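(* Let $k$ and $l$ be two odd integers. For an odd integer $m$ let $X_m$ denote the $3$-manifold which is the mapping torus of the self-homeomorphism of the torus $(S^1)^2=\mathbb R^2/\mathbb Z^2$ induced by the matrix $a_m=\begin{pmatrix}-1 & m\\ 0 & -1\end{pmatrix}$. Then the following holds. (1) $\widehat{\pi_1(X_k)}\cong\widehat{\pi_1(X_l)}$. (2) If $kl\not\equiv 1,7 \pmod 8$, then $\mathbb Z_\infty\pi_1(X_k)\not\cong\mathbb Z_\infty\pi_1(X_l)$. (Here $\cong$ means isomorphism of abstract groups.)
   Context: For a group $G$, the lower central series is $\gamma_1G=G$, $\gamma_{n+1}G=[\gamma_nG,G]$, and the pronilpotent completion is $\widehat G=\varprojlim_n G/\gamma_nG$. The right exact $\mathbb Z$-completion of $G$ is the group $\mathbb Z_\infty G:=\pi_1(\mathbb Z_\infty BG)$, where $BG$ is the classifying space and, for a space $X$, $\mathbb Z_\infty X$ denotes its Bousfield–Kan $\mathbb Z$-completion. For a reduced simplicial set $X_\bullet$ one has $\mathbb Z_\infty X_\bullet\simeq\overline{\mathcal W}(\widehat{\mathcal G X_\bullet})$, where $\mathcal G$ is Kan's loop group functor, $\overline{\mathcal W}$ is its right adjoint (the classifying space of a simplicial group), and $\widehat{\ }$ is applied dimensionwise. The mapping torus of a homeomorphism $f:X\to X$ is $X_f=([0,1]\times X)/((1,x)\sim(0,f(x)))$. The manifold $X_m$ is a $K(G_m,1)$ with $G_m=\mathbb Z\ltimes_{a_m}\mathbb Z^2$, where the generator of $\mathbb Z$ acts on $\mathbb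 Z^2$ by $a_m$. *)

theory Defs
  imports "HOL-Analysis.Analysis" "HOL-Algebra.Generated_Groups" "HOL-Number_Theory.Cong"
begin

section \<open>Quotient spaces, mapping tori and the fundamental group\<close>

text \<open>The quotient of a space by the smallest equivalence relation containing \<open>r\<close>; it is used only
  for relations \<open>r\<close> on the underlying set of the space. Points of the quotient are equivalence
  classes.\<close>

definition quotient_topology :: "'a topology \<Rightarrow> ('a \<times> 'a) set \<Rightarrow> 'a set topology" where
  "quotient_topology X r =
     topology (\<lambda>U. U \<subseteq> topspace X // (r \<union> r\<inverse>)\<^sup>* \<and> openin X (\<Union>U))"

lemma openin_quotient_topology:
  assumes "r \<subseteq> topspace X \<times> topspace X"
  shows "openin (quotient_topology X r) U \<longleftrightarrow>
           U \<subseteq> topspace X // (r \<union> r\<inverse>)\<^sup>* \<and> openin X (\<Union>U)"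
proof -
  let ?E = "(r \<union> r\<inverse>)\<^sup>*"
  have "equiv UNIV ?E"
    by (intro equivI refl_rtrancl trans_rtrancl sym_rtrancl sym_Un_converse) simp
  then have disj: "C = D" if "C \<in> topspace X // ?E" "D \<in> topspace X // ?E" "C \<inter> D \<noteq> {}" for C D
    using quotient_disj[of UNIV ?E C D] that by (auto simp: quotient_def)
  have "istopology (\<lambda>U. U \<subseteq> topspace X // ?E \<and> openin X (\<Union>U))"
    unfolding istopology_def
  proof (intro conjI allI impI; (elim conjE)?)
    fix S T assume S: "S \<subseteq> topspace X // ?E" "openin X (\<Union>S)"
      and T: "T \<subseteq> topspace X // ?E" "openin X (\<Union>T)"
    show "S \<inter> T \<subseteq> topspace X // ?E" using S by blast
    have "\<Union>(S \<inter> T) = \<Union>S \<inter> \<Union>T"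
    proof
      show "\<Union>S \<inter> \<Union>T \<subseteq> \<Union>(S \<inter> T)"
      proof
        fix x assume "x \<in> \<Union>S \<inter> \<Union>T"
        then obtain C D where "C \<in> S" "D \<in> T" "x \<in> C" "x \<in> D" by blast
        moreover from this have "C = D" using disj[of C D] S T by blast
        ultimately show "x \<in> \<Union>(S \<inter> T)" by blast
      qed
    qed blast
    then show "openin X (\<Union>(S \<inter> T))" using S T by (simp add: openin_Int)
  next
    fix K assume K: "\<forall>U\<in>K. U \<subseteq> topspace X // ?E \<and> openin X (\<Union>U)"
    then show "\<Union>K \<subseteq> topspace X // ?E" by blast
    have "\<Union>(\<Union>K) = \<Union>(Union ` K)" by blast
    then show "openin X (\<Union>(\<Union>K))" using K by auto
  qed
  then show ?thesis
    by (simp add: quotient_topology_def)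
qed

definition mapping_torus :: "'a topology \<Rightarrow> ('a \<Rightarrow> 'a) \<Rightarrow> (real \<times> 'a) set topology" where
  "mapping_torus X f =
     quotient_topology (prod_topology (top_of_set {0..1}) X)
       {((1, x), (0, f x)) |x. x \<in> topspace X}"

definition torus :: "(real^2) set topology" where
  "torus = quotient_topology euclidean {(v, w). \<forall>i. (w - v) $ i \<in> \<int>}"

definition matrix_a :: "int \<Rightarrow> real^2^2" where
  "matrix_a m = vector [vector [-1, of_int m], vector [0, -1]]"

text \<open>A matrix in \<open>GL\<^sub>2(\<int>)\<close> maps cosets of \<open>\<int>\<^sup>2\<close> onto cosets, so the induced map of the torus is
  the direct image.\<close>

definition torus_map :: "real^2^2 \<Rightarrow> (real^2) set \<Rightarrow> (real^2) set" where
  "torus_map A C = (\<lambda>v. A *v v) ` C"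

definition manifold_X :: "int \<Rightarrow> (real \<times> (real^2) set) set topology" where
  "manifold_X m = mapping_torus torus (torus_map (matrix_a m))"

definition loops :: "'a topology \<Rightarrow> 'a \<Rightarrow> (real \<Rightarrow> 'a) set" where
  "loops X x = {p. pathin X p \<and> p 0 = x \<and> p 1 = x}"

definition loop_homotopy :: "'a topology \<Rightarrow> 'a \<Rightarrow> ((real \<Rightarrow> 'a) \<times> (real \<Rightarrow> 'a)) set" where
  "loop_homotopy X x =
     {(p, q). homotopic_with (\<lambda>r. r 0 = x \<and> r 1 = x) (top_of_set {0..1}) X p q}"

text \<open>As \<open>joinpaths\<close>, which is restricted to the class of topological spaces.\<close>

definition join_loops :: "(real \<Rightarrow> 'a) \<Rightarrow> (real \<Rightarrow> 'a) \<Rightarrow> real \<Rightarrow> 'a" where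
  "join_loops p q = (\<lambda>t. if t \<le> 1/2 then p (2 * t) else q (2 * t - 1))"

definition fundamental_group :: "'a topology \<Rightarrow> 'a \<Rightarrow> (real \<Rightarrow> 'a) set monoid" where
  "fundamental_group X x =
     \<lparr>carrier = loops X x // loop_homotopy X x,
      mult = (\<lambda>A B. \<Union>p\<in>A. \<Union>q\<in>B. loop_homotopy X x `` {join_loops p q}),
      one = loop_homotopy X x `` {\<lambda>_. x}\<rparr>"


section \<open>Pronilpotent completion\<close>

text \<open>Indices are shifted: \<open>lower_central G n\<close> is \<open>\<gamma>\<^sub>n\<^sub>+\<^sub>1 G\<close>.\<close>

primrec lower_central :: "'a monoid \<Rightarrow> nat \<Rightarrow> 'a set" where
  "lower_central G 0 = carrier G"
| "lower_central G (Suc n) =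
     generate G {x \<otimes>\<^bsub>G\<^esub> y \<otimes>\<^bsub>G\<^esub> inv\<^bsub>G\<^esub> x \<otimes>\<^bsub>G\<^esub> inv\<^bsub>G\<^esub> y |x y. x \<in> lower_central G n \<and> y \<in> carrier G}"

text \<open>An element of the inverse limit is a sequence of cosets. The projection
  \<open>G/\<gamma>\<^sub>n\<^sub>+\<^sub>1 G \<rightarrow> G/\<gamma>\<^sub>n G\<close> sends a coset to the unique coset of \<open>\<gamma>\<^sub>n G\<close> containing it.\<close>

definition pronilpotent_completion :: "'a monoid \<Rightarrow> (nat \<Rightarrow> 'a set) monoid" where
  "pronilpotent_completion G =
     \<lparr>carrier = {f. (\<forall>n. f n \<in> carrier (G Mod lower_central G n)) \<and> (\<forall>n. f (Suc n) \<subseteq> f n)},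
      mult = (\<lambda>f g n. f n \<otimes>\<^bsub>G Mod lower_central G n\<^esub> g n),
      one = (\<lambda>n. \<one>\<^bsub>G Mod lower_central G n\<^esub>)\<rparr>"

text \<open>The homomorphism of completions induced by \<open>h : G \<rightarrow> H\<close>; only the target enters the formula.\<close>

definition completion_map :: "'b monoid \<Rightarrow> ('a \<Rightarrow> 'b) \<Rightarrow> (nat \<Rightarrow> 'a set) \<Rightarrow> nat \<Rightarrow> 'b set" where
  "completion_map H h f = (\<lambda>n. lower_central H n <#>\<^bsub>H\<^esub> (h ` f n))"


section \<open>Free groups\<close>

text \<open>Elements are reduced words; the letter \<open>(True, x)\<close> is the generator \<open>x\<close> and \<open>(False, x)\<close> its
  inverse.\<close>

fun cons_letter :: "bool \<times> 'a \<Rightarrow> (bool \<times> 'a) list \<Rightarrow> (bool \<times> 'a) list" where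
  "cons_letter a [] = [a]"
| "cons_letter a (b # w) = (if snd b = snd a \<and> fst b \<noteq> fst a then w else a # b # w)"

definition reduce_word :: "(bool \<times> 'a) list \<Rightarrow> (bool \<times> 'a) list" where
  "reduce_word w = foldr cons_letter w []"

definition free_group :: "'a set \<Rightarrow> (bool \<times> 'a) list monoid" where
  "free_group S =
     \<lparr>carrier = {w \<in> lists (UNIV \<times> S). reduce_word w = w},
      mult = (\<lambda>u v. reduce_word (u @ v)),
      one = []\<rparr>"

definition free_extension :: "'b monoid \<Rightarrow> ('a \<Rightarrow> 'b) \<Rightarrow> (bool \<times> 'a) list \<Rightarrow> 'b" where
  "free_extension H g w =
     foldr (\<lambda>(b, x) y. (if b then g x else inv\<^bsub>H\<^esub> (g x)) \<otimes>\<^bsub>H\<^esub> y) w \<one>\<^bsub>H\<^esub>"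


section \<open>Simplicial sets and simplicial groups\<close>

text \<open>\<open>face K n i\<close> is \<open>d\<^sub>i : K\<^sub>n \<rightarrow> K\<^sub>n\<^sub>-\<^sub>1\<close> and \<open>degen K n i\<close> is \<open>s\<^sub>i : K\<^sub>n \<rightarrow> K\<^sub>n\<^sub>+\<^sub>1\<close>, and likewise for
  simplicial groups. The simplicial identities are not part of the types; all constructions below
  produce and preserve them.\<close>

record 'a simp_set =
  simplices :: "nat \<Rightarrow> 'a set"
  face :: "nat \<Rightarrow> nat \<Rightarrow> 'a \<Rightarrow> 'a"
  degen :: "nat \<Rightarrow> nat \<Rightarrow> 'a \<Rightarrow> 'a"

record 'a simp_group =
  level :: "nat \<Rightarrow> 'a monoid"
  gface :: "nat \<Rightarrow> nat \<Rightarrow> 'a \<Rightarrow> 'a"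
  gdegen :: "nat \<Rightarrow> nat \<Rightarrow> 'a \<Rightarrow> 'a"

text \<open>The functor \<open>W-bar\<close>. An \<open>n\<close>-simplex is a list \<open>(g\<^sub>n\<^sub>-\<^sub>1, \<dots>, g\<^sub>0)\<close> with \<open>g\<^sub>j \<in> H\<^sub>j\<close>, so its entry at
  list position \<open>j\<close> lies in \<open>H\<^bsub>n-1-j\<^esub>\<close>, and
  \<open>d\<^sub>0 (g\<^sub>n\<^sub>-\<^sub>1, \<dots>, g\<^sub>0) = (g\<^sub>n\<^sub>-\<^sub>2, \<dots>, g\<^sub>0)\<close>,
  \<open>d\<^sub>i (g\<^sub>n\<^sub>-\<^sub>1, \<dots>, g\<^sub>0) = (d\<^sub>i\<^sub>-\<^sub>1 g\<^sub>n\<^sub>-\<^sub>1, \<dots>, d\<^sub>1 g\<^bsub>n-i+1\<^esub>, d\<^sub>0 g\<^bsub>n-i\<^esub> \<cdot> g\<^bsub>n-i-1\<^esub>, g\<^bsub>n-i-2\<^esub>, \<dots>, g\<^sub>0)\<close> for \<open>0 < i < n\<close>,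
  \<open>d\<^sub>n (g\<^sub>n\<^sub>-\<^sub>1, \<dots>, g\<^sub>0) = (d\<^sub>n\<^sub>-\<^sub>1 g\<^sub>n\<^sub>-\<^sub>1, \<dots>, d\<^sub>1 g\<^sub>1)\<close>,
  \<open>s\<^sub>i (g\<^sub>n\<^sub>-\<^sub>1, \<dots>, g\<^sub>0) = (s\<^sub>i\<^sub>-\<^sub>1 g\<^sub>n\<^sub>-\<^sub>1, \<dots>, s\<^sub>0 g\<^bsub>n-i\<^esub>, 1, g\<^bsub>n-i-1\<^esub>, \<dots>, g\<^sub>0)\<close>.\<close>

definition Wbar :: "'a simp_group \<Rightarrow> 'a list simp_set" where
  "Wbar H =
     \<lparr>simplices = (\<lambda>n. {xs. length xs = n \<and> (\<forall>j<n. xs ! j \<in> carrier (level H (n - 1 - j)))}),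
      face = (\<lambda>n i xs.
        if i = 0 then tl xs
        else if i < n then
          map (\<lambda>j. gface H (n - 1 - j) (i - 1 - j) (xs ! j)) [0..<i - 1]
          @ [gface H (n - i) 0 (xs ! (i - 1)) \<otimes>\<^bsub>level H (n - i - 1)\<^esub> xs ! i]
          @ drop (i + 1) xs
        else map (\<lambda>j. gface H (n - 1 - j) (n - 1 - j) (xs ! j)) [0..<n - 1]),
      degen = (\<lambda>n i xs.
        map (\<lambda>j. gdegen H (n - 1 - j) (i - 1 - j) (xs ! j)) [0..<i]
        @ [\<one>\<^bsub>level H (n - i)\<^esub>] @ drop i xs)\<rparr>"

text \<open>The classifying space of a group: on a constant simplicial group, \<open>W-bar\<close> is literally the
  nerve (bar construction), with \<open>n\<close>-simplices \<open>[g\<^sub>1 | \<dots> | g\<^sub>n]\<close>.\<close>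

definition classifying_space :: "'a monoid \<Rightarrow> 'a list simp_set" where
  "classifying_space G = Wbar \<lparr>level = (\<lambda>_. G), gface = (\<lambda>_ _ x. x), gdegen = (\<lambda>_ _ x. x)\<rparr>"

text \<open>Kan's loop group of a reduced simplicial set: \<open>(\<G>X)\<^sub>n\<close> is generated by \<open>X\<^sub>n\<^sub>+\<^sub>1\<close> subject to the
  relations \<open>s\<^sub>0 x = 1\<close> for \<open>x \<in> X\<^sub>n\<close>, that is, free on \<open>X\<^sub>n\<^sub>+\<^sub>1 - s\<^sub>0 X\<^sub>n\<close>. Writing \<open>\<tau> x\<close> for the class of
  \<open>x\<close>, \<open>d\<^sub>0 (\<tau> x) = \<tau> (d\<^sub>1 x) (\<tau> (d\<^sub>0 x))\<inverse>\<close>, \<open>d\<^sub>i (\<tau> x) = \<tau> (d\<^sub>i\<^sub>+\<^sub>1 x)\<close> for \<open>i > 0\<close>, and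
  \<open>s\<^sub>i (\<tau> x) = \<tau> (s\<^sub>i\<^sub>+\<^sub>1 x)\<close>. This is the sign convention for which the functor is left adjoint to
  \<open>Wbar\<close> above.\<close>

definition loop_level :: "'a simp_set \<Rightarrow> nat \<Rightarrow> (bool \<times> 'a) list monoid" where
  "loop_level X n = free_group (simplices X (Suc n) - degen X n 0 ` simplices X n)"

definition loop_gen :: "'a simp_set \<Rightarrow> nat \<Rightarrow> 'a \<Rightarrow> (bool \<times> 'a) list" where
  "loop_gen X n x = (if x \<in> degen X n 0 ` simplices X n then [] else [(True, x)])"

definition loop_group :: "'a simp_set \<Rightarrow> (bool \<times> 'a) list simp_group" where
  "loop_group X =
     \<lparr>level = loop_level X,
      gface = (\<lambda>n i. free_extension (loop_level X (n - 1)) (\<lambda>x.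
        if i = 0
        then loop_gen X (n - 1) (face X (Suc n) 1 x)
               \<otimes>\<^bsub>loop_level X (n - 1)\<^esub>
             inv\<^bsub>loop_level X (n - 1)\<^esub> (loop_gen X (n - 1) (face X (Suc n) 0 x))
        else loop_gen X (n - 1) (face X (Suc n) (Suc i) x))),
      gdegen = (\<lambda>n i. free_extension (loop_level X (Suc n)) (\<lambda>x.
        loop_gen X (Suc n) (degen X (Suc n) (Suc i) x)))\<rparr>"

definition simp_completion :: "'a simp_group \<Rightarrow> (nat \<Rightarrow> 'a set) simp_group" where
  "simp_completion H =
     \<lparr>level = (\<lambda>n. pronilpotent_completion (level H n)),
      gface = (\<lambda>n i. completion_map (level H (n - 1)) (gface H n i)),
      gdegen = (\<lambda>n i. completion_map (level H (Suc n)) (gdegen H n i))\<rparr>"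

text \<open>The fundamental group of a Kan complex \<open>K\<close> at a vertex \<open>v\<close> (\<open>Wbar\<close> of a simplicial group is a
  Kan complex): classes of edges from \<open>v\<close> to \<open>v\<close>, where \<open>[d\<^sub>2 z] \<cdot> [d\<^sub>0 z] = [d\<^sub>1 z]\<close> for each
  2-simplex \<open>z\<close> with edges of this kind.\<close>

definition simp_loops :: "'a simp_set \<Rightarrow> 'a \<Rightarrow> 'a set" where
  "simp_loops K v = {x \<in> simplices K 1. face K 1 0 x = v \<and> face K 1 1 x = v}"

definition simp_homotopy :: "'a simp_set \<Rightarrow> 'a \<Rightarrow> ('a \<times> 'a) set" where
  "simp_homotopy K v =
     {(x, y). x \<in> simp_loops K v \<and> y \<in> simp_loops K v \<and>
        (\<exists>z \<in> simplices K 2.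
           face K 2 0 z = degen K 0 0 v \<and> face K 2 1 z = x \<and> face K 2 2 z = y)}"

definition simp_fundamental_group :: "'a simp_set \<Rightarrow> 'a \<Rightarrow> 'a set monoid" where
  "simp_fundamental_group K v =
     \<lparr>carrier = simp_loops K v // simp_homotopy K v,
      mult = (\<lambda>A B. \<Union>z \<in> {z \<in> simplices K 2. face K 2 2 z \<in> A \<and> face K 2 0 z \<in> B}.
        simp_homotopy K v `` {face K 2 1 z}),
      one = simp_homotopy K v `` {degen K 0 0 v}\<rparr>"


section \<open>The right exact integral completion\<close>

text \<open>The Bousfield-Kan \<open>\<int>\<close>-completion of a reduced simplicial set, in its loop group model
  \<open>\<int>\<^sub>\<infinity> X = Wbar ((\<G>X)^)\<close> with the pronilpotent completion applied dimensionwise. It is again reduced;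
  its only vertex is the empty list.\<close>

definition bousfield_kan_Z ::
    "'a simp_set \<Rightarrow> (nat \<Rightarrow> (bool \<times> 'a) list set) list simp_set" where
  "bousfield_kan_Z X = Wbar (simp_completion (loop_group X))"

definition right_exact_Z_completion ::
    "'a monoid \<Rightarrow> (nat \<Rightarrow> (bool \<times> 'a list) list set) list set monoid" where
  "right_exact_Z_completion G = simp_fundamental_group (bousfield_kan_Z (classifying_space G)) []"

end

theory Submission
  imports Defs
begin

text \<open>
  The manifold \<open>X\<^sub>m\<close> is the quotient of \<open>\<real> \<times> \<real>\<^sup>2\<close> by a free action of \<open>G\<^sub>m = \<int> \<ltimes> \<int>\<^sup>2\<close>, so covering
  theory gives \<open>\<pi>\<^sub>1 X\<^sub>m = G\<^sub>m\<close>. The subgroups \<open>(a\<^sub>m - 1)\<^sup>n \<int>\<^sup>2\<close> define the 2-adic topology on \<open>\<int>\<^sup>2\<close>,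
  hence the pronilpotent completion is \<open>\<int> \<ltimes> \<int>\<^sub>2\<^sup>2\<close> with \<open>\<int>\<^sub>2\<close> the 2-adic integers, and since \<open>l / k\<close> is a
  2-adic unit, \<open>diag (l / k, 1)\<close> conjugates \<open>a\<^sub>k\<close> to \<open>a\<^sub>l\<close>.

  The right exact completion \<open>E\<close> of \<open>G\<^sub>m\<close> is the group of components of the dimensionwise completed
  loop group. It maps onto \<open>\<int> \<ltimes> \<int>\<^sub>2\<^sup>2\<close>. Because \<open>G\<^sub>m\<close> is finitely generated, the kernel of this map is the
  intersection of the lower central series of \<open>E\<close>, hence preserved by isomorphisms. The central
  extension of \<open>G\<^sub>m\<close> by \<open>\<int>\<close> with cocycle \<open>det (v, a\<^sup>n w)\<close> shows that lifts of \<open>v, w \<in> \<int>\<^sub>2\<^sup>2\<close> to \<open>E\<close> can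
  commute only if \<open>det (v, w) \<in> \<int>\<close>, whereas the standard basis has commuting lifts coming from \<open>G\<^sub>m\<close>.
  An isomorphism for \<open>k\<close> and \<open>l\<close> therefore induces a 2-adic matrix \<open>P\<close> with \<open>P a\<^sub>k = a\<^sub>l\<^sup>\<plusminus>\<^sup>1 P\<close> whose
  determinant and its inverse are integers. So \<open>P\<close> is upper triangular with diagonal \<open>p, s\<close>, where
  \<open>p s = \<plusminus>1\<close> and \<open>k p = \<plusminus>l s\<close>. Thus \<open>k = \<plusminus>l s\<^sup>2\<close>, and odd squares are \<open>1\<close> modulo \<open>8\<close>.
\<close>

section \<open>The lower central series\<close>

text \<open>Only simplicial degrees 0 and 1 of the loop group matter, because the fundamental group
  of \<open>Wbar H\<close> is \<open>level H 0\<close> modulo the two faces of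
  \<open>level H 1\<close>. The obstruction in part (2) is a mismatch between these degrees. The
  homomorphism from completed degree 0 to the central extension has a 2-adic central coordinate, but
  a homotopy in degree 1 changes it through a homomorphism to the integers. These are abelian, so
  their lower central series stops at once and completing adds no new values: the coordinate is
  defined modulo the integers, not modulo the 2-adic integers.

  An abstract isomorphism need not respect any topology. What is compared is therefore recovered
  algebraically: the kernel as an intersection of abstract lower central terms, the matrix from the
  fact that additive maps of the 2-adic integers are linear. Degree 0 is free of infinite rank,
  where the abstract lower central series of the completion is hard to control; a multiplicative
  homotopy moves the question into a finitely generated subgroup.\<close>

definition gcomm :: "'a monoid \<Rightarrow> 'a \<Rightarrow> 'a \<Rightarrow> 'a" where
  "gcomm G x y = x \<otimes>\<^bsub>G\<^esub> y \<otimes>\<^bsub>G\<^esub> inv\<^bsub>G\<^esub> x \<otimes>\<^bsub>G\<^esub> inv\<^bsub>G\<^esub> y"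

text \<open>Restricts \<open>group\<close> to records without extension fields, the type on which
  \<open>lower_central\<close> and \<open>pronilpotent_completion\<close> are defined.\<close>

locale plain_group = group G for G :: "'a monoid" (structure)
begin

lemma cancel_left:
  assumes "x \<in> carrier G" "y \<in> carrier G"
  shows "x \<otimes> (inv x \<otimes> y) = y" and "inv x \<otimes> (x \<otimes> y) = y"
  using assms by (simp_all flip: m_assoc)

lemmas word_simps = m_assoc inv_mult_group cancel_left

abbreviation comm :: "'a \<Rightarrow> 'a \<Rightarrow> 'a" where
  "comm \<equiv> gcomm G"

lemmas comm_def = gcomm_def[of G]

lemma comm_closed [simp, intro]: "x \<in> carrier G \<Longrightarrow> y \<in> carrier G \<Longrightarrow> comm x y \<in> carrier G"
  by (simp add: comm_def)

lemma comm_one_right [simp]: "x \<in> carrier G \<Longrightarrow> comm x \<one> = \<one>"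
  by (simp add: comm_def)

lemma mult_comm_swap:
  assumes "x \<in> carrier G" "y \<in> carrier G"
  shows "x \<otimes> y = comm x y \<otimes> (y \<otimes> x)"
  using assms by (simp add: comm_def word_simps)

lemma lower_central_Suc:
  "lower_central G (Suc n) = generate G {comm x y |x y. x \<in> lower_central G n \<and> y \<in> carrier G}"
  by (simp add: comm_def)

text \<open>Conjugation is an automorphism and carries \<open>comm x y\<close> to the commutator of
  the conjugates, so each generating set is stable under conjugation as soon as the preceding term
  is normal.\<close>

lemma lower_central_normal: "lower_central G n \<lhd> G"
proof (induction n)
  case 0
  show ?case
    using subgroup_self by (simp add: normal_inv_iff)
next
  case (Suc n)
  interpret N: normal "lower_central G n" G by (fact Suc)
  show ?case
    unfolding lower_central_Suc
  proof (rule normal_generateI)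
    show "{comm x y |x y. x \<in> lower_central G n \<and> y \<in> carrier G} \<subseteq> carrier G"
      using N.subset by auto
    fix h g assume "h \<in> {comm x y |x y. x \<in> lower_central G n \<and> y \<in> carrier G}" and g: "g \<in> carrier G"
    then obtain x y where h: "h = comm x y" "x \<in> lower_central G n" "y \<in> carrier G" by auto
    then have x: "x \<in> carrier G" using N.subset by auto
    have "g \<otimes> h \<otimes> inv g = comm (g \<otimes> x \<otimes> inv g) (g \<otimes> y \<otimes> inv g)"
      using x g h by (simp add: comm_def word_simps)
    moreover have "g \<otimes> x \<otimes> inv g \<in> lower_central G n"
      using N.inv_op_closed2 g h by simp
    ultimately show "g \<otimes> h \<otimes> inv g \<in> {comm x y |x y. x \<in> lower_central G n \<and> y \<in> carrier G}"
      using g h by auto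
  qed
qed

lemma lower_central_subgroup: "subgroup (lower_central G n) G"
  by (rule normal_imp_subgroup[OF lower_central_normal])

lemma lower_central_carrier: "x \<in> lower_central G n \<Longrightarrow> x \<in> carrier G"
  using subgroup.subset[OF lower_central_subgroup] by blast

lemma lower_central_one [simp, intro]: "\<one> \<in> lower_central G n"
  by (rule subgroup.one_closed[OF lower_central_subgroup])

lemma lower_central_mult: "x \<in> lower_central G n \<Longrightarrow> y \<in> lower_central G n \<Longrightarrow> x \<otimes> y \<in> lower_central G n"
  by (rule subgroup.m_closed[OF lower_central_subgroup])

lemma lower_central_inv: "x \<in> lower_central G n \<Longrightarrow> inv x \<in> lower_central G n"
  by (rule subgroup.m_inv_closed[OF lower_central_subgroup])

lemma lower_central_conj:
  "x \<in> lower_central G n \<Longrightarrow> g \<in> carrier G \<Longrightarrow> g \<otimes> x \<otimes> inv g \<in> lower_central G n"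
  by (rule normal.inv_op_closed2[OF lower_central_normal])

lemma comm_in_lower_central:
  assumes "x \<in> lower_central G n" "y \<in> carrier G"
  shows "comm x y \<in> lower_central G (Suc n)"
  unfolding lower_central_Suc by (rule generate.incl) (use assms in blast)

lemma lower_central_Suc_subset: "lower_central G (Suc n) \<subseteq> lower_central G n"
  unfolding lower_central_Suc
proof (rule generate_subgroup_incl[OF _ lower_central_subgroup], safe)
  fix x y assume x: "x \<in> lower_central G n" and y: "y \<in> carrier G"
  have xc: "x \<in> carrier G" using lower_central_carrier x by blast
  have "comm x y = x \<otimes> (y \<otimes> inv x \<otimes> inv y)"
    using xc y by (simp add: comm_def word_simps)
  then show "comm x y \<in> lower_central G n"
    using lower_central_mult[OF x lower_central_conj[OF lower_central_inv[OF x] y]] by simp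
qed

lemma lower_central_antimono: "m \<le> n \<Longrightarrow> lower_central G n \<subseteq> lower_central G m"
  using lift_Suc_antimono_le[of "lower_central G"] lower_central_Suc_subset by blast

section \<open>Congruence modulo a term of the lower central series\<close>

definition lcong :: "nat \<Rightarrow> 'a \<Rightarrow> 'a \<Rightarrow> bool" where
  "lcong n g h \<longleftrightarrow> g \<in> carrier G \<and> h \<in> carrier G \<and> g \<otimes> inv h \<in> lower_central G n"

lemma lcong_refl [simp]: "g \<in> carrier G \<Longrightarrow> lcong n g g"
  by (simp add: lcong_def)

lemma lcong_carrier: "lcong n g h \<Longrightarrow> g \<in> carrier G" "lcong n g h \<Longrightarrow> h \<in> carrier G"
  by (simp_all add: lcong_def)

lemma lcong_sym:
  assumes "lcong n g h" shows "lcong n h g"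
proof -
  have "inv (g \<otimes> inv h) = h \<otimes> inv g"
    using assms by (simp add: lcong_def inv_mult_group)
  then show ?thesis
    using assms lower_central_inv[of "g \<otimes> inv h" n] by (simp add: lcong_def)
qed

lemma lcong_trans [trans]:
  assumes "lcong n f g" "lcong n g h" shows "lcong n f h"
proof -
  have "f \<otimes> inv h = (f \<otimes> inv g) \<otimes> (g \<otimes> inv h)"
    using assms by (simp add: lcong_def word_simps)
  then show ?thesis
    using assms lower_central_mult by (simp add: lcong_def)
qed

lemma lcong_mult:
  assumes "lcong n g h" "lcong n g' h'" shows "lcong n (g \<otimes> g') (h \<otimes> h')"
proof -
  have "(g \<otimes> g') \<otimes> inv (h \<otimes> h') = (g \<otimes> (g' \<otimes> inv h') \<otimes> inv g) \<otimes> (g \<otimes> inv h)"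
    using assms by (simp add: lcong_def word_simps)
  then show ?thesis
    using assms lower_central_mult lower_central_conj by (simp add: lcong_def)
qed

lemma lcong_inv:
  assumes "lcong n g h" shows "lcong n (inv g) (inv h)"
proof -
  have "inv g \<otimes> inv (inv h) = inv g \<otimes> (h \<otimes> inv g) \<otimes> inv (inv g)"
    using assms by (simp add: lcong_def word_simps)
  then show ?thesis
    using assms lcong_sym[OF assms] lower_central_conj[of "h \<otimes> inv g" n "inv g"] by (simp add: lcong_def)
qed

lemma lcong_mono: "lcong n g h \<Longrightarrow> m \<le> n \<Longrightarrow> lcong m g h"
  using lower_central_antimono by (auto simp: lcong_def)

lemma lcong_one_iff: "lcong n g \<one> \<longleftrightarrow> g \<in> lower_central G n"
  using lower_central_carrier by (auto simp: lcong_def)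

lemma lcong_mult_left:
  assumes "c \<in> lower_central G n" "g \<in> carrier G" shows "lcong n (c \<otimes> g) g"
  using assms lower_central_carrier[OF assms(1)] by (simp add: lcong_def word_simps)

lemma lcong_mult_right:
  assumes "c \<in> lower_central G n" "g \<in> carrier G" shows "lcong n (g \<otimes> c) g"
  using lower_central_conj[OF assms] lower_central_carrier[OF assms(1)] assms by (simp add: lcong_def)

lemma mem_lower_central_coset:
  "g \<in> lower_central G n #> h \<longleftrightarrow> lcong n g h" if "h \<in> carrier G"
proof
  assume "g \<in> lower_central G n #> h"
  then obtain c where "c \<in> lower_central G n" "g = c \<otimes> h" by (auto simp: r_coset_def)
  then show "lcong n g h"
    using lcong_mult_left that by simp
next
  assume *: "lcong n g h"
  then have "g = (g \<otimes> inv h) \<otimes> h"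
    by (simp add: lcong_def word_simps)
  then show "g \<in> lower_central G n #> h"
    using * by (auto simp: r_coset_def lcong_def)
qed

end

section \<open>Functoriality of the lower central series\<close>

lemma hom_lower_central:
  assumes "group G" "group H" "h \<in> hom G H" "x \<in> lower_central G n"
  shows "h x \<in> lower_central H n"
proof -
  interpret G: plain_group G by (rule plain_group.intro) fact
  interpret H: plain_group H by (rule plain_group.intro) fact
  interpret h: group_hom G H h using assms by (simp add: group_hom_def group_hom_axioms_def)
  show ?thesis using assms(4)
  proof (induction n arbitrary: x)
    case 0
    then show ?case by simp
  next
    case (Suc n)
    have sub: "{G.comm x y |x y. x \<in> lower_central G n \<and> y \<in> carrier G} \<subseteq> carrier G"
      using G.lower_central_carrier by auto
    have "h ` generate G {G.comm x y |x y. x \<in> lower_central G n \<and> y \<in> carrier G}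
        = generate H (h ` {G.comm x y |x y. x \<in> lower_central G n \<and> y \<in> carrier G})"
      using h.generate_img[OF sub] by simp
    also have "\<dots> \<subseteq> lower_central H (Suc n)"
      unfolding H.lower_central_Suc
    proof (rule H.mono_generate, safe)
      fix x y assume x: "x \<in> lower_central G n" and y: "y \<in> carrier G"
      then have "h (G.comm x y) = H.comm (h x) (h y)"
        using G.lower_central_carrier[OF x] by (simp add: G.comm_def H.comm_def)
      then show "\<exists>x' y'. h (G.comm x y) = H.comm x' y' \<and> x' \<in> lower_central H n \<and> y' \<in> carrier H"
        using Suc.IH[OF x] h.hom_closed[OF y] by blast
    qed
    finally show ?case
      using Suc.prems G.lower_central_Suc by auto
  qed
qed

text \<open>Both entries of a generating commutator can be lifted, the deep one by induction; so the
  generators of the target term are images of generators.\<close>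

lemma hom_lower_central_surj:
  assumes "group G" "group H" "h \<in> hom G H" "h ` carrier G = carrier H" "y \<in> lower_central H n"
  shows "\<exists>x\<in>lower_central G n. h x = y"
proof -
  interpret G: plain_group G by (rule plain_group.intro) fact
  interpret H: plain_group H by (rule plain_group.intro) fact
  interpret h: group_hom G H h using assms by (simp add: group_hom_def group_hom_axioms_def)
  show ?thesis using assms(5)
  proof (induction n arbitrary: y)
    case 0
    then show ?case using assms(4) by (metis imageE lower_central.simps(1))
  next
    case (Suc n)
    have sub: "{G.comm x y |x y. x \<in> lower_central G n \<and> y \<in> carrier G} \<subseteq> carrier G"
      using G.lower_central_carrier by auto
    have "lower_central H (Suc n) \<subseteq> generate H (h ` {G.comm x y |x y. x \<in> lower_central G n \<and> y \<in> carrier G})"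
      unfolding H.lower_central_Suc
    proof (rule H.mono_generate, safe)
      fix x y assume x: "x \<in> lower_central H n" and y: "y \<in> carrier H"
      obtain x' where x': "x' \<in> lower_central G n" "h x' = x" using Suc.IH x by blast
      obtain y' where y': "y' \<in> carrier G" "h y' = y" using y assms(4) by (metis imageE)
      have "h (G.comm x' y') = H.comm x y"
        using x' y' G.lower_central_carrier[OF x'(1)] by (simp add: G.comm_def H.comm_def)
      then show "H.comm x y \<in> h ` {G.comm x y |x y. x \<in> lower_central G n \<and> y \<in> carrier G}"
        using x' y' by (metis (mono_tags, lifting) image_eqI mem_Collect_eq)
    qed
    also have "\<dots> = h ` lower_central G (Suc n)"
      unfolding G.lower_central_Suc by (rule h.generate_img[OF sub])
    finally show ?case
      using Suc.prems by auto
  qed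
qed

lemma hom_lcong:
  assumes "group G" "group H" "h \<in> hom G H" "plain_group.lcong G n x y"
  shows "plain_group.lcong H n (h x) (h y)"
proof -
  interpret G: plain_group G by (rule plain_group.intro) fact
  interpret H: plain_group H by (rule plain_group.intro) fact
  interpret h: group_hom G H h using assms by (simp add: group_hom_def group_hom_axioms_def)
  show ?thesis
    using assms(4) hom_lower_central[OF assms(1-3), of "x \<otimes>\<^bsub>G\<^esub> inv\<^bsub>G\<^esub> y" n]
    by (simp add: G.lcong_def H.lcong_def)
qed

section \<open>Pronilpotent completions\<close>

context plain_group
begin

abbreviation compl :: "(nat \<Rightarrow> 'a set) monoid" where
  "compl \<equiv> pronilpotent_completion G"

lemma compl_cases:
  assumes "x \<in> carrier compl"
  obtains g where "g \<in> carrier G" "x n = lower_central G n #> g"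
proof -
  have "x n \<in> rcosets (lower_central G n)"
    using assms by (simp add: pronilpotent_completion_def FactGroup_def)
  then show thesis using that by (auto simp: RCOSETS_def)
qed

lemma compl_nonempty:
  assumes "x \<in> carrier compl" shows "\<exists>g. g \<in> x n"
  using compl_cases[OF assms, of n] mem_lower_central_coset lcong_refl by metis

lemma compl_mem_carrier:
  assumes "x \<in> carrier compl" "g \<in> x n" shows "g \<in> carrier G"
  using compl_cases[OF assms(1), of n] assms(2) mem_lower_central_coset lcong_carrier by metis

lemma compl_mem_iff:
  assumes "x \<in> carrier compl" "g \<in> x n" shows "h \<in> x n \<longleftrightarrow> lcong n h g"
  using compl_cases[OF assms(1), of n] assms(2) mem_lower_central_coset lcong_trans lcong_sym by metis

lemma compl_mem_antimono:
  assumes "x \<in> carrier compl" "g \<in> x n" "m \<le> n" shows "g \<in> x m"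
proof -
  have "\<And>n. x (Suc n) \<subseteq> x n"
    using assms(1) by (simp add: pronilpotent_completion_def)
  then have "x n \<subseteq> x m" using lift_Suc_antimono_le[of x m n] assms(3) by blast
  then show ?thesis using assms(2) by blast
qed

lemma compl_mult_mem:
  assumes "g \<in> x n" "h \<in> y n"
  shows "g \<otimes> h \<in> (x \<otimes>\<^bsub>compl\<^esub> y) n"
  using assms by (auto simp: pronilpotent_completion_def FactGroup_def set_mult_def)

lemma compl_one_mem_iff: "g \<in> \<one>\<^bsub>compl\<^esub> n \<longleftrightarrow> g \<in> lower_central G n"
  by (simp add: pronilpotent_completion_def)

text \<open>Cosets of the same subgroup with a common element coincide. An identity in the
  completion thus reduces to one common representative per level, which is computed in
  \<open>G\<close>.\<close>

lemma compl_eqI: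
  assumes "x \<in> carrier compl" "y \<in> carrier compl" "\<And>n. \<exists>g. g \<in> x n \<and> g \<in> y n"
  shows "x = y"
proof
  fix n
  obtain g where "g \<in> x n" "g \<in> y n" using assms(3) by blast
  then show "x n = y n"
    using compl_mem_iff assms(1,2) by blast
qed

text \<open>The limit of a sequence that is Cauchy for the lower central filtration; a constant
  sequence gives the canonical map from \<open>G\<close> to its completion.\<close>

definition compl_lim :: "(nat \<Rightarrow> 'a) \<Rightarrow> nat \<Rightarrow> 'a set" where
  "compl_lim s n = {g. lcong n g (s n)}"

lemma
  assumes "\<And>n. s n \<in> carrier G" "\<And>n. lcong n (s (Suc n)) (s n)"
  shows compl_lim_closed: "compl_lim s \<in> carrier compl"
    and compl_lim_mem: "s n \<in> compl_lim s n"
proof -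
  have "compl_lim s n = lower_central G n #> s n" for n
    using mem_lower_central_coset[OF assms(1)] by (auto simp: compl_lim_def)
  then have "compl_lim s n \<in> carrier (G Mod lower_central G n)" for n
    using assms(1) by (auto simp: FactGroup_def RCOSETS_def)
  moreover have "compl_lim s (Suc n) \<subseteq> compl_lim s n" for n
    using lcong_mono[of "Suc n" _ _ n] lcong_trans assms(2) by (fastforce simp: compl_lim_def)
  ultimately show "compl_lim s \<in> carrier compl"
    by (simp add: pronilpotent_completion_def)
  show "s n \<in> compl_lim s n"
    using assms(1) by (simp add: compl_lim_def)
qed

lemma compl_mult_closed:
  assumes x: "x \<in> carrier compl" and y: "y \<in> carrier compl"
  shows "x \<otimes>\<^bsub>compl\<^esub> y \<in> carrier compl"
proof -
  have "(x \<otimes>\<^bsub>compl\<^esub> y) n \<in> carrier (G Mod lower_central G n)" for n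
  proof -
    interpret N: group "G Mod lower_central G n"
      using lower_central_normal by (rule normal.factorgroup_is_group)
    show ?thesis
      using N.m_closed[of "x n" "y n"] x y by (simp add: pronilpotent_completion_def)
  qed
  moreover have "(x \<otimes>\<^bsub>compl\<^esub> y) (Suc n) \<subseteq> (x \<otimes>\<^bsub>compl\<^esub> y) n" for n
    using x y by (auto simp: pronilpotent_completion_def FactGroup_def set_mult_def) blast
  ultimately show ?thesis
    by (simp add: pronilpotent_completion_def)
qed

lemma compl_of_closed: "g \<in> carrier G \<Longrightarrow> compl_lim (\<lambda>_. g) \<in> carrier compl"
  and compl_of_mem: "g \<in> carrier G \<Longrightarrow> g \<in> compl_lim (\<lambda>_. g) n"
  using compl_lim_closed[of "\<lambda>_. g"] compl_lim_mem[of "\<lambda>_. g"] by simp_all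

lemma compl_one_closed: "\<one>\<^bsub>compl\<^esub> \<in> carrier compl"
  and compl_of_one: "compl_lim (\<lambda>_. \<one>) = \<one>\<^bsub>compl\<^esub>"
proof -
  have "compl_lim (\<lambda>_. \<one>) n = \<one>\<^bsub>compl\<^esub> n" for n
    using compl_one_mem_iff by (auto simp: compl_lim_def lcong_one_iff)
  then show "compl_lim (\<lambda>_. \<one>) = \<one>\<^bsub>compl\<^esub>" by blast
  then show "\<one>\<^bsub>compl\<^esub> \<in> carrier compl" using compl_of_closed[of \<one>] by simp
qed

text \<open>Representatives are inverted level by level. The effect on representatives is recorded
  together with the inverse law, so that \<open>inv\<close> can be identified once the group axioms
  hold.\<close>

lemma compl_inv_ex:
  assumes x: "x \<in> carrier compl"
  shows "\<exists>y\<in>carrier compl. (\<forall>n. \<forall>g\<in>x n. inv g \<in> y n) \<and> y \<otimes>\<^bsub>compl\<^esub> x = \<one>\<^bsub>compl\<^esub>"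
proof -
  define s where "s n = (SOME g. g \<in> x n)" for n
  have s: "s n \<in> x n" for n
    unfolding s_def using compl_nonempty[OF x] by (rule someI_ex)
  have sc: "s n \<in> carrier G" for n using compl_mem_carrier[OF x s] .
  have cong: "lcong n (s (Suc n)) (s n)" for n
    using compl_mem_iff[OF x s] compl_mem_antimono[OF x s, of n "Suc n"] by simp
  let ?y = "compl_lim (\<lambda>n. inv (s n))"
  have y: "?y \<in> carrier compl" "inv (s n) \<in> ?y n" for n
    using compl_lim_closed[of "\<lambda>n. inv (s n)"] compl_lim_mem[of "\<lambda>n. inv (s n)"] sc cong lcong_inv
    by auto
  have yx: "inv g \<in> ?y n" if "g \<in> x n" for g n
    using that compl_mem_iff[OF x s] compl_mem_iff[OF y(1) y(2)] lcong_inv by blast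
  have "?y \<otimes>\<^bsub>compl\<^esub> x = \<one>\<^bsub>compl\<^esub>"
  proof (rule compl_eqI[OF compl_mult_closed[OF y(1) x] compl_one_closed])
    fix n show "\<exists>g. g \<in> (?y \<otimes>\<^bsub>compl\<^esub> x) n \<and> g \<in> \<one>\<^bsub>compl\<^esub> n"
      using compl_mult_mem[of "inv (s n)" ?y n "s n" x] y(2)[of n] s[of n] sc[of n] by (intro exI[of _ "\<one>"]) (simp add: compl_one_mem_iff)
  qed
  then show ?thesis using y yx by blast
qed

lemma compl_group: "group compl"
proof (rule groupI)
  fix x y z assume x: "x \<in> carrier compl" and y: "y \<in> carrier compl" and z: "z \<in> carrier compl"
  show "x \<otimes>\<^bsub>compl\<^esub> y \<otimes>\<^bsub>compl\<^esub> z = x \<otimes>\<^bsub>compl\<^esub> (y \<otimes>\<^bsub>compl\<^esub> z)"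
  proof (rule compl_eqI)
    fix n
    obtain f g h where *: "f \<in> x n" "g \<in> y n" "h \<in> z n"
      using compl_nonempty[OF x] compl_nonempty[OF y] compl_nonempty[OF z] by blast
    have "f \<otimes> g \<otimes> h = f \<otimes> (g \<otimes> h)"
      using compl_mem_carrier[OF x *(1)] compl_mem_carrier[OF y *(2)] compl_mem_carrier[OF z *(3)]
      by (rule m_assoc)
    moreover have "f \<otimes> g \<otimes> h \<in> (x \<otimes>\<^bsub>compl\<^esub> y \<otimes>\<^bsub>compl\<^esub> z) n"
      by (intro compl_mult_mem *)
    moreover have "f \<otimes> (g \<otimes> h) \<in> (x \<otimes>\<^bsub>compl\<^esub> (y \<otimes>\<^bsub>compl\<^esub> z)) n"
      by (intro compl_mult_mem *)
    ultimately show "\<exists>k. k \<in> (x \<otimes>\<^bsub>compl\<^esub> y \<otimes>\<^bsub>compl\<^esub> z) n \<and> k \<in> (x \<otimes>\<^bsub>compl\<^esub> (y \<otimes>\<^bsub>compl\<^esub> z)) n"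
      by auto
  qed (use x y z compl_mult_closed in auto)
next
  fix x assume x: "x \<in> carrier compl"
  show "\<one>\<^bsub>compl\<^esub> \<otimes>\<^bsub>compl\<^esub> x = x"
  proof (rule compl_eqI)
    fix n
    obtain f where f: "f \<in> x n" using compl_nonempty[OF x] by blast
    then have "\<one> \<otimes> f \<in> (\<one>\<^bsub>compl\<^esub> \<otimes>\<^bsub>compl\<^esub> x) n"
      by (intro compl_mult_mem) (simp_all add: compl_one_mem_iff)
    then show "\<exists>k. k \<in> (\<one>\<^bsub>compl\<^esub> \<otimes>\<^bsub>compl\<^esub> x) n \<and> k \<in> x n"
      using f compl_mem_carrier[OF x f] by auto
  qed (use x compl_mult_closed compl_one_closed in auto)
  show "\<exists>y\<in>carrier compl. y \<otimes>\<^bsub>compl\<^esub> x = \<one>\<^bsub>compl\<^esub>"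
    using compl_inv_ex[OF x] by blast
qed (use compl_mult_closed compl_one_closed in auto)

lemma compl_inv_mem:
  assumes "x \<in> carrier compl" "g \<in> x n" shows "inv g \<in> (inv\<^bsub>compl\<^esub> x) n"
proof -
  interpret C: plain_group compl by (rule plain_group.intro[OF compl_group])
  show ?thesis
    using compl_inv_ex[OF assms(1)] assms C.inv_equality by auto
qed

lemma compl_comm_mem:
  assumes "x \<in> carrier compl" "y \<in> carrier compl" "g \<in> x n" "h \<in> y n"
  shows "comm g h \<in> gcomm compl x y n"
proof -
  interpret C: plain_group compl by (rule plain_group.intro[OF compl_group])
  show ?thesis
    unfolding comm_def C.comm_def by (intro compl_mult_mem compl_inv_mem assms)
qed

lemma compl_of_hom: "(\<lambda>g. compl_lim (\<lambda>_. g)) \<in> hom G compl"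
proof (rule homI)
  fix g h assume g: "g \<in> carrier G" and h: "h \<in> carrier G"
  show "compl_lim (\<lambda>_. g \<otimes> h) = compl_lim (\<lambda>_. g) \<otimes>\<^bsub>compl\<^esub> compl_lim (\<lambda>_. h)"
  proof (rule compl_eqI)
    fix n
    show "\<exists>k. k \<in> compl_lim (\<lambda>_. g \<otimes> h) n \<and> k \<in> (compl_lim (\<lambda>_. g) \<otimes>\<^bsub>compl\<^esub> compl_lim (\<lambda>_. h)) n"
      using g h by (intro exI[of _ "g \<otimes> h"] conjI compl_mult_mem compl_of_mem m_closed)
  qed (use g h in \<open>auto intro: compl_of_closed compl_mult_closed\<close>)
qed (rule compl_of_closed)

end

text \<open>The image of a coset is in general only part of a coset of \<open>H\<close>; the factor
  \<open>lower_central H n\<close> in \<open>completion_map\<close> fills it up to the whole coset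
  of any representative \<open>h g\<close>.\<close>

lemma
  assumes "group G" "group H" "h \<in> hom G H" "x \<in> carrier (pronilpotent_completion G)"
  shows completion_map_closed: "completion_map H h x \<in> carrier (pronilpotent_completion H)"
    and completion_map_mem: "g \<in> x n \<Longrightarrow> h g \<in> completion_map H h x n"
proof -
  interpret G: plain_group G by (rule plain_group.intro) fact
  interpret H: plain_group H by (rule plain_group.intro) fact
  interpret h: group_hom G H h using assms by (simp add: group_hom_def group_hom_axioms_def)
  have eq: "completion_map H h x n = lower_central H n #>\<^bsub>H\<^esub> h g" if g: "g \<in> x n" for n g
  proof -
    have gc: "g \<in> carrier G" using G.compl_mem_carrier[OF assms(4) g] .
    have "k \<in> lower_central H n <#>\<^bsub>H\<^esub> (h ` x n) \<longleftrightarrow> H.lcong n k (h g)" for k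
    proof
      assume "k \<in> lower_central H n <#>\<^bsub>H\<^esub> (h ` x n)"
      then obtain c g' where k: "c \<in> lower_central H n" "g' \<in> x n" "k = c \<otimes>\<^bsub>H\<^esub> h g'"
        by (auto simp: set_mult_def)
      then have "H.lcong n (h g') (h g)"
        using hom_lcong[OF assms(1-3)] G.compl_mem_iff[OF assms(4) g] by blast
      moreover have "H.lcong n k (h g')"
        using k H.lcong_mult_left G.compl_mem_carrier[OF assms(4)] h.hom_closed by metis
      ultimately show "H.lcong n k (h g)" using H.lcong_trans by blast
    next
      assume k: "H.lcong n k (h g)"
      then have "k = (k \<otimes>\<^bsub>H\<^esub> inv\<^bsub>H\<^esub> h g) \<otimes>\<^bsub>H\<^esub> h g"
        by (simp add: H.lcong_def H.word_simps)
      then show "k \<in> lower_central H n <#>\<^bsub>H\<^esub> (h ` x n)"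
        using g k unfolding H.lcong_def set_mult_def by blast
    qed
    then show ?thesis
      using H.mem_lower_central_coset[of "h g" _ n] gc by (auto simp: completion_map_def)
  qed
  show mem: "h g \<in> completion_map H h x n" if "g \<in> x n" for g n
    using eq[OF that] H.mem_lower_central_coset[of "h g" "h g" n] G.compl_mem_carrier[OF assms(4) that] by simp
  have "completion_map H h x n \<in> carrier (H Mod lower_central H n)" for n
  proof -
    obtain g where g: "g \<in> x n" using G.compl_nonempty[OF assms(4)] by blast
    then show ?thesis
      using eq[OF g] G.compl_mem_carrier[OF assms(4) g] by (auto simp: FactGroup_def RCOSETS_def)
  qed
  moreover have "completion_map H h x (Suc n) \<subseteq> completion_map H h x n" for n
  proof -
    obtain g where g: "g \<in> x (Suc n)" using G.compl_nonempty[OF assms(4)] by blast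
    then have g': "g \<in> x n" using G.compl_mem_antimono[OF assms(4), of g "Suc n" n] by simp
    have gc: "h g \<in> carrier H" using G.compl_mem_carrier[OF assms(4) g] by simp
    show ?thesis
      unfolding eq[OF g] eq[OF g'] r_coset_def using H.lower_central_Suc_subset[of n] by blast
  qed
  ultimately show "completion_map H h x \<in> carrier (pronilpotent_completion H)"
    by (simp add: pronilpotent_completion_def)
qed

lemma completion_map_hom:
  assumes "group G" "group H" "h \<in> hom G H"
  shows "completion_map H h \<in> hom (pronilpotent_completion G) (pronilpotent_completion H)"
proof (rule homI)
  interpret G: plain_group G by (rule plain_group.intro) fact
  interpret H: plain_group H by (rule plain_group.intro) fact
  interpret h: group_hom G H h using assms by (simp add: group_hom_def group_hom_axioms_def)
  fix x y assume x: "x \<in> carrier G.compl" and y: "y \<in> carrier G.compl"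
  show "completion_map H h (x \<otimes>\<^bsub>G.compl\<^esub> y) = completion_map H h x \<otimes>\<^bsub>H.compl\<^esub> completion_map H h y"
  proof (rule H.compl_eqI)
    fix n
    obtain f g where fg: "f \<in> x n" "g \<in> y n"
      using G.compl_nonempty[OF x] G.compl_nonempty[OF y] by blast
    have "h (f \<otimes>\<^bsub>G\<^esub> g) = h f \<otimes>\<^bsub>H\<^esub> h g"
      using G.compl_mem_carrier[OF x fg(1)] G.compl_mem_carrier[OF y fg(2)] by (rule h.hom_mult)
    then show "\<exists>k. k \<in> completion_map H h (x \<otimes>\<^bsub>G.compl\<^esub> y) n
        \<and> k \<in> (completion_map H h x \<otimes>\<^bsub>H.compl\<^esub> completion_map H h y) n"
      using fg by (intro exI[of _ "h (f \<otimes>\<^bsub>G\<^esub> g)"] conjI completion_map_mem[OF assms]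
          G.compl_mult_closed G.compl_mult_mem x y)
        (auto intro!: H.compl_mult_mem completion_map_mem[OF assms] x y)
  qed (use x y assms in \<open>auto intro!: completion_map_closed G.compl_mult_closed H.compl_mult_closed\<close>)
qed (use completion_map_closed[OF assms] in auto)

text \<open>A lift of a compatible sequence is corrected step by step, since the lower central subgroups
  also map onto each other.\<close>

lemma completion_map_surj:
  assumes "group G" "group H" "h \<in> hom G H" "h ` carrier G = carrier H"
    and y: "y \<in> carrier (pronilpotent_completion H)"
  shows "\<exists>x\<in>carrier (pronilpotent_completion G). completion_map H h x = y"
proof -
  interpret G: plain_group G by (rule plain_group.intro) fact
  interpret H: plain_group H by (rule plain_group.intro) fact
  interpret h: group_hom G H h using assms by (simp add: group_hom_def group_hom_axioms_def)
  have "\<exists>s. \<forall>n. (s n \<in> carrier G \<and> h (s n) \<in> y n) \<and> G.lcong n (s (Suc n)) (s n)"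
  proof (rule dependent_nat_choice)
    obtain k where k: "k \<in> y 0" using H.compl_nonempty[OF y] by blast
    have "k \<in> h ` carrier G"
      using assms(4) H.compl_mem_carrier[OF y k] by simp
    then show "\<exists>x. x \<in> carrier G \<and> h x \<in> y 0"
      using k by auto
  next
    fix f n assume f: "f \<in> carrier G \<and> h f \<in> y n"
    obtain k where k: "k \<in> y (Suc n)" using H.compl_nonempty[OF y] by blast
    then have "k \<in> y n" using H.compl_mem_antimono[OF y k, of n] by simp
    then have "H.lcong n k (h f)" using H.compl_mem_iff[OF y, of "h f" n k] f by simp
    then have c: "k \<otimes>\<^bsub>H\<^esub> inv\<^bsub>H\<^esub> h f \<in> lower_central H n" and kc: "k \<in> carrier H"
      by (simp_all add: H.lcong_def)
    obtain c where c: "c \<in> lower_central G n" "h c = k \<otimes>\<^bsub>H\<^esub> inv\<^bsub>H\<^esub> h f"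
      using hom_lower_central_surj[OF assms(1-4) c] by auto
    from c have "c \<otimes>\<^bsub>G\<^esub> f \<in> carrier G" "h (c \<otimes>\<^bsub>G\<^esub> f) = k" "G.lcong n (c \<otimes>\<^bsub>G\<^esub> f) f"
      using f kc G.lower_central_carrier G.lcong_mult_left by (simp_all add: H.word_simps)
    then show "\<exists>g. (g \<in> carrier G \<and> h g \<in> y (Suc n)) \<and> G.lcong n g f"
      using k by auto
  qed
  then obtain s where s: "\<And>n. s n \<in> carrier G" "\<And>n. h (s n) \<in> y n" "\<And>n. G.lcong n (s (Suc n)) (s n)"
    by blast
  have x: "G.compl_lim s \<in> carrier G.compl" "\<And>n. s n \<in> G.compl_lim s n"
    using G.compl_lim_closed[OF s(1,3)] G.compl_lim_mem[OF s(1,3)] by simp_all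
  have "completion_map H h (G.compl_lim s) = y"
  proof (rule H.compl_eqI)
    show "\<exists>g. g \<in> completion_map H h (G.compl_lim s) n \<and> g \<in> y n" for n
      using completion_map_mem[OF assms(1-3) x(1) x(2)[of n]] s(2)[of n] by auto
  qed (use completion_map_closed[OF assms(1-3) x(1)] y in auto)
  then show ?thesis using x by blast
qed

section \<open>Lower central series of completions of finitely generated groups\<close>

text \<open>The second entries will be a fixed list of generators and the first entries will vary:
  modulo the next term, this is a general element of a lower central term.\<close>

definition gcomm_prod :: "'b monoid \<Rightarrow> ('a \<Rightarrow> 'b) \<Rightarrow> ('a \<Rightarrow> 'b) \<Rightarrow> 'a list \<Rightarrow> 'b" where
  "gcomm_prod G u v xs = foldr (\<lambda>x y. gcomm G (u x) (v x) \<otimes>\<^bsub>G\<^esub> y) xs \<one>\<^bsub>G\<^esub>"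

lemma gcomm_prod_simps [simp]:
  "gcomm_prod G u v [] = \<one>\<^bsub>G\<^esub>"
  "gcomm_prod G u v (x # xs) = gcomm G (u x) (v x) \<otimes>\<^bsub>G\<^esub> gcomm_prod G u v xs"
  by (simp_all add: gcomm_prod_def)

context plain_group
begin

lemma gcomm_prod_closed:
  "(\<And>x. x \<in> set xs \<Longrightarrow> u x \<in> carrier G \<and> v x \<in> carrier G) \<Longrightarrow> gcomm_prod G u v xs \<in> carrier G"
  by (induction xs) simp_all

lemma lcong_commute:
  assumes "c \<in> lower_central G j" "y \<in> carrier G"
  shows "lcong (Suc j) (c \<otimes> y) (y \<otimes> c)"
  using mult_comm_swap[of c y] assms lower_central_carrier[OF assms(1)]
    lcong_mult_left[OF comm_in_lower_central[OF assms], of "y \<otimes> c"] by simp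

lemma lcong_conj:
  assumes "c \<in> lower_central G j" "y \<in> carrier G"
  shows "lcong (Suc j) (y \<otimes> c \<otimes> inv y) c"
proof -
  have "lcong (Suc j) ((y \<otimes> c) \<otimes> inv y) ((c \<otimes> y) \<otimes> inv y)"
    by (rule lcong_mult[OF lcong_sym[OF lcong_commute[OF assms]] lcong_refl]) (simp add: assms)
  then show ?thesis
    using assms lower_central_carrier[OF assms(1)] by (simp add: word_simps)
qed

text \<open>By the identity \<open>[u, yz] = [u, y] (y [u, z] y^-1)\<close>: here
  \<open>[u, z]\<close> is one step deeper than \<open>u\<close>, so conjugating it changes it only
  two steps deeper.\<close>

lemma lcong_comm_mult_right:
  assumes "u \<in> lower_central G j" "y \<in> carrier G" "z \<in> carrier G"
  shows "lcong (Suc (Suc j)) (comm u (y \<otimes> z)) (comm u y \<otimes> comm u z)"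
proof -
  have u: "u \<in> carrier G" using lower_central_carrier[OF assms(1)] .
  have "comm u (y \<otimes> z) = comm u y \<otimes> (y \<otimes> comm u z \<otimes> inv y)"
    using u assms by (simp add: comm_def word_simps)
  moreover have "lcong (Suc (Suc j)) \<dots> (comm u y \<otimes> comm u z)"
    using u assms by (intro lcong_mult lcong_conj comm_in_lower_central lcong_refl comm_closed)
  ultimately show ?thesis by simp
qed

text \<open>The factor \<open>w\<close> is deep while \<open>u\<close> is arbitrary. This is
  linearity in a correction to a given first entry, the form used by successive
  approximation.\<close>

lemma lcong_comm_mult_left:
  assumes "w \<in> lower_central G j" "u \<in> carrier G" "y \<in> carrier G"
  shows "lcong (Suc (Suc j)) (comm (u \<otimes> w) y) (comm u y \<otimes> comm w y)"
proof -
  have w: "w \<in> carrier G" using lower_central_carrier[OF assms(1)] .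
  have "comm (u \<otimes> w) y = (u \<otimes> comm w y \<otimes> inv u) \<otimes> comm u y"
    using w assms by (simp add: comm_def word_simps)
  also have "lcong (Suc (Suc j)) \<dots> (comm w y \<otimes> comm u y)"
    using w assms by (intro lcong_mult lcong_conj comm_in_lower_central lcong_refl comm_closed)
  also have "lcong (Suc (Suc j)) \<dots> (comm u y \<otimes> comm w y)"
    using w assms by (intro lcong_commute comm_in_lower_central comm_closed)
  finally show ?thesis .
qed

lemma gcomm_prod_in_lower_central:
  assumes "\<And>x. x \<in> set xs \<Longrightarrow> w x \<in> lower_central G j \<and> v x \<in> carrier G"
  shows "gcomm_prod G w v xs \<in> lower_central G (Suc j)"
  using assms
  by (induction xs) (simp_all add: lower_central_mult comm_in_lower_central del: lower_central.simps(2))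

lemma lcong_gcomm_prod_mult:
  assumes "\<And>x. x \<in> set xs \<Longrightarrow> u x \<in> carrier G \<and> w x \<in> lower_central G j \<and> v x \<in> carrier G"
  shows "lcong (Suc (Suc j)) (gcomm_prod G (\<lambda>x. u x \<otimes> w x) v xs) (gcomm_prod G u v xs \<otimes> gcomm_prod G w v xs)"
  using assms
proof (induction xs)
  case (Cons x xs)
  let ?U = "gcomm_prod G u v xs" and ?W = "gcomm_prod G w v xs"
  have x: "u x \<in> carrier G" "w x \<in> lower_central G j" "v x \<in> carrier G" "w x \<in> carrier G"
    using Cons.prems lower_central_carrier by auto
  have wc: "\<And>x. x \<in> set xs \<Longrightarrow> w x \<in> carrier G"
    using Cons.prems lower_central_carrier by auto
  have U: "?U \<in> carrier G" and W: "?W \<in> carrier G"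
    using Cons.prems wc by (auto intro!: gcomm_prod_closed)
  have cw: "comm (w x) (v x) \<in> lower_central G (Suc j)"
    using comm_in_lower_central x by blast
  have "lcong (Suc (Suc j)) (comm (u x \<otimes> w x) (v x) \<otimes> gcomm_prod G (\<lambda>x. u x \<otimes> w x) v xs)
      ((comm (u x) (v x) \<otimes> comm (w x) (v x)) \<otimes> (?U \<otimes> ?W))"
    using Cons x by (intro lcong_mult lcong_comm_mult_left Cons.IH) auto
  also have "\<dots> = comm (u x) (v x) \<otimes> ((comm (w x) (v x) \<otimes> ?U) \<otimes> ?W)"
    using x U W by (simp add: m_assoc)
  also have "lcong (Suc (Suc j)) \<dots> (comm (u x) (v x) \<otimes> ((?U \<otimes> comm (w x) (v x)) \<otimes> ?W))"
    using x U W by (intro lcong_mult lcong_commute[OF cw] lcong_refl comm_closed)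
  also have "\<dots> = (comm (u x) (v x) \<otimes> ?U) \<otimes> (comm (w x) (v x) \<otimes> ?W)"
    using x U W by (simp add: m_assoc)
  finally show ?case by simp
qed simp

lemma gcomm_prod_single:
  assumes "distinct xs" "x \<in> set xs" "set xs \<subseteq> carrier G" "u \<in> carrier G"
  shows "gcomm_prod G (\<lambda>z. if z = x then u else \<one>) (\<lambda>z. z) xs = comm u x"
proof -
  have triv: "gcomm_prod G (\<lambda>z. if z = x then u else \<one>) (\<lambda>z. z) ys = \<one>"
    if "x \<notin> set ys" "set ys \<subseteq> carrier G" for ys
    using that by (induction ys) (auto simp: comm_def)
  show ?thesis
    using assms
  proof (induction xs)
    case (Cons a xs)
    show ?case
    proof (cases "a = x")
      case True
      then show ?thesis using Cons.prems triv[of xs] by simp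
    next
      case False
      then have "gcomm_prod G (\<lambda>z. if z = x then u else \<one>) (\<lambda>z. z) xs = comm u x" "x \<in> carrier G"
        using Cons by auto
      then show ?thesis using False Cons.prems by (simp add: comm_def)
    qed
  qed simp
qed

text \<open>Modulo the term \<open>Suc (Suc j)\<close> the commutator is bilinear, so the elements
  of the required shape form a set \<open>A\<close> closed under products and inverses. It contains
  the generators of the term \<open>Suc j\<close>, because a commutator with a word splits into
  commutators with its letters.\<close>

lemma lower_central_Suc_gcomm_prod:
  assumes xs: "distinct xs" "set xs \<subseteq> carrier G" "generate G (set xs) = carrier G"
    and c: "c \<in> lower_central G (Suc j)"
  shows "\<exists>w. (\<forall>x\<in>set xs. w x \<in> lower_central G j) \<and> lcong (Suc (Suc j)) c (gcomm_prod G w (\<lambda>x. x) xs)"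
proof -
  define R where "R = (\<lambda>c w. (\<forall>x\<in>set xs. w x \<in> lower_central G j) \<and> lcong (Suc (Suc j)) c (gcomm_prod G w (\<lambda>x. x) xs))"
  define A where "A = {c. \<exists>w. R c w}"
  have A_cong: "c \<in> A" if "lcong (Suc (Suc j)) c a" "a \<in> A" for c a
    using that lcong_trans unfolding A_def R_def by blast
  have one: "\<one> \<in> A"
  proof -
    have "gcomm_prod G (\<lambda>_. \<one>) (\<lambda>x. x) ys = \<one>" if "set ys \<subseteq> carrier G" for ys
      using that by (induction ys) (auto simp: comm_def)
    then have "R \<one> (\<lambda>_. \<one>)" using xs(2) by (simp add: R_def)
    then show ?thesis unfolding A_def by blast
  qed
  have mult: "a \<otimes> b \<in> A" if ab: "a \<in> A" "b \<in> A" for a b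
  proof -
    obtain u w where u: "R a u" and w: "R b w" using ab unfolding A_def by blast
    have "lcong (Suc (Suc j)) (a \<otimes> b) (gcomm_prod G u (\<lambda>x. x) xs \<otimes> gcomm_prod G w (\<lambda>x. x) xs)"
      using u w unfolding R_def by (intro lcong_mult) auto
    also have "lcong (Suc (Suc j)) \<dots> (gcomm_prod G (\<lambda>x. u x \<otimes> w x) (\<lambda>x. x) xs)"
      using u w xs(2) lower_central_carrier unfolding R_def by (intro lcong_sym[OF lcong_gcomm_prod_mult]) blast
    finally have "R (a \<otimes> b) (\<lambda>x. u x \<otimes> w x)"
      using u w lower_central_mult unfolding R_def by blast
    then show ?thesis unfolding A_def by blast
  qed
  have inv: "inv a \<in> A" if a: "a \<in> A" for a
  proof -
    obtain u where u: "R a u" using a unfolding A_def by blast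
    let ?U = "gcomm_prod G u (\<lambda>x. x) xs" and ?V = "gcomm_prod G (\<lambda>x. inv (u x)) (\<lambda>x. x) xs"
    have uc: "u x \<in> carrier G" "x \<in> carrier G" if "x \<in> set xs" for x
      using u that lower_central_carrier xs(2) unfolding R_def by blast+
    have c: "?U \<in> carrier G" "?V \<in> carrier G" "a \<in> carrier G"
      using uc u lcong_carrier unfolding R_def by (auto intro!: gcomm_prod_closed)
    \<comment> \<open>With entries \<open>u x\<close> times their inverses the product is trivial,
      so additivity identifies the inverse of \<open>?U\<close> with \<open>?V\<close> up to the
      allowed error.\<close>
    have "lcong (Suc (Suc j)) (gcomm_prod G (\<lambda>x. u x \<otimes> inv (u x)) (\<lambda>x. x) xs) (?U \<otimes> ?V)"
      using u uc lower_central_inv unfolding R_def by (intro lcong_gcomm_prod_mult) blast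
    moreover have "gcomm_prod G (\<lambda>x. u x \<otimes> inv (u x)) (\<lambda>x. x) ys = \<one>" if "set ys \<subseteq> set xs" for ys
      using that uc by (induction ys) (auto simp: comm_def)
    ultimately have "lcong (Suc (Suc j)) (inv ?U \<otimes> \<one>) (inv ?U \<otimes> (?U \<otimes> ?V))"
      using c by (intro lcong_mult) auto
    then have "lcong (Suc (Suc j)) (inv ?U) ?V" using c by (simp add: word_simps)
    moreover have "lcong (Suc (Suc j)) (inv a) (inv ?U)"
      using u unfolding R_def by (intro lcong_inv) blast
    ultimately have "R (inv a) (\<lambda>x. inv (u x))"
      using u lower_central_inv lcong_trans unfolding R_def by blast
    then show ?thesis unfolding A_def by blast
  qed
  have gens: "comm u x \<in> A" if "u \<in> lower_central G j" "x \<in> set xs" for u x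
  proof -
    have "u \<in> carrier G" using that lower_central_carrier by blast
    then have "R (comm u x) (\<lambda>z. if z = x then u else \<one>)"
      using that xs(2) gcomm_prod_single[OF xs(1) that(2) xs(2)] by (auto simp: R_def)
    then show ?thesis unfolding A_def by blast
  qed
  \<comment> \<open>Induction on \<open>y\<close> as a word in the generators, by linearity in the
    second entry.\<close>
  have comms: "comm u y \<in> A" if u: "u \<in> lower_central G j" and y: "y \<in> generate G (set xs)" for u y
    using y
  proof (induction rule: generate.induct)
    case one
    then show ?case using \<open>\<one> \<in> A\<close> lower_central_carrier[OF u] by simp
  next
    case (incl x)
    then show ?case using gens u by blast
  next
    case (inv x)
    have x: "x \<in> carrier G" and uc: "u \<in> carrier G" using inv xs(2) lower_central_carrier[OF u] by auto
    have "comm u (inv x) = inv x \<otimes> inv (comm u x) \<otimes> inv (inv x)"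
      using x uc by (simp add: comm_def word_simps)
    then have "lcong (Suc (Suc j)) (comm u (inv x)) (inv (comm u x))"
      using lcong_conj[OF lower_central_inv[OF comm_in_lower_central[OF u x]], of "inv x"] x by simp
    then show ?case using A_cong \<open>\<And>a. a \<in> A \<Longrightarrow> inv a \<in> A\<close> gens u inv by blast
  next
    case (eng y z)
    have "y \<in> carrier G" "z \<in> carrier G" using eng generate_in_carrier[OF xs(2)] by auto
    then show ?case using A_cong[OF lcong_comm_mult_right[OF u]] mult eng by blast
  qed
  have "c \<in> A" using c unfolding lower_central_Suc
  proof (induction rule: generate.induct)
    case (incl h)
    then show ?case using comms xs(3) by blast
  next
    case (inv h)
    then show ?case using comms xs(3) \<open>\<And>a. a \<in> A \<Longrightarrow> inv a \<in> A\<close> by blast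
  qed (use one mult in blast)+
  then show ?thesis unfolding A_def R_def by blast
qed

lemma compl_gcomm_prod_mem:
  assumes "\<And>x. x \<in> set xs \<Longrightarrow> U x \<in> carrier compl \<and> V x \<in> carrier compl \<and> u x \<in> U x n \<and> v x \<in> V x n"
  shows "gcomm_prod G u v xs \<in> gcomm_prod compl U V xs n"
  using assms
proof (induction xs)
  case (Cons x xs)
  then have "gcomm_prod G u v xs \<in> gcomm_prod compl U V xs n" by simp
  moreover have "comm (u x) (v x) \<in> gcomm compl (U x) (V x) n"
    using Cons.prems[of x] by (intro compl_comm_mem) auto
  ultimately show ?case unfolding gcomm_prod_simps by (intro compl_mult_mem)
qed (simp add: compl_one_mem_iff)

text \<open>Successive approximation: the error left after \<open>j\<close> steps lies in the next lower central
  subgroup and is a product of commutators with the generators up to a smaller error.\<close>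

lemma compl_eq_gcomm_prod:
  assumes xs: "distinct xs" "set xs \<subseteq> carrier G" "generate G (set xs) = carrier G"
    and z: "z \<in> carrier compl" "\<one> \<in> z (Suc n)"
  shows "\<exists>U. (\<forall>x\<in>set xs. U x \<in> carrier compl \<and> \<one> \<in> U x n)
    \<and> z = gcomm_prod compl U (\<lambda>x. compl_lim (\<lambda>_. x)) xs"
proof -
  let ?P = "\<lambda>s. gcomm_prod G s (\<lambda>x. x) xs"
  \<comment> \<open>Stage \<open>j\<close> represents \<open>z\<close> up to level
    \<open>Suc n + j\<close>, while consecutive stages have entries that agree only up to level
    \<open>n + j\<close>: taking commutators gains one level.\<close>
  have "\<exists>s. \<forall>j. ((\<forall>x\<in>set xs. s j x \<in> lower_central G n) \<and> (\<forall>f\<in>z (Suc n + j). lcong (Suc n + j) f (?P (s j))))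
      \<and> (\<forall>x\<in>set xs. lcong (n + j) (s (Suc j) x) (s j x))"
  proof (rule dependent_nat_choice)
    have "gcomm_prod G (\<lambda>_. \<one>) (\<lambda>x. x) ys = \<one>" if "set ys \<subseteq> carrier G" for ys
      using that by (induction ys) (auto simp: comm_def)
    then have "?P (\<lambda>_. \<one>) = \<one>" using xs(2) by blast
    then show "\<exists>s. (\<forall>x\<in>set xs. s x \<in> lower_central G n) \<and> (\<forall>f\<in>z (Suc n + 0). lcong (Suc n + 0) f (?P s))"
      using compl_mem_iff[OF z] by (intro exI[of _ "\<lambda>_. \<one>"]) (simp del: lower_central.simps(2))
  next
    fix s j
    assume s: "(\<forall>x\<in>set xs. s x \<in> lower_central G n) \<and> (\<forall>f\<in>z (Suc n + j). lcong (Suc n + j) f (?P s))"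
    obtain f where f: "f \<in> z (Suc n + Suc j)" using compl_nonempty[OF z(1)] by blast
    then have f': "f \<in> z (Suc n + j)" using compl_mem_antimono[OF z(1) f, of "Suc n + j"] by simp
    have sc: "s x \<in> carrier G" if "x \<in> set xs" for x
      using s that lower_central_carrier by blast
    have c: "lcong (Suc (n + j)) f (?P s)" "f \<in> carrier G" "?P s \<in> carrier G"
      using s f' lcong_carrier by auto
    then have "lcong (Suc (n + j)) (inv (?P s) \<otimes> f) (inv (?P s) \<otimes> ?P s)"
      by (intro lcong_mult) auto
    then have "inv (?P s) \<otimes> f \<in> lower_central G (Suc (n + j))"
      using c by (simp add: lcong_one_iff del: lower_central.simps(2))
    then obtain w where w: "\<And>x. x \<in> set xs \<Longrightarrow> w x \<in> lower_central G (n + j)"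
      and wf: "lcong (Suc (Suc (n + j))) (inv (?P s) \<otimes> f) (?P w)"
      using lower_central_Suc_gcomm_prod[OF xs] by blast
    have "lcong (Suc (Suc (n + j))) (?P s \<otimes> (inv (?P s) \<otimes> f)) (?P s \<otimes> ?P w)"
      using wf c by (intro lcong_mult) auto
    also have "lcong (Suc (Suc (n + j))) (?P s \<otimes> ?P w) (?P (\<lambda>x. s x \<otimes> w x))"
      using sc w xs(2) by (intro lcong_sym[OF lcong_gcomm_prod_mult]) blast
    finally have "lcong (Suc n + Suc j) f (?P (\<lambda>x. s x \<otimes> w x))"
      using c by (simp add: word_simps)
    then have "\<forall>f\<in>z (Suc n + Suc j). lcong (Suc n + Suc j) f (?P (\<lambda>x. s x \<otimes> w x))"
      using compl_mem_iff[OF z(1) f] lcong_trans by blast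
    moreover have "\<forall>x\<in>set xs. s x \<otimes> w x \<in> lower_central G n"
      using s w lower_central_mult lower_central_antimono[of n "n + j"] by fastforce
    moreover have "\<forall>x\<in>set xs. lcong (n + j) (s x \<otimes> w x) (s x)"
      using sc w lcong_mult_right by blast
    ultimately show "\<exists>t. ((\<forall>x\<in>set xs. t x \<in> lower_central G n)
        \<and> (\<forall>f\<in>z (Suc n + Suc j). lcong (Suc n + Suc j) f (?P t))) \<and> (\<forall>x\<in>set xs. lcong (n + j) (t x) (s x))"
      by (intro exI[of _ "\<lambda>x. s x \<otimes> w x"] conjI)
  qed
  then obtain s where s: "\<And>j x. x \<in> set xs \<Longrightarrow> s j x \<in> lower_central G n"
    and sP: "\<And>j f. f \<in> z (Suc n + j) \<Longrightarrow> lcong (Suc n + j) f (?P (s j))"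
    and sS: "\<And>j x. x \<in> set xs \<Longrightarrow> lcong (n + j) (s (Suc j) x) (s j x)"
    by blast
  define U where "U x = compl_lim (\<lambda>j. s j x)" for x
  have U: "U x \<in> carrier compl" "s j x \<in> U x j" if "x \<in> set xs" for x j
  proof -
    have "s j x \<in> carrier G" "lcong j (s (Suc j) x) (s j x)" for j
      using lower_central_carrier[OF s[OF that]] lcong_mono[OF sS[OF that], of j] by auto
    then show "U x \<in> carrier compl" "s j x \<in> U x j"
      unfolding U_def by (rule compl_lim_closed compl_lim_mem)+
  qed
  have "\<one> \<in> U x n" if "x \<in> set xs" for x
    using s[OF that, of n] lcong_sym lcong_one_iff unfolding U_def compl_lim_def by blast
  moreover have "z = gcomm_prod compl U (\<lambda>x. compl_lim (\<lambda>_. x)) xs"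
  proof (rule compl_eqI[OF z(1)])
    interpret C: plain_group compl by (rule plain_group.intro[OF compl_group])
    show C: "gcomm_prod compl U (\<lambda>x. compl_lim (\<lambda>_. x)) xs \<in> carrier compl"
      using U xs(2) by (intro C.gcomm_prod_closed) (auto intro: compl_of_closed)
    fix j
    obtain f where f: "f \<in> z (Suc n + j)" using compl_nonempty[OF z(1)] by blast
    have "?P (s j) \<in> gcomm_prod compl U (\<lambda>x. compl_lim (\<lambda>_. x)) xs j"
      using U xs(2) by (intro compl_gcomm_prod_mem) (auto intro: compl_of_closed compl_of_mem)
    moreover have "lcong j f (?P (s j))"
      using lcong_mono[OF sP[OF f], of j] by simp
    ultimately have "f \<in> gcomm_prod compl U (\<lambda>x. compl_lim (\<lambda>_. x)) xs j"
      using compl_mem_iff[OF C] by blast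
    then show "\<exists>g. g \<in> z j \<and> g \<in> gcomm_prod compl U (\<lambda>x. compl_lim (\<lambda>_. x)) xs j"
      using compl_mem_antimono[OF z(1) f, of j] by auto
  qed
  ultimately show ?thesis using U(1) by blast
qed

text \<open>The condition \<open>\<one> \<in> z n\<close> puts \<open>z\<close> into the kernel of
  the projection to level \<open>n\<close>. Since the generators form a fixed finite list, the
  infinitely many corrections are absorbed into finitely many first entries, so \<open>z\<close> is
  a finite product of commutators in the completion itself.\<close>

lemma compl_lower_central:
  assumes fin: "finite T" "T \<subseteq> carrier G" "generate G T = carrier G"
    and z: "z \<in> carrier compl" "\<one> \<in> z n"
  shows "z \<in> lower_central compl n"
  using z
proof (induction n arbitrary: z)
  case (Suc n)
  interpret C: plain_group compl by (rule plain_group.intro[OF compl_group])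
  obtain xs where xs: "set xs = T" "distinct xs" using finite_distinct_list[OF fin(1)] by blast
  obtain U where U: "\<And>x. x \<in> set xs \<Longrightarrow> U x \<in> carrier compl \<and> \<one> \<in> U x n"
    and z: "z = gcomm_prod compl U (\<lambda>x. compl_lim (\<lambda>_. x)) xs"
    using compl_eq_gcomm_prod[OF xs(2) _ _ Suc.prems] xs(1) fin(2,3) by blast
  show ?case
    unfolding z using U Suc.IH xs(1) fin(2)
    by (intro C.gcomm_prod_in_lower_central) (auto intro: compl_of_closed)
qed simp

end

section \<open>Free groups\<close>

fun reduced :: "(bool \<times> 'a) list \<Rightarrow> bool" where
  "reduced [] \<longleftrightarrow> True"
| "reduced [a] \<longleftrightarrow> True"
| "reduced (a # b # w) \<longleftrightarrow> \<not> (snd b = snd a \<and> fst b \<noteq> fst a) \<and> reduced (b # w)"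

definition flip :: "bool \<times> 'a \<Rightarrow> bool \<times> 'a" where
  "flip a = (\<not> fst a, snd a)"

lemma reduced_tl: "reduced (a # w) \<Longrightarrow> reduced w"
  by (cases w) auto

lemma reduced_cons_letter: "reduced w \<Longrightarrow> reduced (cons_letter a w)"
  by (cases w) (auto intro: reduced_tl)

lemma reduced_foldr: "reduced u \<Longrightarrow> reduced (foldr cons_letter w u)"
  by (induction w) (auto intro: reduced_cons_letter)

lemma reduced_reduce_word: "reduced (reduce_word w)"
  unfolding reduce_word_def by (rule reduced_foldr) simp

lemma cons_letter_reduced: "reduced (a # w) \<Longrightarrow> cons_letter a w = a # w"
  by (cases w) auto

lemma reduce_word_reduced: "reduced w \<Longrightarrow> reduce_word w = w"
  unfolding reduce_word_def
proof (induction w)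
  case (Cons a w)
  then show ?case using reduced_tl[OF Cons.prems] by (simp add: cons_letter_reduced)
qed simp

lemma reduce_word_eq_iff: "reduce_word w = w \<longleftrightarrow> reduced w"
  using reduced_reduce_word reduce_word_reduced by metis

text \<open>Van der Waerden's argument: a letter and its inverse act on reduced words by mutually
  inverse bijections.\<close>

lemma cons_letter_flip: "reduced w \<Longrightarrow> cons_letter (flip a) (cons_letter a w) = w"
proof (cases w)
  case (Cons b v)
  assume w: "reduced w"
  show ?thesis
  proof (cases "snd b = snd a \<and> fst b \<noteq> fst a")
    case True
    then have b: "b = flip a" by (auto simp: flip_def prod_eq_iff)
    then have "cons_letter (flip a) v = w"
      using w Cons cons_letter_reduced by metis
    then show ?thesis using True Cons by simp
  next
    case False
    then show ?thesis using Cons by (auto simp: flip_def)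
  qed
qed (simp add: flip_def)

lemma flip_flip [simp]: "flip (flip a) = a"
  by (simp add: flip_def)

lemma cons_letter_flip': "reduced w \<Longrightarrow> cons_letter a (cons_letter (flip a) w) = w"
  using cons_letter_flip[of w "flip a"] by simp

lemma foldr_cons_letter:
  assumes "reduced u"
  shows "foldr cons_letter (cons_letter a v) u = cons_letter a (foldr cons_letter v u)"
proof (cases v)
  case (Cons b v')
  show ?thesis
  proof (cases "snd b = snd a \<and> fst b \<noteq> fst a")
    case True
    then have "b = flip a" by (auto simp: flip_def prod_eq_iff)
    then show ?thesis
      using True Cons cons_letter_flip'[OF reduced_foldr[OF assms]] by simp
  qed (use Cons in auto)
qed simp

text \<open>The action of a word on reduced words depends only on its reduced form. This gives
  associativity of the multiplication without a confluence proof for cancellation.\<close>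

lemma foldr_reduce_word:
  assumes "reduced u" shows "foldr cons_letter (reduce_word w) u = foldr cons_letter w u"
  unfolding reduce_word_def by (induction w) (simp_all add: foldr_cons_letter[OF assms])

lemma reduce_word_append: "reduce_word (u @ v) = foldr cons_letter u (reduce_word v)"
  by (simp add: reduce_word_def)

lemma reduce_word_left: "reduce_word (reduce_word u @ v) = reduce_word (u @ v)"
  by (simp add: reduce_word_append foldr_reduce_word reduced_reduce_word)

lemma reduce_word_right: "reduce_word (u @ reduce_word v) = reduce_word (u @ v)"
  by (simp add: reduce_word_append reduce_word_reduced reduced_reduce_word)

lemma foldr_inverse_word:
  "reduced u \<Longrightarrow> foldr cons_letter (rev (map flip w)) (foldr cons_letter w u) = u"
  by (induction w) (simp_all add: cons_letter_flip reduced_foldr)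

lemma set_cons_letter: "set (cons_letter a w) \<subseteq> insert a (set w)"
  by (cases w) auto

lemma set_reduce_word: "set (reduce_word w) \<subseteq> set w"
  unfolding reduce_word_def
proof (induction w)
  case (Cons a w)
  then show ?case using set_cons_letter[of a "foldr cons_letter w []"] by auto
qed simp

lemma carrier_free_group: "w \<in> carrier (free_group S) \<longleftrightarrow> w \<in> lists (UNIV \<times> S) \<and> reduced w"
  by (auto simp: free_group_def reduce_word_eq_iff)

lemma mult_free_group: "u \<otimes>\<^bsub>free_group S\<^esub> v = reduce_word (u @ v)"
  and one_free_group: "\<one>\<^bsub>free_group S\<^esub> = []"
  by (simp_all add: free_group_def)

lemma reduce_word_free_group: "w \<in> lists (UNIV \<times> S) \<Longrightarrow> reduce_word w \<in> carrier (free_group S)"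
  using set_reduce_word[of w] by (auto simp: carrier_free_group reduced_reduce_word lists_eq_set)

lemma group_free_group: "group (free_group S)"
proof (rule groupI)
  fix u v w assume "u \<in> carrier (free_group S)" "v \<in> carrier (free_group S)" "w \<in> carrier (free_group S)"
  show "u \<otimes>\<^bsub>free_group S\<^esub> v \<otimes>\<^bsub>free_group S\<^esub> w = u \<otimes>\<^bsub>free_group S\<^esub> (v \<otimes>\<^bsub>free_group S\<^esub> w)"
    by (simp add: mult_free_group reduce_word_left reduce_word_right)
next
  fix w assume w: "w \<in> carrier (free_group S)"
  show "\<one>\<^bsub>free_group S\<^esub> \<otimes>\<^bsub>free_group S\<^esub> w = w"
    using w by (simp add: mult_free_group one_free_group carrier_free_group reduce_word_reduced)
  let ?v = "reduce_word (rev (map flip w))"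
  have "set (rev (map flip w)) \<subseteq> UNIV \<times> S"
    using w by (auto simp: carrier_free_group flip_def)
  then have "?v \<in> carrier (free_group S)"
    by (intro reduce_word_free_group) (simp add: lists_eq_set)
  moreover have "?v \<otimes>\<^bsub>free_group S\<^esub> w = \<one>\<^bsub>free_group S\<^esub>"
    using foldr_inverse_word[of "[]" w]
    unfolding mult_free_group one_free_group reduce_word_left by (simp add: reduce_word_def)
  ultimately show "\<exists>v\<in>carrier (free_group S). v \<otimes>\<^bsub>free_group S\<^esub> w = \<one>\<^bsub>free_group S\<^esub>" by blast
qed (auto simp: mult_free_group one_free_group carrier_free_group reduced_reduce_word
      intro!: in_listsI dest!: set_reduce_word[THEN subsetD])

definition free_gen :: "'a \<Rightarrow> (bool \<times> 'a) list" where
  "free_gen x = [(True, x)]"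

lemma free_gen_closed: "x \<in> S \<Longrightarrow> free_gen x \<in> carrier (free_group S)"
  by (simp add: free_gen_def carrier_free_group)

lemma free_group_generated: "generate (free_group S) (free_gen ` S) = carrier (free_group S)"
proof
  interpret F: group "free_group S" by (rule group_free_group)
  show "generate (free_group S) (free_gen ` S) \<subseteq> carrier (free_group S)"
    by (rule F.generate_incl) (auto simp: free_gen_closed)
  show "carrier (free_group S) \<subseteq> generate (free_group S) (free_gen ` S)"
  proof
    fix w assume "w \<in> carrier (free_group S)"
    then show "w \<in> generate (free_group S) (free_gen ` S)"
    proof (induction w)
      case Nil
      then show ?case using generate.one[of "free_group S"] by (simp add: one_free_group)
    next
      case (Cons a w)
      obtain b x where a: "a = (b, x)" by (cases a)
      have x: "x \<in> S" and w: "w \<in> carrier (free_group S)"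
        using Cons.prems a reduced_tl by (auto simp: carrier_free_group)
      have "[(False, x)] = inv\<^bsub>free_group S\<^esub> free_gen x"
        using x by (intro F.inv_equality[symmetric])
          (simp_all add: mult_free_group one_free_group carrier_free_group reduce_word_def free_gen_def)
      then have "[a] \<in> generate (free_group S) (free_gen ` S)"
        using a x generate.incl[of "free_gen x" "free_gen ` S" "free_group S"]
          generate.inv[of "free_gen x" "free_gen ` S" "free_group S"] by (cases b) (auto simp: free_gen_def)
      moreover have "a # w = [a] \<otimes>\<^bsub>free_group S\<^esub> w"
        using Cons.prems by (simp add: mult_free_group carrier_free_group reduce_word_reduced)
      ultimately show ?case
        using Cons.IH[OF w] generate.eng by metis
    qed
  qed
qed

lemma free_extension_free_gen:
  "group H \<Longrightarrow> g x \<in> carrier H \<Longrightarrow> free_extension H g (free_gen x) = g x"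
  by (simp add: free_extension_def free_gen_def group.is_monoid)

lemma free_extension_hom:
  assumes "group H" "\<And>x. x \<in> S \<Longrightarrow> g x \<in> carrier H"
  shows "free_extension H g \<in> hom (free_group S) H"
proof -
  interpret H: plain_group H by (rule plain_group.intro) fact
  define l where "l = (\<lambda>a. if fst a then g (snd a) else inv\<^bsub>H\<^esub> g (snd a))"
  have l: "l a \<in> carrier H" if "snd a \<in> S" for a
    using assms(2)[OF that] by (simp add: l_def)
  have [simp]: "free_extension H g [] = \<one>\<^bsub>H\<^esub>"
    by (simp add: free_extension_def)
  have Cons [simp]: "free_extension H g (a # w) = l a \<otimes>\<^bsub>H\<^esub> free_extension H g w" for a w
    by (simp add: free_extension_def l_def split: prod.split)
  have closed: "free_extension H g w \<in> carrier H" if "w \<in> lists (UNIV \<times> S)" for w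
    using that by (induction w) (auto intro!: l H.m_closed)
  \<comment> \<open>Cancelling a letter against its inverse preserves the value, so evaluation is
    unchanged by \<open>reduce_word\<close>.\<close>
  have cons: "free_extension H g (cons_letter a w) = l a \<otimes>\<^bsub>H\<^esub> free_extension H g w"
    if "w \<in> lists (UNIV \<times> S)" "snd a \<in> S" for a w
  proof (cases w)
    case (Cons b v)
    show ?thesis
    proof (cases "snd b = snd a \<and> fst b \<noteq> fst a")
      case True
      then have b: "b = flip a" by (auto simp: flip_def prod_eq_iff)
      have "l a \<otimes>\<^bsub>H\<^esub> (l (flip a) \<otimes>\<^bsub>H\<^esub> free_extension H g v) = free_extension H g v"
        using assms(2)[OF that(2)] closed[of v] that(1) Cons
        by (simp add: l_def flip_def H.cancel_left)
      then show ?thesis using Cons b True by simp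
    qed (use Cons in auto)
  qed simp
  have reduce: "free_extension H g (reduce_word w) = free_extension H g w" if "w \<in> lists (UNIV \<times> S)" for w
    using that
  proof (induction w)
    case (Cons a w)
    then have "reduce_word w \<in> lists (UNIV \<times> S)"
      using reduce_word_free_group[of w S] by (simp add: carrier_free_group)
    then have "free_extension H g (cons_letter a (reduce_word w)) = l a \<otimes>\<^bsub>H\<^esub> free_extension H g w"
      using Cons by (subst cons) auto
    then show ?case by (simp add: reduce_word_def)
  qed (simp add: reduce_word_def)
  have append: "free_extension H g (u @ v) = free_extension H g u \<otimes>\<^bsub>H\<^esub> free_extension H g v"
    if "u \<in> lists (UNIV \<times> S)" "v \<in> lists (UNIV \<times> S)" for u v
    using that(1)
  proof (induction u)
    case (Cons a u)
    then have "l a \<in> carrier H" "free_extension H g u \<in> carrier H" using l closed[of u] by auto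
    then show ?case using Cons closed[OF that(2)] by (simp add: H.m_assoc)
  qed (simp add: closed[OF that(2)])
  show ?thesis
    by (rule homI) (auto simp: mult_free_group carrier_free_group reduce append closed)
qed

lemma hom_eq_on_generate:
  assumes "group G" "group H" "f \<in> hom G H" "g \<in> hom G H" "T \<subseteq> carrier G" "\<And>x. x \<in> T \<Longrightarrow> f x = g x"
    "w \<in> generate G T"
  shows "f w = g w"
proof -
  interpret f: group_hom G H f using assms by (simp add: group_hom_def group_hom_axioms_def)
  interpret g: group_hom G H g using assms by (simp add: group_hom_def group_hom_axioms_def)
  show ?thesis using assms(7)
  proof (induction rule: generate.induct)
    case (inv h)
    then show ?case using assms(5,6) by (metis f.hom_inv g.hom_inv subsetD)
  next
    case (eng h1 h2)
    then have "h1 \<in> carrier G" "h2 \<in> carrier G" using f.G.generate_in_carrier[OF assms(5)] by auto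
    then show ?case using eng by simp
  qed (simp_all add: assms)
qed

lemma free_group_hom_eq:
  assumes "group H" "f \<in> hom (free_group S) H" "g \<in> hom (free_group S) H"
    "\<And>x. x \<in> S \<Longrightarrow> f (free_gen x) = g (free_gen x)" "w \<in> carrier (free_group S)"
  shows "f w = g w"
proof (rule hom_eq_on_generate[OF group_free_group assms(1-3)])
  show "free_gen ` S \<subseteq> carrier (free_group S)" using free_gen_closed by auto
  show "w \<in> generate (free_group S) (free_gen ` S)" using assms(5) by (simp add: free_group_generated)
qed (use assms(4) in auto)

section \<open>The 2-adic integers\<close>

text \<open>The condition forces \<open>0 \<le> s n < 2 ^ n\<close> as well as compatibility, so the
  entries are canonical residues and equality of elements is equality of sequences.\<close>

typedef z2 = "{s :: nat \<Rightarrow> int. \<forall>n. s n = s (Suc n) mod 2 ^ n}" morphisms res Abs_z2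
  by (rule exI[of _ "\<lambda>_. 0"]) simp

setup_lifting type_definition_z2

lemma mod_pow2_Suc: "(a mod 2 ^ Suc n) mod 2 ^ n = a mod (2 ^ n :: int)"
  by (rule mod_mod_cancel) simp

instantiation z2 :: comm_ring_1
begin

lift_definition zero_z2 :: z2 is "\<lambda>_. 0" by simp
lift_definition one_z2 :: z2 is "\<lambda>n. 1 mod 2 ^ n" by (simp only: mod_pow2_Suc simp_thms)
lift_definition plus_z2 :: "z2 \<Rightarrow> z2 \<Rightarrow> z2" is "\<lambda>s t n. (s n + t n) mod 2 ^ n"
  unfolding mod_pow2_Suc by (metis mod_add_eq)
lift_definition times_z2 :: "z2 \<Rightarrow> z2 \<Rightarrow> z2" is "\<lambda>s t n. (s n * t n) mod 2 ^ n"
  unfolding mod_pow2_Suc by (metis mod_mult_eq)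
lift_definition uminus_z2 :: "z2 \<Rightarrow> z2" is "\<lambda>s n. (- s n) mod 2 ^ n"
  unfolding mod_pow2_Suc by (metis mod_minus_eq)
lift_definition minus_z2 :: "z2 \<Rightarrow> z2 \<Rightarrow> z2" is "\<lambda>s t n. (s n - t n) mod 2 ^ n"
  unfolding mod_pow2_Suc by (metis mod_diff_eq)

lemma res_mod [simp]: "res x n mod 2 ^ n = res x n"
  using res[of x] by (metis (mono_tags, lifting) mem_Collect_eq mod_mod_trivial)

lemma res_0 [simp]: "res x 0 = 0"
  using res_mod[of x 0] by simp

instance
proof
  fix a b c :: z2
  show "a * b * c = a * (b * c)" by (rule res_inject[THEN iffD1]) (simp add: times_z2.rep_eq mod_simps mult.assoc)
  show "a * b = b * a" by (rule res_inject[THEN iffD1]) (simp add: times_z2.rep_eq mult.commute)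
  show "1 * a = a" by (rule res_inject[THEN iffD1]) (auto simp: times_z2.rep_eq one_z2.rep_eq mod_simps fun_eq_iff of_bool_def)
  show "a + b + c = a + (b + c)" by (rule res_inject[THEN iffD1]) (simp add: plus_z2.rep_eq mod_simps add.assoc)
  show "a + b = b + a" by (rule res_inject[THEN iffD1]) (simp add: plus_z2.rep_eq add.commute)
  show "0 + a = a" by (rule res_inject[THEN iffD1]) (simp add: plus_z2.rep_eq zero_z2.rep_eq)
  show "- a + a = 0" by (rule res_inject[THEN iffD1]) (simp add: plus_z2.rep_eq zero_z2.rep_eq uminus_z2.rep_eq mod_simps)
  show "a - b = a + - b" by (rule res_inject[THEN iffD1]) (simp add: plus_z2.rep_eq minus_z2.rep_eq uminus_z2.rep_eq mod_simps)
  show "(a + b) * c = a * c + b * c" by (rule res_inject[THEN iffD1]) (simp add: plus_z2.rep_eq times_z2.rep_eq mod_simps algebra_simps)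
  have "res 0 1 \<noteq> res 1 1" by (simp add: zero_z2.rep_eq one_z2.rep_eq)
  then show "(0::z2) \<noteq> 1" by metis
qed

end

lemma res_mod_le: "m \<le> n \<Longrightarrow> res x n mod 2 ^ m = res x m"
proof (induction n rule: dec_induct)
  case (step n)
  have "res x (Suc n) mod 2 ^ m = res x (Suc n) mod 2 ^ n mod 2 ^ m"
    using step(1) by (simp add: mod_mod_cancel le_imp_power_dvd)
  also have "res x (Suc n) mod 2 ^ n = res x n" using res[of x] by (metis (mono_tags, lifting) mem_Collect_eq)
  finally show ?case using step(3) by simp
qed simp

lemma res_of_int: "res (of_int k) n = k mod 2 ^ n"
proof -
  have "res (of_nat j) n = int j mod 2 ^ n" for j
    by (induction j) (simp_all add: zero_z2.rep_eq one_z2.rep_eq plus_z2.rep_eq mod_simps add.commute)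
  then show ?thesis
    by (cases k) (simp_all add: uminus_z2.rep_eq mod_simps minus_z2.rep_eq one_z2.rep_eq plus_z2.rep_eq)
qed

text \<open>For the converse direction the quotient is written down: its residue modulo
  \<open>2 ^ j\<close> is read off from the residue of \<open>x\<close> modulo
  \<open>2 ^ (j + n)\<close>.\<close>

lemma pow2_dvd_z2_iff: "2 ^ n dvd x \<longleftrightarrow> res x n = 0"
proof
  assume "2 ^ n dvd x"
  then obtain y where "x = of_int (2 ^ n) * y" by auto
  then show "res x n = 0" by (simp add: times_z2.rep_eq res_of_int del: of_int_power)
next
  assume x: "res x n = 0"
  have dvd: "2 ^ n dvd res x (j + n)" for j
    using res_mod_le[of n "j + n" x] x by (simp add: mod_eq_0_iff_dvd)
  have "res x (j + n) div 2 ^ n = (res x (Suc j + n) div 2 ^ n) mod 2 ^ j" for j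
  proof -
    have "res x (j + n) = res x (Suc j + n) mod 2 ^ (j + n)"
      using res_mod_le[of "j + n" "Suc j + n" x] by simp
    then have "res x (j + n) div 2 ^ n = (res x (Suc j + n) mod (2 ^ n * 2 ^ j)) div 2 ^ n"
      by (simp add: power_add mult.commute)
    also have "\<dots> = (res x (Suc j + n) div 2 ^ n) mod 2 ^ j"
      by (simp add: zmod_zmult2_eq)
    finally show ?thesis .
  qed
  then have y: "res (Abs_z2 (\<lambda>j. res x (j + n) div 2 ^ n)) = (\<lambda>j. res x (j + n) div 2 ^ n)"
    by (intro Abs_z2_inverse) blast
  have "x = of_int (2 ^ n) * Abs_z2 (\<lambda>j. res x (j + n) div 2 ^ n)"
  proof (rule res_inject[THEN iffD1], rule ext)
    fix j
    have "res x j = res x (j + n) mod 2 ^ j" by (simp add: res_mod_le)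
    also have "\<dots> = (2 ^ n * (res x (j + n) div 2 ^ n)) mod 2 ^ j" using dvd[of j] by simp
    finally show "res x j = res (of_int (2 ^ n) * Abs_z2 (\<lambda>j. res x (j + n) div 2 ^ n)) j"
      by (simp add: times_z2.rep_eq res_of_int y mod_simps del: of_int_power)
  qed
  then show "2 ^ n dvd x" by (metis dvd_triv_left of_int_numeral of_int_power)
qed

lemma pow2_dvd_of_int_iff: "2 ^ n dvd (of_int k :: z2) \<longleftrightarrow> 2 ^ n dvd k"
  by (simp add: pow2_dvd_z2_iff res_of_int mod_eq_0_iff_dvd)

lemma z2_approx: "\<exists>k. 2 ^ n dvd (x :: z2) - of_int k"
  by (rule exI[of _ "res x n"]) (simp add: pow2_dvd_z2_iff minus_z2.rep_eq res_of_int)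

lemma z2_separated: "(\<And>n. 2 ^ n dvd x) \<Longrightarrow> x = 0" for x :: z2
  by (rule res_inject[THEN iffD1]) (auto simp: pow2_dvd_z2_iff zero_z2.rep_eq)

text \<open>Completeness: the limit has the \<open>n\<close>-th residue of \<open>s n\<close> as its
  \<open>n\<close>-th residue.\<close>

lemma z2_limit:
  fixes s :: "nat \<Rightarrow> z2"
  assumes "\<And>n. 2 ^ n dvd s (Suc n) - s n"
  shows "\<exists>x. \<forall>n. 2 ^ n dvd x - s n"
proof -
  have "res (s n) n = res (s (Suc n)) (Suc n) mod 2 ^ n" for n
  proof -
    have "res (s (Suc n)) n mod 2 ^ n = res (s n) n mod 2 ^ n"
      using assms[of n] unfolding pow2_dvd_z2_iff minus_z2.rep_eq mod_eq_0_iff_dvd mod_eq_dvd_iff .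
    then show ?thesis using res_mod_le[of n "Suc n" "s (Suc n)"] by simp
  qed
  then have "res (Abs_z2 (\<lambda>n. res (s n) n)) = (\<lambda>n. res (s n) n)"
    by (intro Abs_z2_inverse) blast
  then show ?thesis
    by (intro exI[of _ "Abs_z2 (\<lambda>n. res (s n) n)"]) (simp add: pow2_dvd_z2_iff minus_z2.rep_eq)
qed

lemma int_zero_of_pow2_dvd: "(\<And>n. 2 ^ n dvd k) \<Longrightarrow> k = 0" for k :: int
proof (rule ccontr)
  assume *: "\<And>n. 2 ^ n dvd k" and k: "k \<noteq> 0"
  have "2 ^ nat \<bar>k\<bar> \<le> \<bar>k\<bar>" using dvd_imp_le_int[OF k *[of "nat \<bar>k\<bar>"]] by simp
  moreover have "nat \<bar>k\<bar> < 2 ^ nat \<bar>k\<bar>" by (rule less_exp)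
  then have "\<bar>k\<bar> < 2 ^ nat \<bar>k\<bar>" by (metis nat_less_iff abs_ge_zero of_nat_numeral of_nat_power zless_nat_eq_int_zless)
  ultimately show False by simp
qed

lemma of_int_z2_eq_iff: "(of_int k :: z2) = of_int l \<longleftrightarrow> k = l"
proof
  assume "(of_int k :: z2) = of_int l"
  then have "(of_int (k - l) :: z2) = 0" by simp
  then have "2 ^ n dvd k - l" for n using pow2_dvd_of_int_iff[of n "k - l"] by simp
  then show "k = l" using int_zero_of_pow2_dvd[of "k - l"] by simp
qed simp

text \<open>Absence of 2-torsion; it allows the factor 2 in the commutator relation of the central
  extension to be cancelled.\<close>

lemma z2_double_eq_0: "2 * x = 0 \<Longrightarrow> x = 0" for x :: z2
proof (rule z2_separated)
  fix n assume "2 * x = 0"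
  then have "res (of_int 2 * x) (Suc n) = 0" by (simp add: zero_z2.rep_eq)
  then have "2 ^ Suc n dvd (2 * res x (Suc n) :: int)"
    by (simp add: times_z2.rep_eq res_of_int mod_simps mod_eq_0_iff_dvd del: of_int_numeral)
  then have "2 ^ n dvd res x (Suc n)" by simp
  then show "2 ^ n dvd x" using res_mod_le[of n "Suc n" x] by (simp add: pow2_dvd_z2_iff mod_eq_0_iff_dvd)
qed

text \<open>Inverses of \<open>k\<close> modulo \<open>2 ^ n\<close> are chosen for each
  \<open>n\<close> separately. They are compatible because \<open>k\<close> can be cancelled modulo
  \<open>2 ^ n\<close>, so they converge.\<close>

lemma odd_z2_unit:
  assumes "odd k" shows "\<exists>c :: z2. of_int k * c = 1"
proof -
  have cop: "coprime k (2 ^ n)" for n using assms by simp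
  then have "\<forall>n. \<exists>c. 2 ^ n dvd k * c - 1"
    by (metis cong_iff_dvd_diff cong_solve_coprime_int)
  then obtain c where c: "\<And>n. 2 ^ n dvd k * c n - 1" by metis
  have "2 ^ n dvd c (Suc n) - c n" for n
  proof -
    have "2 ^ n dvd k * c (Suc n) - 1" using c[of "Suc n"] by (metis dvd_mult_right power_Suc)
    then have "2 ^ n dvd k * (c (Suc n) - c n)"
      using c[of n] dvd_diff[of "2 ^ n" "k * c (Suc n) - 1" "k * c n - 1"] by (simp add: algebra_simps)
    then show ?thesis using cop coprime_commute coprime_dvd_mult_right_iff by blast
  qed
  then have "2 ^ n dvd (of_int (c (Suc n)) - of_int (c n) :: z2)" for n
    using pow2_dvd_of_int_iff[of n "c (Suc n) - c n"] by simp
  then obtain x :: z2 where x: "\<And>n. 2 ^ n dvd x - of_int (c n)" using z2_limit[of "\<lambda>n. of_int (c n)"] by blast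
  have "2 ^ n dvd of_int k * x - 1" for n
  proof -
    have "2 ^ n dvd of_int k * (x - of_int (c n)) + of_int (k * c n - 1)"
      using x[of n] pow2_dvd_of_int_iff c by (intro dvd_add dvd_mult) blast+
    then show ?thesis by (simp add: algebra_simps)
  qed
  then show ?thesis using z2_separated[of "of_int k * x - 1"] by auto
qed

lemma odd_square_mod_8: "odd a \<Longrightarrow> 8 dvd a * a - (1 :: int)"
proof -
  assume "odd a"
  then obtain b where a: "a = 2 * b + 1" by (elim oddE)
  have "even (b * (b + 1))" by simp
  then obtain c where "b * (b + 1) = 2 * c" by (elim evenE)
  then have "a * a - 1 = 8 * c" unfolding a by (simp add: algebra_simps)
  then show ?thesis by simp
qed

text \<open>An approximation of \<open>s\<close> modulo 8 by an integer \<open>a\<close> reduces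
  this to odd integer squares; if \<open>a\<close> were even, 2 would divide 1.\<close>

lemma z2_unit_square:
  fixes s :: z2
  assumes "s * t = 1" shows "8 dvd s * s - 1"
proof -
  obtain a where "2 ^ 3 dvd s - of_int a" using z2_approx by blast
  then obtain z where "s - of_int a = 2 ^ 3 * z" by (elim dvdE)
  then have s: "s = of_int a + 8 * z" by (simp add: algebra_simps)
  have "odd a"
  proof
    assume "even a"
    then obtain b where "a = 2 * b" by (elim evenE)
    then have "1 = 2 * ((of_int b + 4 * z) * t)" using assms s by (simp add: algebra_simps)
    then have "(2 ^ 1 :: z2) dvd of_int 1" by (metis dvd_triv_left of_int_1 power_one_right)
    then show False unfolding pow2_dvd_of_int_iff by simp
  qed
  then have "(2 ^ 3 :: int) dvd a * a - 1" using odd_square_mod_8 by simp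
  then have "(2 ^ 3 :: z2) dvd of_int (a * a - 1)" by (simp only: pow2_dvd_of_int_iff)
  then have "8 dvd (of_int (a * a - 1) :: z2)" by simp
  moreover have "s * s - 1 = of_int (a * a - 1) + 8 * (2 * of_int a * z + 8 * z * z)"
    unfolding s by (simp add: algebra_simps)
  ultimately show ?thesis by (metis dvd_add dvd_triv_left)
qed

section \<open>The fundamental group of \<open>Wbar\<close> of a simplicial group\<close>

text \<open>Edges of \<open>Wbar H\<close> are elements of degree 0 and its 2-simplices are pairs
  from degrees 1 and 0, so the fundamental group of \<open>Wbar H\<close> is the group of components
  of \<open>H\<close>, determined by these two levels.\<close>

locale simp_group_01 =
  fixes H :: "'a simp_group" and H0 H1 :: "'a monoid" and D0 D1 S :: "'a \<Rightarrow> 'a"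
  defines "H0 \<equiv> level H 0" and "H1 \<equiv> level H 1"
    and "D0 \<equiv> gface H 1 0" and "D1 \<equiv> gface H 1 1" and "S \<equiv> gdegen H 0 0"
  assumes group0: "group H0" and group1: "group H1"
    and D0_hom: "D0 \<in> hom H1 H0" and D1_hom: "D1 \<in> hom H1 H0" and S_hom: "S \<in> hom H0 H1"
    and D0_S: "x \<in> carrier H0 \<Longrightarrow> D0 (S x) = x"
    and D1_S: "x \<in> carrier H0 \<Longrightarrow> D1 (S x) = x"
begin

sublocale H0: plain_group H0 by (rule plain_group.intro[OF group0])
sublocale H1: plain_group H1 by (rule plain_group.intro[OF group1])
sublocale D0: group_hom H1 H0 D0 by unfold_locales (fact D0_hom)
sublocale D1: group_hom H1 H0 D1 by unfold_locales (fact D1_hom)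
sublocale S: group_hom H0 H1 S by unfold_locales (fact S_hom)

definition rel :: "'a \<Rightarrow> 'a \<Rightarrow> bool" where
  "rel x x' \<longleftrightarrow> (\<exists>y\<in>carrier H1. D0 y = x \<and> D1 y = x')"

lemma rel_carrier: "rel x x' \<Longrightarrow> x \<in> carrier H0" "rel x x' \<Longrightarrow> x' \<in> carrier H0"
  by (auto simp: rel_def)

lemma rel_refl: "x \<in> carrier H0 \<Longrightarrow> rel x x"
  unfolding rel_def using D0_S D1_S by (intro bexI[of _ "S x"]) auto

lemma rel_mult: "rel x x' \<Longrightarrow> rel y y' \<Longrightarrow> rel (x \<otimes>\<^bsub>H0\<^esub> y) (x' \<otimes>\<^bsub>H0\<^esub> y')"
  unfolding rel_def by (metis D0.hom_mult D1.hom_mult H1.m_closed)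

lemma rel_inv: "rel x x' \<Longrightarrow> rel (inv\<^bsub>H0\<^esub> x) (inv\<^bsub>H0\<^esub> x')"
  unfolding rel_def by (metis D0.hom_inv D1.hom_inv H1.inv_closed)

text \<open>Mal'cev's argument: a reflexive relation compatible with the group operations is
  symmetric, and likewise transitive. Fillers of horns are thereby replaced by computation in the
  group.\<close>

lemma rel_sym:
  assumes "rel x x'" shows "rel x' x"
proof -
  have c: "x \<in> carrier H0" "x' \<in> carrier H0" using assms rel_carrier by auto
  have "rel (x' \<otimes>\<^bsub>H0\<^esub> inv\<^bsub>H0\<^esub> x \<otimes>\<^bsub>H0\<^esub> x) (x' \<otimes>\<^bsub>H0\<^esub> inv\<^bsub>H0\<^esub> x' \<otimes>\<^bsub>H0\<^esub> x)"
    using c assms by (intro rel_mult rel_inv rel_refl)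
  then show ?thesis using c by (simp add: H0.word_simps)
qed

lemma rel_trans:
  assumes "rel x y" "rel y z" shows "rel x z"
proof -
  have c: "x \<in> carrier H0" "y \<in> carrier H0" "z \<in> carrier H0" using assms rel_carrier by auto
  have "rel (x \<otimes>\<^bsub>H0\<^esub> inv\<^bsub>H0\<^esub> y \<otimes>\<^bsub>H0\<^esub> y) (y \<otimes>\<^bsub>H0\<^esub> inv\<^bsub>H0\<^esub> y \<otimes>\<^bsub>H0\<^esub> z)"
    using c assms by (intro rel_mult rel_inv rel_refl)
  then show ?thesis using c by (simp add: H0.word_simps)
qed

definition pi1 :: "'a list set monoid" where
  "pi1 = simp_fundamental_group (Wbar H) []"

definition cls :: "'a \<Rightarrow> 'a list set" where
  "cls x = {[x'] |x'. rel x x'}"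

lemma cls_eq_iff: "x \<in> carrier H0 \<Longrightarrow> y \<in> carrier H0 \<Longrightarrow> cls x = cls y \<longleftrightarrow> rel x y"
  unfolding cls_def using rel_refl rel_sym rel_trans by blast

lemma simplices_1: "simplices (Wbar H) 1 = {[x] |x. x \<in> carrier H0}"
  by (auto simp: Wbar_def H0_def length_Suc_conv)

lemma simplices_2: "simplices (Wbar H) 2 = {[y, x] |y x. y \<in> carrier H1 \<and> x \<in> carrier H0}"
proof -
  have "length xs = 2 \<and> (\<forall>j<2. xs ! j \<in> carrier (level H (2 - 1 - j)))
    \<longleftrightarrow> (\<exists>y x. xs = [y, x] \<and> y \<in> carrier H1 \<and> x \<in> carrier H0)" for xs
    by (auto simp: H0_def H1_def length_Suc_conv numeral_2_eq_2 less_Suc_eq all_conj_distrib)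
  then show ?thesis by (simp add: Wbar_def)
qed

lemma faces:
  "face (Wbar H) 2 0 [y, x] = [x]"
  "face (Wbar H) 2 1 [y, x] = [D0 y \<otimes>\<^bsub>H0\<^esub> x]"
  "face (Wbar H) 2 2 [y, x] = [D1 y]"
  "degen (Wbar H) 0 0 [] = [\<one>\<^bsub>H0\<^esub>]"
  by (simp_all add: Wbar_def H0_def D0_def D1_def)

lemma simp_loops_Wbar: "simp_loops (Wbar H) [] = {[x] |x. x \<in> carrier H0}"
proof -
  have "face (Wbar H) 1 0 [x] = []" "face (Wbar H) 1 1 [x] = []" for x
    by (simp_all add: Wbar_def)
  then show ?thesis unfolding simp_loops_def simplices_1 by auto
qed

lemma simp_homotopy_Wbar: "simp_homotopy (Wbar H) [] `` {[x]} = cls x"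
proof (rule Set.set_eqI)
  fix w
  show "w \<in> simp_homotopy (Wbar H) [] `` {[x]} \<longleftrightarrow> w \<in> cls x"
  proof
    assume "w \<in> simp_homotopy (Wbar H) [] `` {[x]}"
    then obtain x' y u where "w = [x']" "y \<in> carrier H1" "u = \<one>\<^bsub>H0\<^esub>" "D0 y \<otimes>\<^bsub>H0\<^esub> u = x" "D1 y = x'"
      unfolding simp_homotopy_def simplices_2 simp_loops_Wbar by (auto simp: faces simp del: One_nat_def)
    then show "w \<in> cls x" by (auto simp: cls_def rel_def)
  next
    assume "w \<in> cls x"
    then obtain y where y: "y \<in> carrier H1" "D0 y = x" "w = [D1 y]" by (auto simp: cls_def rel_def)
    then have "[y, \<one>\<^bsub>H0\<^esub>] \<in> simplices (Wbar H) 2" "face (Wbar H) 2 1 [y, \<one>\<^bsub>H0\<^esub>] = [x]"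
      by (auto simp: simplices_2 faces(2) simp del: One_nat_def)
    then show "w \<in> simp_homotopy (Wbar H) [] `` {[x]}"
      using y unfolding simp_homotopy_def simp_loops_Wbar
      by (auto simp: faces simp del: One_nat_def intro!: bexI[of _ "[y, \<one>\<^bsub>H0\<^esub>]"])
  qed
qed

lemma carrier_pi1: "carrier pi1 = cls ` carrier H0"
proof -
  have "carrier pi1 = (\<Union>w\<in>{[x] |x. x \<in> carrier H0}. {simp_homotopy (Wbar H) [] `` {w}})"
    by (simp add: pi1_def simp_fundamental_group_def quotient_def simp_loops_Wbar)
  also have "\<dots> = (\<lambda>x. simp_homotopy (Wbar H) [] `` {[x]}) ` carrier H0"
    by auto
  finally show ?thesis by (simp add: simp_homotopy_Wbar)
qed

lemma one_pi1: "\<one>\<^bsub>pi1\<^esub> = cls \<one>\<^bsub>H0\<^esub>"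
  by (simp add: pi1_def simp_fundamental_group_def faces simp_homotopy_Wbar)

lemma mult_pi1:
  assumes a: "a \<in> carrier H0" and b: "b \<in> carrier H0"
  shows "cls a \<otimes>\<^bsub>pi1\<^esub> cls b = cls (a \<otimes>\<^bsub>H0\<^esub> b)"
proof -
  let ?Z = "{z \<in> simplices (Wbar H) 2. face (Wbar H) 2 2 z \<in> cls a \<and> face (Wbar H) 2 0 z \<in> cls b}"
  have Z: "simp_homotopy (Wbar H) [] `` {face (Wbar H) 2 1 z} = cls (a \<otimes>\<^bsub>H0\<^esub> b)" if z: "z \<in> ?Z" for z
  proof -
    obtain y x where yx: "z = [y, x]" "y \<in> carrier H1" "x \<in> carrier H0"
      using z by (auto simp: simplices_2)
    have "rel a (D1 y)" "rel b x" using z by (auto simp: yx faces cls_def)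
    moreover have "rel (D0 y) (D1 y)" using yx by (auto simp: rel_def)
    ultimately have "rel (D0 y \<otimes>\<^bsub>H0\<^esub> x) (a \<otimes>\<^bsub>H0\<^esub> b)"
      by (blast intro: rel_mult rel_sym rel_trans)
    then show ?thesis
      using yx a b by (simp add: faces(2) simp_homotopy_Wbar cls_eq_iff del: One_nat_def)
  qed
  \<comment> \<open>This 2-simplex has outer edges \<open>a\<close> and \<open>b\<close>; it shows
    that the union defining the product is not empty.\<close>
  have "[S a, b] \<in> ?Z"
    using a b D1_S rel_refl by (auto simp: simplices_2 faces cls_def)
  then have "(\<Union>z\<in>?Z. simp_homotopy (Wbar H) [] `` {face (Wbar H) 2 1 z}) = cls (a \<otimes>\<^bsub>H0\<^esub> b)"
    using Z by blast
  then show ?thesis by (simp add: pi1_def simp_fundamental_group_def)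
qed

lemma group_pi1: "group pi1"
proof (rule groupI)
  fix x assume "x \<in> carrier pi1"
  then obtain a where a: "a \<in> carrier H0" "x = cls a" by (auto simp: carrier_pi1)
  then show "\<one>\<^bsub>pi1\<^esub> \<otimes>\<^bsub>pi1\<^esub> x = x" by (simp add: one_pi1 mult_pi1)
  have "cls (inv\<^bsub>H0\<^esub> a) \<otimes>\<^bsub>pi1\<^esub> x = \<one>\<^bsub>pi1\<^esub>" using a by (simp add: one_pi1 mult_pi1)
  then show "\<exists>y\<in>carrier pi1. y \<otimes>\<^bsub>pi1\<^esub> x = \<one>\<^bsub>pi1\<^esub>" using a by (auto simp: carrier_pi1)
qed (auto simp: carrier_pi1 one_pi1 mult_pi1 H0.m_assoc)

lemma cls_hom: "cls \<in> hom H0 pi1"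
  by (rule homI) (auto simp: carrier_pi1 mult_pi1)

end

section \<open>The right exact completion\<close>

lemma completion_map_const:
  assumes "group G" "group H" "h \<in> hom G H" "g \<in> carrier G"
  shows "completion_map H h (plain_group.compl_lim G (\<lambda>_. g)) = plain_group.compl_lim H (\<lambda>_. h g)"
proof -
  interpret G: plain_group G by (rule plain_group.intro) fact
  interpret H: plain_group H by (rule plain_group.intro) fact
  have h: "h g \<in> carrier H" using assms(3,4) by (auto simp: hom_def)
  have "h g \<in> completion_map H h (G.compl_lim (\<lambda>_. g)) n \<and> h g \<in> H.compl_lim (\<lambda>_. h g) n" for n
    using completion_map_mem[OF assms(1-3) G.compl_of_closed[OF assms(4)] G.compl_of_mem[OF assms(4)]]
      H.compl_of_mem[OF h] by simp
  then show ?thesis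
    using completion_map_closed[OF assms(1-3) G.compl_of_closed[OF assms(4)]] H.compl_of_closed[OF h]
    by (intro H.compl_eqI) auto
qed

lemma completion_map_comp:
  assumes "group F" "group G" "group H" "g \<in> hom F G" "h \<in> hom G H" "k \<in> hom F H"
    and eq: "\<And>f. f \<in> carrier F \<Longrightarrow> h (g f) = k f"
    and x: "x \<in> carrier (pronilpotent_completion F)"
  shows "completion_map H h (completion_map G g x) = completion_map H k x"
proof -
  interpret F: plain_group F by (rule plain_group.intro) fact
  interpret G: plain_group G by (rule plain_group.intro) fact
  interpret H: plain_group H by (rule plain_group.intro) fact
  note gx = completion_map_closed[OF assms(1,2,4) x]
  have "\<exists>z. z \<in> completion_map H h (completion_map G g x) n \<and> z \<in> completion_map H k x n" for n
  proof -
    obtain f where f: "f \<in> x n" using F.compl_nonempty[OF x] by blast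
    have "h (g f) \<in> completion_map H h (completion_map G g x) n"
      by (intro completion_map_mem[OF assms(2,3,5) gx] completion_map_mem[OF assms(1,2,4) x] f)
    moreover have "k f \<in> completion_map H k x n"
      by (intro completion_map_mem[OF assms(1,3,6) x] f)
    ultimately show ?thesis using eq F.compl_mem_carrier[OF x f] by auto
  qed
  then show ?thesis
    using completion_map_closed[OF assms(2,3,5) gx] completion_map_closed[OF assms(1,3,6) x]
    by (intro H.compl_eqI) auto
qed

lemma completion_map_id:
  assumes "group G" "h \<in> hom G G" "\<And>g. g \<in> carrier G \<Longrightarrow> h g = g"
    and x: "x \<in> carrier (pronilpotent_completion G)"
  shows "completion_map G h x = x"
proof -
  interpret G: plain_group G by (rule plain_group.intro) fact
  have "\<exists>z. z \<in> completion_map G h x n \<and> z \<in> x n" for n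
  proof -
    obtain f where f: "f \<in> x n" using G.compl_nonempty[OF x] by blast
    have "h f \<in> completion_map G h x n"
      by (intro completion_map_mem[OF assms(1,1,2) x] f)
    then show ?thesis using assms(3) G.compl_mem_carrier[OF x f] f by auto
  qed
  then show ?thesis using completion_map_closed[OF assms(1,1,2) x] x by (intro G.compl_eqI) auto
qed

locale bar_group = plain_group
begin

definition BG :: "'a list simp_set" where "BG = classifying_space G"

text \<open>The free generators in degree 0 and below in degree 1. Since \<open>degen 0\<close>
  inserts the identity in front, only the first entry is required to be nontrivial.\<close>

definition gens0 :: "'a list set" where "gens0 = {[g] |g. g \<in> carrier G \<and> g \<noteq> \<one>}"
definition gens1 :: "'a list set" where "gens1 = {[g, h] |g h. g \<in> carrier G \<and> h \<in> carrier G \<and> g \<noteq> \<one>}"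

definition F0 :: "(bool \<times> 'a list) list monoid" where "F0 = free_group gens0"
definition F1 :: "(bool \<times> 'a list) list monoid" where "F1 = free_group gens1"

text \<open>The class of the 1-simplex \<open>[g]\<close> in the loop group; the case distinction is
  the relation that kills the degenerate simplex.\<close>

definition tau :: "'a \<Rightarrow> (bool \<times> 'a list) list" where
  "tau g = (if g = \<one> then \<one>\<^bsub>F0\<^esub> else free_gen [g])"

lemma BG_simps:
  "simplices BG 0 = {[]}"
  "simplices BG (Suc 0) = {[g] |g. g \<in> carrier G}"
  "simplices BG (Suc (Suc 0)) = {[g, h] |g h. g \<in> carrier G \<and> h \<in> carrier G}"
  "face BG (Suc (Suc 0)) 0 [g, h] = [h]"
  "face BG (Suc (Suc 0)) (Suc 0) [g, h] = [g \<otimes> h]"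
  "face BG (Suc (Suc 0)) (Suc (Suc 0)) [g, h] = [g]"
  "degen BG 0 0 [] = [\<one>]"
  "degen BG (Suc 0) 0 [g] = [\<one>, g]"
  "degen BG (Suc 0) (Suc 0) [g] = [g, \<one>]"
proof -
  have "length xs = Suc (Suc 0) \<and> (\<forall>j<Suc (Suc 0). xs ! j \<in> carrier G)
    \<longleftrightarrow> (\<exists>g h. xs = [g, h] \<and> g \<in> carrier G \<and> h \<in> carrier G)" for xs
    by (auto simp: length_Suc_conv less_Suc_eq all_conj_distrib)
  then show "simplices BG (Suc (Suc 0)) = {[g, h] |g h. g \<in> carrier G \<and> h \<in> carrier G}"
    by (simp add: BG_def classifying_space_def Wbar_def)
  show "simplices BG (Suc 0) = {[g] |g. g \<in> carrier G}"
    by (auto simp: BG_def classifying_space_def Wbar_def length_Suc_conv)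
qed (simp_all add: BG_def classifying_space_def Wbar_def)

lemma loop_level_BG: "loop_level BG 0 = F0" "loop_level BG (Suc 0) = F1"
proof -
  have "degen BG 0 0 ` simplices BG 0 = {[\<one>]}" by (simp add: BG_simps)
  then have "simplices BG (Suc 0) - degen BG 0 0 ` simplices BG 0 = gens0"
    by (auto simp: gens0_def BG_simps)
  then show "loop_level BG 0 = F0" by (simp add: loop_level_def F0_def)
  have "degen BG (Suc 0) 0 ` simplices BG (Suc 0) = {[\<one>, g] |g. g \<in> carrier G}"
    by (auto simp: BG_simps image_def)
  then have "simplices BG (Suc (Suc 0)) - degen BG (Suc 0) 0 ` simplices BG (Suc 0) = gens1"
    by (auto simp: gens1_def BG_simps)
  then show "loop_level BG (Suc 0) = F1" by (simp add: loop_level_def F1_def)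
qed

lemma loop_gen_BG: "loop_gen BG 0 [g] = tau g"
  by (simp add: loop_gen_def BG_simps tau_def free_gen_def F0_def one_free_group)

lemma group_F0: "group F0" and group_F1: "group F1"
  unfolding F0_def F1_def by (rule group_free_group)+

sublocale F0: plain_group F0 by (rule plain_group.intro[OF group_F0])
sublocale F1: plain_group F1 by (rule plain_group.intro[OF group_F1])

lemma tau_closed: "g \<in> carrier G \<Longrightarrow> tau g \<in> carrier F0"
  using free_gen_closed[of "[g]" gens0] F0.one_closed by (auto simp: tau_def F0_def gens0_def)

lemma generate_F0: "generate F0 (tau ` carrier G) = carrier F0"
proof
  show "generate F0 (tau ` carrier G) \<subseteq> carrier F0"
    using tau_closed by (intro F0.generate_incl) auto
  have "free_gen ` gens0 \<subseteq> tau ` carrier G"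
    by (auto simp: gens0_def tau_def image_def)
  then have "generate F0 (free_gen ` gens0) \<subseteq> generate F0 (tau ` carrier G)"
    by (rule F0.mono_generate)
  then show "carrier F0 \<subseteq> generate F0 (tau ` carrier G)"
    using free_group_generated[of gens0] by (simp add: F0_def)
qed

lemma F0_hom_eq:
  assumes "group H" "f \<in> hom F0 H" "g \<in> hom F0 H" "\<And>x. x \<in> carrier G \<Longrightarrow> f (tau x) = g (tau x)"
    "w \<in> carrier F0"
  shows "f w = g w"
proof (rule hom_eq_on_generate[OF group_F0 assms(1-3)])
  show "tau ` carrier G \<subseteq> carrier F0" using tau_closed by auto
  show "w \<in> generate F0 (tau ` carrier G)" using assms(5) generate_F0 by simp
qed (use assms(4) in auto)

definition d0 :: "(bool \<times> 'a list) list \<Rightarrow> (bool \<times> 'a list) list" where "d0 = gface (loop_group BG) 1 0"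
definition d1 :: "(bool \<times> 'a list) list \<Rightarrow> (bool \<times> 'a list) list" where "d1 = gface (loop_group BG) 1 1"
definition s0 :: "(bool \<times> 'a list) list \<Rightarrow> (bool \<times> 'a list) list" where "s0 = gdegen (loop_group BG) 0 0"

lemma d0_hom: "d0 \<in> hom F1 F0"
  and d0_gen: "[g, h] \<in> gens1 \<Longrightarrow> d0 (free_gen [g, h]) = tau (g \<otimes> h) \<otimes>\<^bsub>F0\<^esub> inv\<^bsub>F0\<^esub> tau h"
proof -
  define f where "f x = loop_gen BG 0 (face BG (Suc (Suc 0)) (Suc 0) x)
    \<otimes>\<^bsub>F0\<^esub> inv\<^bsub>F0\<^esub> loop_gen BG 0 (face BG (Suc (Suc 0)) 0 x)" for x
  have d0: "d0 = free_extension F0 f"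
    by (simp add: d0_def loop_group_def loop_level_BG f_def[abs_def])
  have f: "f [g, h] = tau (g \<otimes> h) \<otimes>\<^bsub>F0\<^esub> inv\<^bsub>F0\<^esub> tau h" for g h
    by (simp add: f_def BG_simps loop_gen_BG)
  then have closed: "f x \<in> carrier F0" if "x \<in> gens1" for x
    using that tau_closed by (auto simp: gens1_def)
  show "d0 \<in> hom F1 F0"
    unfolding d0 F1_def by (rule free_extension_hom[OF group_F0 closed])
  show "[g, h] \<in> gens1 \<Longrightarrow> d0 (free_gen [g, h]) = tau (g \<otimes> h) \<otimes>\<^bsub>F0\<^esub> inv\<^bsub>F0\<^esub> tau h"
    using closed[of "[g, h]"] by (simp add: d0 free_extension_free_gen group_F0 f)
qed

lemma d1_hom: "d1 \<in> hom F1 F0"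
  and d1_gen: "[g, h] \<in> gens1 \<Longrightarrow> d1 (free_gen [g, h]) = tau g"
proof -
  define f where "f x = loop_gen BG 0 (face BG (Suc (Suc 0)) (Suc (Suc 0)) x)" for x
  have d1: "d1 = free_extension F0 f"
    by (simp add: d1_def loop_group_def loop_level_BG f_def[abs_def])
  have f: "f [g, h] = tau g" for g h
    by (simp add: f_def BG_simps loop_gen_BG)
  then have closed: "f x \<in> carrier F0" if "x \<in> gens1" for x
    using that tau_closed by (auto simp: gens1_def)
  show "d1 \<in> hom F1 F0"
    unfolding d1 F1_def by (rule free_extension_hom[OF group_F0 closed])
  show "[g, h] \<in> gens1 \<Longrightarrow> d1 (free_gen [g, h]) = tau g"
    using closed[of "[g, h]"] by (simp add: d1 free_extension_free_gen group_F0 f)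
qed

lemma s0_hom: "s0 \<in> hom F0 F1"
  and s0_gen: "[g] \<in> gens0 \<Longrightarrow> s0 (free_gen [g]) = free_gen [g, \<one>]"
proof -
  define f where "f x = loop_gen BG (Suc 0) (degen BG (Suc 0) (Suc 0) x)" for x
  have s0: "s0 = free_extension F1 f"
    by (simp add: s0_def loop_group_def loop_level_BG f_def[abs_def])
  have img: "degen BG (Suc 0) 0 ` simplices BG (Suc 0) = {[\<one>, g] |g. g \<in> carrier G}"
    by (auto simp: BG_simps image_def)
  have f: "f [g] = free_gen [g, \<one>]" if "[g] \<in> gens0" for g
    using that by (simp add: f_def loop_gen_def img BG_simps(9) free_gen_def gens0_def)
  have closed: "f x \<in> carrier F1" if "x \<in> gens0" for x
  proof -
    obtain g where g: "x = [g]" "g \<in> carrier G" "g \<noteq> \<one>" using \<open>x \<in> gens0\<close> by (auto simp: gens0_def)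
    then have "[g, \<one>] \<in> gens1" by (auto simp: gens1_def)
    then show ?thesis using f[of g] that g free_gen_closed by (simp add: F1_def)
  qed
  show "s0 \<in> hom F0 F1"
    unfolding s0 F0_def by (rule free_extension_hom[OF group_F1 closed])
  show "[g] \<in> gens0 \<Longrightarrow> s0 (free_gen [g]) = free_gen [g, \<one>]"
    using closed[of "[g]"] f[of g] by (simp add: s0 free_extension_free_gen group_F1)
qed

lemma
  assumes w: "w \<in> carrier F0"
  shows d0_s0: "d0 (s0 w) = w" and d1_s0: "d1 (s0 w) = w"
proof -
  have comp: "d0 \<circ> s0 \<in> hom F0 F0" "d1 \<circ> s0 \<in> hom F0 F0" "id \<in> hom F0 F0"
    using s0_hom d0_hom d1_hom by (auto simp: hom_def Pi_def)
  have gens: "(d0 \<circ> s0) (tau g) = id (tau g) \<and> (d1 \<circ> s0) (tau g) = id (tau g)"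
    if g: "g \<in> carrier G" for g
  proof (cases "g = \<one>")
    case True
    then show ?thesis
      using hom_one[OF comp(1) group_F0 group_F0] hom_one[OF comp(2) group_F0 group_F0] by (simp add: tau_def)
  next
    case False
    then have "[g] \<in> gens0" "[g, \<one>] \<in> gens1" "tau g = free_gen [g]"
      using g by (auto simp: gens0_def gens1_def tau_def)
    then show ?thesis
      using g tau_closed[OF g] by (simp add: s0_gen d0_gen d1_gen) (simp add: tau_def)
  qed
  show "d0 (s0 w) = w" "d1 (s0 w) = w"
    using F0_hom_eq[OF group_F0 comp(1,3) _ w] F0_hom_eq[OF group_F0 comp(2,3) _ w] gens by auto
qed

lemma level_loop_group: "level (loop_group BG) 0 = F0" "level (loop_group BG) 1 = F1"
  by (simp_all add: loop_group_def loop_level_BG)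

end

context bar_group
begin

lemma simp_group_01_loop_group: "simp_group_01 (loop_group BG)"
  by (rule simp_group_01.intro)
    (simp_all only: level_loop_group One_nat_def[symmetric] d0_def[symmetric] d1_def[symmetric]
      s0_def[symmetric] group_F0 group_F1 d0_hom d1_hom s0_hom d0_s0 d1_s0)

sublocale L: simp_group_01 "loop_group BG" F0 F1 d0 d1 s0
  by (rule simp_group_01_loop_group)
    (simp_all only: level_loop_group One_nat_def[symmetric] d0_def[symmetric] d1_def[symmetric] s0_def[symmetric])

lemma simp_completion_loop_group:
  "level (simp_completion (loop_group BG)) 0 = F0.compl"
  "level (simp_completion (loop_group BG)) 1 = F1.compl"
  "gface (simp_completion (loop_group BG)) 1 0 = completion_map F0 d0"
  "gface (simp_completion (loop_group BG)) 1 1 = completion_map F0 d1"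
  "gdegen (simp_completion (loop_group BG)) 0 0 = completion_map F1 s0"
  by (simp_all add: simp_completion_def level_loop_group[unfolded One_nat_def] d0_def d1_def s0_def)

lemma completion_map_faces_s0:
  assumes "x \<in> carrier F0.compl"
  shows "completion_map F0 d0 (completion_map F1 s0 x) = x"
    and "completion_map F0 d1 (completion_map F1 s0 x) = x"
proof -
  have id: "(\<lambda>x. x) \<in> hom F0 F0" by (simp add: hom_def)
  show "completion_map F0 d0 (completion_map F1 s0 x) = x"
    using completion_map_comp[OF group_F0 group_F1 group_F0 s0_hom d0_hom id d0_s0 assms]
      completion_map_id[OF group_F0 id _ assms] by simp
  show "completion_map F0 d1 (completion_map F1 s0 x) = x"
    using completion_map_comp[OF group_F0 group_F1 group_F0 s0_hom d1_hom id d1_s0 assms]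
      completion_map_id[OF group_F0 id _ assms] by simp
qed

lemma simp_group_01_simp_completion: "simp_group_01 (simp_completion (loop_group BG))"
  by (rule simp_group_01.intro)
    (simp_all only: simp_completion_loop_group F0.compl_group F1.compl_group
      completion_map_hom group_F0 group_F1 d0_hom d1_hom s0_hom completion_map_faces_s0)

sublocale K: simp_group_01 "simp_completion (loop_group BG)" F0.compl F1.compl
  "completion_map F0 d0" "completion_map F0 d1" "completion_map F1 s0"
  by (rule simp_group_01_simp_completion) (simp_all only: simp_completion_loop_group)

abbreviation ZG :: "(nat \<Rightarrow> (bool \<times> 'a list) list set) list set monoid" where
  "ZG \<equiv> right_exact_Z_completion G"

lemma ZG_eq: "ZG = K.pi1"
  unfolding K.pi1_def unfolding right_exact_Z_completion_def bousfield_kan_Z_def BG_def by (rule refl)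

lemma group_ZG: "group ZG"
  using K.group_pi1 by (simp add: ZG_eq)

text \<open>\<open>hd\<close> recovers \<open>g\<close> from the simplex \<open>[g]\<close>. The map
  is the projection of degree 0 onto the group of components of the loop group, which is
  \<open>G\<close>.\<close>

definition phi :: "(bool \<times> 'a list) list \<Rightarrow> 'a" where
  "phi = free_extension G hd"

lemma phi_hom: "phi \<in> hom F0 G"
  and phi_tau: "g \<in> carrier G \<Longrightarrow> phi (tau g) = g"
proof -
  show *: "phi \<in> hom F0 G"
    unfolding phi_def F0_def by (rule free_extension_hom[OF is_group]) (auto simp: gens0_def)
  show "phi (tau g) = g" if "g \<in> carrier G"
    using that free_extension_free_gen[OF is_group, of hd "[g]"] hom_one[OF * group_F0 is_group]
    by (auto simp: phi_def tau_def)
qed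

sublocale phi: group_hom F0 G phi
  by unfold_locales (rule phi_hom)

lemma phi_surj: "phi ` carrier F0 = carrier G"
proof
  show "phi ` carrier F0 \<subseteq> carrier G" using phi.hom_closed by blast
  show "carrier G \<subseteq> phi ` carrier F0"
  proof
    fix g assume "g \<in> carrier G"
    then show "g \<in> phi ` carrier F0" using phi_tau[of g] tau_closed[of g] by (metis image_eqI)
  qed
qed

lemma F1_hom_eq:
  assumes "group H" "f \<in> hom F1 H" "g \<in> hom F1 H"
    "\<And>x y. [x, y] \<in> gens1 \<Longrightarrow> f (free_gen [x, y]) = g (free_gen [x, y])" "w \<in> carrier F1"
  shows "f w = g w"
proof (rule free_group_hom_eq[OF assms(1), of f gens1 g])
  fix z assume z: "z \<in> gens1"
  then obtain x y where "z = [x, y]" by (auto simp: gens1_def)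
  then show "f (free_gen z) = g (free_gen z)" using assms(4) z by simp
qed (use assms in \<open>simp_all add: F1_def\<close>)

lemma phi_d0_d1: "w \<in> carrier F1 \<Longrightarrow> phi (d0 w) = phi (d1 w)"
proof -
  assume w: "w \<in> carrier F1"
  have h: "phi \<circ> d0 \<in> hom F1 G" "phi \<circ> d1 \<in> hom F1 G"
    using phi_hom d0_hom d1_hom by (auto simp: hom_def Pi_def)
  have "(phi \<circ> d0) w = (phi \<circ> d1) w"
  proof (rule F1_hom_eq[OF is_group h _ w])
    fix x y assume xy: "[x, y] \<in> gens1"
    then show "(phi \<circ> d0) (free_gen [x, y]) = (phi \<circ> d1) (free_gen [x, y])"
      using tau_closed by (auto simp: d0_gen d1_gen phi_tau gens1_def m_assoc)
  qed
  then show ?thesis by simp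
qed

text \<open>The generator \<open>[g, h]\<close> is a homotopy from \<open>tau (g h)\<close> times
  the inverse of \<open>tau h\<close> to \<open>tau g\<close>; degree 1 thus encodes the
  multiplication table of \<open>G\<close>.\<close>

lemma L_rel_tau_mult:
  assumes g: "g \<in> carrier G" and h: "h \<in> carrier G"
  shows "L.rel (tau (g \<otimes> h)) (tau g \<otimes>\<^bsub>F0\<^esub> tau h)"
proof (cases "g = \<one>")
  case True
  then show ?thesis
    using h tau_closed[OF h] L.rel_refl by (simp add: tau_def[of \<one>])
next
  case False
  then have gh: "[g, h] \<in> gens1" using g h by (auto simp: gens1_def)
  then have "free_gen [g, h] \<in> carrier F1" using free_gen_closed by (simp add: F1_def)
  then have "L.rel (tau (g \<otimes> h) \<otimes>\<^bsub>F0\<^esub> inv\<^bsub>F0\<^esub> tau h) (tau g)"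
    unfolding L.rel_def using gh d0_gen d1_gen by blast
  then have "L.rel (tau (g \<otimes> h) \<otimes>\<^bsub>F0\<^esub> inv\<^bsub>F0\<^esub> tau h \<otimes>\<^bsub>F0\<^esub> tau h) (tau g \<otimes>\<^bsub>F0\<^esub> tau h)"
    using tau_closed[OF h] by (intro L.rel_mult L.rel_refl)
  then show ?thesis
    using tau_closed g h by (simp add: F0.word_simps)
qed

lemma L_rel_tau_inv:
  assumes g: "g \<in> carrier G"
  shows "L.rel (tau (inv g)) (inv\<^bsub>F0\<^esub> tau g)"
proof -
  have c: "tau g \<in> carrier F0" "tau (inv g) \<in> carrier F0" using g tau_closed by auto
  have "L.rel (tau (inv g \<otimes> g)) (tau (inv g) \<otimes>\<^bsub>F0\<^esub> tau g)"
    using g by (intro L_rel_tau_mult) auto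
  then have "L.rel (tau (inv g) \<otimes>\<^bsub>F0\<^esub> tau g \<otimes>\<^bsub>F0\<^esub> inv\<^bsub>F0\<^esub> tau g) (\<one>\<^bsub>F0\<^esub> \<otimes>\<^bsub>F0\<^esub> inv\<^bsub>F0\<^esub> tau g)"
    using g c by (intro L.rel_mult L.rel_refl L.rel_sym[of _ "tau (inv g) \<otimes>\<^bsub>F0\<^esub> tau g"])
      (auto simp: tau_def[of \<one>])
  then show ?thesis using c by (simp add: F0.word_simps)
qed

text \<open>Every word can be multiplied out up to homotopy. In particular a word with trivial value
  in \<open>G\<close> is homotopic to the identity.\<close>

lemma L_rel_phi:
  assumes w: "w \<in> carrier F0"
  shows "L.rel w (tau (phi w))"
proof -
  have "w \<in> generate F0 (tau ` carrier G)" using w generate_F0 by simp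
  then show ?thesis
  proof (induction rule: generate.induct)
    case one
    then show ?case using L.rel_refl[of "\<one>\<^bsub>F0\<^esub>"] by (simp add: tau_def)
  next
    case (incl h)
    then show ?case using L.rel_refl tau_closed by (auto simp: phi_tau)
  next
    case (inv h)
    then obtain g where g: "g \<in> carrier G" "h = tau g" by auto
    then show ?case
      using L.rel_sym[OF L_rel_tau_inv[OF g(1)]] tau_closed[OF g(1)] by (simp add: phi_tau)
  next
    case (eng u v)
    have c: "u \<in> carrier F0" "v \<in> carrier F0"
      using eng.IH L.rel_carrier by auto
    have "L.rel (u \<otimes>\<^bsub>F0\<^esub> v) (tau (phi u) \<otimes>\<^bsub>F0\<^esub> tau (phi v))"
      using eng.IH by (rule L.rel_mult)
    also have "L.rel (tau (phi u) \<otimes>\<^bsub>F0\<^esub> tau (phi v)) (tau (phi u \<otimes> phi v))"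
      using c by (intro L.rel_sym[OF L_rel_tau_mult]) auto
    finally (L.rel_trans) show ?case using c by simp
  qed
qed

definition const0 :: "(bool \<times> 'a list) list \<Rightarrow> nat \<Rightarrow> (bool \<times> 'a list) list set" where
  "const0 w = F0.compl_lim (\<lambda>_. w)"

lemma const0_hom: "const0 \<in> hom F0 F0.compl"
  using F0.compl_of_hom by (simp add: const0_def[abs_def])

lemma K_rel_const:
  assumes "L.rel w v" shows "K.rel (const0 w) (const0 v)"
proof -
  obtain y where y: "y \<in> carrier F1" "d0 y = w" "d1 y = v"
    using assms by (auto simp: L.rel_def)
  then have "completion_map F0 d0 (F1.compl_lim (\<lambda>_. y)) = const0 w"
    "completion_map F0 d1 (F1.compl_lim (\<lambda>_. y)) = const0 v"
    by (simp_all add: completion_map_const group_F0 group_F1 d0_hom d1_hom const0_def)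
  then show ?thesis unfolding K.rel_def using F1.compl_of_closed[OF y(1)] by blast
qed

text \<open>\<open>tau\<close> itself is not multiplicative, but its defect is a homotopy. The
  composite is the canonical map from \<open>G\<close> to its right exact completion.\<close>

lemma unit_hom: "(\<lambda>g. K.cls (const0 (tau g))) \<in> hom G ZG"
proof (rule homI)
  fix g assume "g \<in> carrier G"
  then have "const0 (tau g) \<in> carrier F0.compl"
    using const0_hom tau_closed by (auto simp: hom_def)
  then show "K.cls (const0 (tau g)) \<in> carrier ZG"
    by (simp add: ZG_eq K.carrier_pi1)
next
  fix g h assume g: "g \<in> carrier G" and h: "h \<in> carrier G"
  have c: "const0 w \<in> carrier F0.compl" if "w \<in> carrier F0" for w
    using that const0_hom by (auto simp: hom_def)
  have "K.cls (const0 (tau (g \<otimes> h))) = K.cls (const0 (tau g \<otimes>\<^bsub>F0\<^esub> tau h))"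
    using K_rel_const[OF L_rel_tau_mult[OF g h]] K.rel_carrier K.cls_eq_iff by blast
  also have "\<dots> = K.cls (const0 (tau g) \<otimes>\<^bsub>F0.compl\<^esub> const0 (tau h))"
    using const0_hom g h tau_closed by (simp add: hom_mult)
  also have "\<dots> = K.cls (const0 (tau g)) \<otimes>\<^bsub>ZG\<^esub> K.cls (const0 (tau h))"
    using c g h tau_closed by (simp add: ZG_eq K.mult_pi1)
  finally show "K.cls (const0 (tau (g \<otimes> h))) = K.cls (const0 (tau g)) \<otimes>\<^bsub>ZG\<^esub> K.cls (const0 (tau h))" .
qed

definition phihat :: "(nat \<Rightarrow> (bool \<times> 'a list) list set) \<Rightarrow> nat \<Rightarrow> 'a set" where
  "phihat = completion_map G phi"

lemma phihat_hom: "phihat \<in> hom F0.compl compl"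
  unfolding phihat_def by (rule completion_map_hom[OF group_F0 is_group phi_hom])

lemma phihat_mem: "x \<in> carrier F0.compl \<Longrightarrow> f \<in> x n \<Longrightarrow> phi f \<in> phihat x n"
  unfolding phihat_def by (rule completion_map_mem[OF group_F0 is_group phi_hom])

lemma phihat_surj: "y \<in> carrier compl \<Longrightarrow> \<exists>x\<in>carrier F0.compl. phihat x = y"
  unfolding phihat_def by (rule completion_map_surj[OF group_F0 is_group phi_hom phi_surj])

text \<open>Every element of \<open>F0\<close> is homotopic to a word in the generators of \<open>G\<close>. Performing this
  homotopy multiplicatively replaces \<open>F0\<close> by a finitely generated group.\<close>

lemma retract:
  assumes T: "T \<subseteq> carrier G" "generate G T = carrier G"
  shows "\<exists>eta\<in>hom F0 F1. \<forall>w\<in>carrier F0. d1 (eta w) = w \<and> d0 (eta w) \<in> generate F0 (tau ` T)"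
proof -
  let ?L = "generate F0 (tau ` T)"
  have tT: "tau ` T \<subseteq> carrier F0" using T(1) tau_closed by blast
  have words: "\<exists>w\<in>?L. L.rel w (tau g)" if "g \<in> generate G T" for g
    using that
  proof (induction rule: generate.induct)
    case one
    then show ?case
      using generate.one[of F0] L.rel_refl[of "\<one>\<^bsub>F0\<^esub>"] by (auto simp: tau_def)
  next
    case (incl h)
    then show ?case
      using generate.incl[of "tau h" "tau ` T"] L.rel_refl tau_closed T(1) by blast
  next
    case (inv h)
    then have "h \<in> carrier G" using T(1) by blast
    then show ?case
      using generate.inv[of "tau h" "tau ` T"] L.rel_sym[OF L_rel_tau_inv[of h]] inv by blast
  next
    case (eng h1 h2)
    then obtain w1 w2 where w: "w1 \<in> ?L" "w2 \<in> ?L" "L.rel w1 (tau h1)" "L.rel w2 (tau h2)" by blast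
    have h: "h1 \<in> carrier G" "h2 \<in> carrier G" using eng T generate_in_carrier by blast+
    have "L.rel (w1 \<otimes>\<^bsub>F0\<^esub> w2) (tau (h1 \<otimes> h2))"
      using L.rel_trans[OF L.rel_mult[OF w(3,4)] L.rel_sym[OF L_rel_tau_mult[OF h]]] .
    then show ?case using generate.eng[OF w(1,2)] by blast
  qed
  have "\<exists>y\<in>carrier F1. d1 y = free_gen x \<and> d0 y \<in> ?L" if x: "x \<in> gens0" for x
  proof -
    obtain g where g: "x = [g]" "g \<in> carrier G" "g \<noteq> \<one>" using x by (auto simp: gens0_def)
    then show ?thesis using words[of g] T(2) by (auto simp: L.rel_def tau_def)
  qed
  then obtain y where y: "\<And>x. x \<in> gens0 \<Longrightarrow> y x \<in> carrier F1 \<and> d1 (y x) = free_gen x \<and> d0 (y x) \<in> ?L"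
    by metis
  \<comment> \<open>Freeness turns the separately chosen homotopies into a homomorphism, so that
    \<open>eta\<close> can be completed.\<close>
  define eta where "eta = free_extension F1 y"
  have eta: "eta \<in> hom F0 F1"
    unfolding eta_def F0_def by (rule free_extension_hom[OF group_F1]) (use y in blast)
  have gen: "eta (free_gen x) = y x" if "x \<in> gens0" for x
    using y[OF that] by (simp add: eta_def free_extension_free_gen group_F1)
  have h: "d1 \<circ> eta \<in> hom F0 F0" "d0 \<circ> eta \<in> hom F0 F0" "id \<in> hom F0 F0"
    using eta d0_hom d1_hom by (auto simp: hom_def Pi_def)
  have gF0: "generate F0 (free_gen ` gens0) = carrier F0"
    by (simp add: F0_def free_group_generated)
  have gc: "free_gen ` gens0 \<subseteq> carrier F0"
    using free_gen_closed by (auto simp: F0_def)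
  have "d1 (eta w) = w" if "w \<in> carrier F0" for w
  proof -
    have "(d1 \<circ> eta) v = id v" if "v \<in> free_gen ` gens0" for v
      using that gen y by auto
    then have "(d1 \<circ> eta) w = id w"
      using hom_eq_on_generate[OF group_F0 group_F0 h(1,3) gc, of w] \<open>w \<in> carrier F0\<close> gF0 by blast
    then show ?thesis by simp
  qed
  moreover have "d0 (eta w) \<in> ?L" if w: "w \<in> carrier F0" for w
  proof -
    interpret r: group_hom F0 F0 "d0 \<circ> eta" by unfold_locales (rule h(2))
    have "(d0 \<circ> eta) w \<in> generate F0 ((d0 \<circ> eta) ` (free_gen ` gens0))"
      using r.generate_img[OF gc] w gF0 by auto
    also have "\<dots> \<subseteq> ?L"
      using gen y by (intro F0.generate_subgroup_incl F0.generate_is_subgroup[OF tT]) auto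
    finally show ?thesis by simp
  qed
  ultimately show ?thesis using eta by blast
qed

text \<open>For fixed \<open>n\<close>, multiplying \<open>x\<close> by a null-homotopic constant
  makes its level \<open>n\<close> trivial without changing its class. The retraction then moves it
  into the completion of a finitely generated group, where triviality at level \<open>n\<close>
  implies membership in the abstract lower central term. Homomorphisms carry this membership back to
  \<open>ZG\<close>.\<close>

theorem kernel_in_lower_central:
  assumes T: "finite T" "T \<subseteq> carrier G" "generate G T = carrier G"
    and x: "x \<in> carrier F0.compl" "phihat x = \<one>\<^bsub>compl\<^esub>"
  shows "K.cls x \<in> lower_central ZG n"
proof -
  obtain eta where eta: "eta \<in> hom F0 F1"
    and d1_eta: "\<And>w. w \<in> carrier F0 \<Longrightarrow> d1 (eta w) = w"
    and d0_eta: "\<And>w. w \<in> carrier F0 \<Longrightarrow> d0 (eta w) \<in> generate F0 (tau ` T)"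
    using retract[OF T(2,3)] by blast
  define LL where "LL = F0\<lparr>carrier := generate F0 (tau ` T)\<rparr>"
  have tT: "tau ` T \<subseteq> carrier F0" using T(2) tau_closed by blast
  have sub: "subgroup (generate F0 (tau ` T)) F0" by (rule F0.generate_is_subgroup[OF tT])
  interpret LL: plain_group LL
    unfolding LL_def by (rule plain_group.intro[OF F0.subgroup_imp_group[OF sub]])
  have gLL: "generate LL (tau ` T) = carrier LL" "tau ` T \<subseteq> carrier LL"
    using F0.generate_consistent[OF _ sub, of "tau ` T"] generate.incl[of _ "tau ` T" F0]
    by (auto simp: LL_def)
  define rho where "rho w = d0 (eta w)" for w
  have rho: "rho \<in> hom F0 LL" "rho \<in> hom F0 F0"
    using eta d0_hom d0_eta by (auto simp: hom_def Pi_def LL_def rho_def)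
  have incl: "(\<lambda>w. w) \<in> hom LL F0"
    using subgroup.subset[OF sub] by (auto simp: hom_def LL_def)
  obtain f where f: "f \<in> x n" using F0.compl_nonempty[OF x(1)] by blast
  have fc: "f \<in> carrier F0" using F0.compl_mem_carrier[OF x(1) f] .
  have "phi f \<in> lower_central G n"
    using phihat_mem[OF x(1) f] x(2) compl_one_mem_iff by simp
  then obtain c where c: "c \<in> lower_central F0 n" "phi c = phi f"
    using hom_lower_central_surj[OF group_F0 is_group phi_hom phi_surj] by blast
  have cc: "c \<in> carrier F0" using F0.lower_central_carrier[OF c(1)] .
  \<comment> \<open>\<open>c\<close> lies in the term \<open>n\<close> and has the same image in
    \<open>G\<close> as \<open>f\<close>. Hence \<open>r\<close> is null-homotopic, and multiplying
    by it replaces the representative \<open>f\<close> by \<open>c\<close>.\<close>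
  define r where "r = c \<otimes>\<^bsub>F0\<^esub> inv\<^bsub>F0\<^esub> f"
  have r: "r \<in> carrier F0" "phi r = \<one>" using cc fc c(2) by (simp_all add: r_def)
  have "L.rel r \<one>\<^bsub>F0\<^esub>" using L_rel_phi[OF r(1)] r(2) by (simp add: tau_def)
  then have "K.rel (const0 r) (const0 \<one>\<^bsub>F0\<^esub>)" by (rule K_rel_const)
  then have rel_r: "K.rel (const0 r) \<one>\<^bsub>F0.compl\<^esub>" by (simp add: const0_def F0.compl_of_one)
  have cr: "const0 r \<in> carrier F0.compl" using K.rel_carrier[OF rel_r] by simp
  define u where "u = const0 r \<otimes>\<^bsub>F0.compl\<^esub> x"
  have u: "u \<in> carrier F0.compl" unfolding u_def by (rule F0.compl_mult_closed[OF cr x(1)])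
  have "r \<otimes>\<^bsub>F0\<^esub> f \<in> u n"
    unfolding u_def const0_def by (intro F0.compl_mult_mem F0.compl_of_mem r f)
  then have "c \<in> u n" using cc fc by (simp add: r_def F0.word_simps)
  then have u1: "\<one>\<^bsub>F0\<^esub> \<in> u n"
    using F0.compl_mem_iff[OF u] F0.lcong_one_iff F0.lcong_sym c(1) by blast
  have "K.rel u (\<one>\<^bsub>F0.compl\<^esub> \<otimes>\<^bsub>F0.compl\<^esub> x)"
    unfolding u_def by (intro K.rel_mult rel_r K.rel_refl x(1))
  then have cls_u: "K.cls x = K.cls u"
    using x(1) u K.rel_sym by (simp add: K.cls_eq_iff)
  define v where "v = completion_map LL rho u"
  have v: "v \<in> carrier LL.compl"
    unfolding v_def by (rule completion_map_closed[OF group_F0 LL.is_group rho(1) u])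
  have "rho \<one>\<^bsub>F0\<^esub> \<in> v n"
    unfolding v_def by (rule completion_map_mem[OF group_F0 LL.is_group rho(1) u u1])
  then have "\<one>\<^bsub>LL\<^esub> \<in> v n"
    using hom_one[OF rho(1) group_F0 LL.is_group] by simp
  then have v_lc: "v \<in> lower_central LL.compl n"
    using LL.compl_lower_central[OF _ gLL(2,1) v] T(1) by simp
  \<comment> \<open>The completed \<open>eta u\<close> is an element of completed degree 1 that
    joins \<open>v\<close>, viewed in \<open>F0.compl\<close>, to \<open>u\<close>.\<close>
  have D1: "completion_map F0 d1 (completion_map F1 eta u) = u"
    using completion_map_comp[OF group_F0 group_F1 group_F0 eta d1_hom _ d1_eta u]
      completion_map_id[OF group_F0 _ _ u, of "\<lambda>w. w"] by (simp add: hom_def)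
  have D0: "completion_map F0 d0 (completion_map F1 eta u) = completion_map F0 (\<lambda>w. w) v"
    using completion_map_comp[OF group_F0 group_F1 group_F0 eta d0_hom rho(2) _ u]
      completion_map_comp[OF group_F0 LL.is_group group_F0 rho(1) incl rho(2) _ u]
    by (simp add: rho_def v_def)
  have "K.rel (completion_map F0 (\<lambda>w. w) v) u"
    unfolding K.rel_def
    using D0 D1 completion_map_closed[OF group_F0 group_F1 eta u] by blast
  then have cls_v: "K.cls u = K.cls (completion_map F0 (\<lambda>w. w) v)"
    using K.rel_carrier K.cls_eq_iff by blast
  have "completion_map F0 (\<lambda>w. w) v \<in> lower_central F0.compl n"
    by (rule hom_lower_central[OF LL.compl_group F0.compl_group
          completion_map_hom[OF LL.is_group group_F0 incl] v_lc])
  then have "K.cls (completion_map F0 (\<lambda>w. w) v) \<in> lower_central K.pi1 n"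
    by (rule hom_lower_central[OF F0.compl_group K.group_pi1 K.cls_hom])
  then show ?thesis using cls_u cls_v by (simp add: ZG_eq)
qed

end

section \<open>The semidirect product and its central extension\<close>

definition sg :: "int \<Rightarrow> 'r::comm_ring_1" where
  "sg n = (if even n then 1 else - 1)"

lemma sg_simps [simp]:
  "sg 0 = 1" "sg (- n) = sg n" "sg n * sg n = 1" "sg n * (sg n * x) = x" "sg 1 = - 1"
  by (simp_all add: sg_def)

lemma sg_add: "sg (m + n) = sg m * sg n"
  by (simp add: sg_def)

lemma of_int_sg: "of_int (sg n) = sg n"
  by (simp add: sg_def)

text \<open>\<open>(n, (x, y))\<close> acts through \<open>a\<^sup>n (x, y) = (-1)\<^sup>n (x - n m y, y)\<close>. The central extension
  \<open>hdp\<close> has the cocycle \<open>det (v, a\<^sup>n v')\<close>, so that lifts of \<open>v\<close> and \<open>w\<close> have commutator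
  \<open>2 det (v, w)\<close>.\<close>

definition sdp :: "'r::comm_ring_1 \<Rightarrow> (int \<times> 'r \<times> 'r) monoid" where
  "sdp m = \<lparr>carrier = UNIV,
    mult = (\<lambda>(n, x, y) (n', x', y'). (n + n', x + sg n * (x' - of_int n * m * y'), y + sg n * y')),
    one = (0, 0, 0)\<rparr>"

definition hdp :: "'r::comm_ring_1 \<Rightarrow> (int \<times> 'r \<times> 'r \<times> 'r) monoid" where
  "hdp m = \<lparr>carrier = UNIV,
    mult = (\<lambda>(n, x, y, z) (n', x', y', z').
      (n + n', x + sg n * (x' - of_int n * m * y'), y + sg n * y',
       z + z' + (x * (sg n * y') - y * (sg n * (x' - of_int n * m * y'))))),
    one = (0, 0, 0, 0)\<rparr>"

lemma carrier_sdp [simp]: "carrier (sdp m) = UNIV"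
  and one_sdp [simp]: "\<one>\<^bsub>sdp m\<^esub> = (0, 0, 0)"
  and mult_sdp: "(n, x, y) \<otimes>\<^bsub>sdp m\<^esub> (n', x', y') =
    (n + n', x + sg n * (x' - of_int n * m * y'), y + sg n * y')"
  by (simp_all add: sdp_def)

lemma carrier_hdp [simp]: "carrier (hdp m) = UNIV"
  and one_hdp [simp]: "\<one>\<^bsub>hdp m\<^esub> = (0, 0, 0, 0)"
  and mult_hdp: "(n, x, y, z) \<otimes>\<^bsub>hdp m\<^esub> (n', x', y', z') =
    (n + n', x + sg n * (x' - of_int n * m * y'), y + sg n * y',
     z + z' + (x * (sg n * y') - y * (sg n * (x' - of_int n * m * y'))))"
  by (simp_all add: hdp_def)

lemma group_sdp: "group (sdp m)" for m :: "'a::comm_ring_1"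
proof (rule groupI)
  fix p q r :: "int \<times> 'a \<times> 'a"
  obtain n x y n' x' y' n'' x'' y'' where
    "p = (n, x, y)" "q = (n', x', y')" "r = (n'', x'', y'')" by (metis prod_cases3)
  then show "p \<otimes>\<^bsub>sdp m\<^esub> q \<otimes>\<^bsub>sdp m\<^esub> r = p \<otimes>\<^bsub>sdp m\<^esub> (q \<otimes>\<^bsub>sdp m\<^esub> r)"
    by (simp add: mult_sdp sg_add algebra_simps)
next
  fix p :: "int \<times> 'a \<times> 'a"
  obtain n x y where p: "p = (n, x, y)" by (metis prod_cases3)
  then show "\<one>\<^bsub>sdp m\<^esub> \<otimes>\<^bsub>sdp m\<^esub> p = p" by (simp add: mult_sdp)
  have "(- n, - sg n * (x + of_int n * m * y), - sg n * y) \<otimes>\<^bsub>sdp m\<^esub> p = \<one>\<^bsub>sdp m\<^esub>"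
    by (simp add: p mult_sdp algebra_simps)
  then show "\<exists>q\<in>carrier (sdp m). q \<otimes>\<^bsub>sdp m\<^esub> p = \<one>\<^bsub>sdp m\<^esub>" by auto
qed auto

lemma group_hdp: "group (hdp m)" for m :: "'a::comm_ring_1"
proof (rule groupI)
  fix p q r :: "int \<times> 'a \<times> 'a \<times> 'a"
  obtain n x y z n' x' y' z' n'' x'' y'' z'' where
    "p = (n, x, y, z)" "q = (n', x', y', z')" "r = (n'', x'', y'', z'')" by (metis prod_cases4)
  then show "p \<otimes>\<^bsub>hdp m\<^esub> q \<otimes>\<^bsub>hdp m\<^esub> r = p \<otimes>\<^bsub>hdp m\<^esub> (q \<otimes>\<^bsub>hdp m\<^esub> r)"
    by (simp add: mult_hdp sg_add algebra_simps)
next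
  fix p :: "int \<times> 'a \<times> 'a \<times> 'a"
  obtain n x y z where p: "p = (n, x, y, z)" by (metis prod_cases4)
  then show "\<one>\<^bsub>hdp m\<^esub> \<otimes>\<^bsub>hdp m\<^esub> p = p" by (simp add: mult_hdp)
  have "(- n, - sg n * (x + of_int n * m * y), - sg n * y, - z) \<otimes>\<^bsub>hdp m\<^esub> p = \<one>\<^bsub>hdp m\<^esub>"
    by (simp add: p mult_hdp algebra_simps)
  then show "\<exists>q\<in>carrier (hdp m). q \<otimes>\<^bsub>hdp m\<^esub> p = \<one>\<^bsub>hdp m\<^esub>" by auto
qed auto

lemma hdp_proj_hom: "(\<lambda>(n, x, y, z). (n, x, y)) \<in> hom (hdp m) (sdp m)"
  by (rule homI) (auto simp: mult_sdp mult_hdp)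

text \<open>Determines a commutator from the relation \<open>pq = c qp\<close>, which avoids
  formulas for inverses.\<close>

lemma gcomm_eqI:
  assumes "group G" "p \<in> carrier G" "q \<in> carrier G" "c \<in> carrier G"
    and eq: "c \<otimes>\<^bsub>G\<^esub> (q \<otimes>\<^bsub>G\<^esub> p) = p \<otimes>\<^bsub>G\<^esub> q"
  shows "gcomm G p q = c"
proof -
  interpret G: plain_group G by (rule plain_group.intro) fact
  have "gcomm G p q = (p \<otimes>\<^bsub>G\<^esub> q) \<otimes>\<^bsub>G\<^esub> inv\<^bsub>G\<^esub> (q \<otimes>\<^bsub>G\<^esub> p)"
    using assms by (simp add: gcomm_def G.word_simps)
  also have "\<dots> = c"
    using assms(2-4) unfolding eq[symmetric] by (simp add: G.m_assoc)
  finally show ?thesis .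
qed

lemma gcomm_hdp:
  assumes "u = x + sg n * (x' - of_int n * m * y') - (x' + sg n' * (x - of_int n' * m * y))"
    and "w = y + sg n * y' - (y' + sg n' * y)"
    and "s = x * (sg n * y') - y * (sg n * (x' - of_int n * m * y'))
      - (x' * (sg n' * y) - y' * (sg n' * (x - of_int n' * m * y)))
      - (u * (y' + sg n' * y) - w * (x' + sg n' * (x - of_int n' * m * y)))"
  shows "gcomm (hdp m) (n, x, y, z) (n', x', y', z') = (0, u, w, s)"
  by (rule gcomm_eqI[OF group_hdp]) (simp_all add: mult_hdp assms)

lemma sg_diff_even: "2 dvd (1 - sg n :: 'r::comm_ring_1)"
  by (simp add: sg_def)

text \<open>A commutator kills the integer coordinate, and each further one gains a power of 2
  because the eigenvalue of the matrix is -1.\<close>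

lemma lower_central_hdp:
  fixes m :: "'a::comm_ring_1"
  assumes "p \<in> lower_central (hdp m) (Suc j)"
  shows "\<exists>x y z. p = (0, x, y, z) \<and> 2 ^ j dvd x \<and> 2 ^ Suc j dvd y \<and> 2 ^ j dvd z"
proof -
  interpret P: plain_group "hdp m" by (rule plain_group.intro[OF group_hdp])
  \<comment> \<open>The coordinate \<open>y\<close> is kept one power of 2 ahead of
    \<open>x\<close>, since the unipotent part adds a multiple of \<open>m y\<close> to
    \<open>x\<close> without a factor 2.\<close>
  define V where "V = (\<lambda>j. {(0::int, x :: 'a, y :: 'a, z :: 'a) |x y z. 2 ^ j dvd x \<and> 2 ^ Suc j dvd y \<and> 2 ^ j dvd z})"
  have sub: "subgroup (V j) (hdp m)" for j
  proof (rule P.subgroupI)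
    show "V j \<noteq> {}" unfolding V_def by (auto intro!: exI[of _ 0])
    fix p assume "p \<in> V j"
    then obtain x y z where p: "p = (0, x, y, z)" "2 ^ j dvd x" "2 ^ Suc j dvd y" "2 ^ j dvd z"
      unfolding V_def by blast
    have "inv\<^bsub>hdp m\<^esub> p = (0, - x, - y, - z)"
      by (rule P.inv_equality) (simp_all add: p mult_hdp)
    then show "inv\<^bsub>hdp m\<^esub> p \<in> V j" using p unfolding V_def by auto
  next
    fix p q assume "p \<in> V j" "q \<in> V j"
    then obtain x y z x' y' z' where p: "p = (0, x, y, z)" "2 ^ j dvd x" "2 ^ Suc j dvd y" "2 ^ j dvd z"
      and q: "q = (0, x', y', z')" "2 ^ j dvd x'" "2 ^ Suc j dvd y'" "2 ^ j dvd z'"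
      unfolding V_def by blast
    have "2 ^ j dvd x * y' - y * x'" using p(2) q(2) by (intro dvd_diff dvd_mult dvd_mult2)
    then show "p \<otimes>\<^bsub>hdp m\<^esub> q \<in> V j"
      using p q unfolding V_def by (auto simp: mult_hdp intro!: dvd_add simp del: power_Suc)
  qed simp
  have "lower_central (hdp m) (Suc j) \<subseteq> V j"
  proof (induction j)
    case 0
    show ?case
      unfolding P.lower_central_Suc[of 0]
    proof (rule P.generate_subgroup_incl[OF _ sub], rule subsetI)
      fix c assume "c \<in> {gcomm (hdp m) p q |p q. p \<in> lower_central (hdp m) 0 \<and> q \<in> carrier (hdp m)}"
      then obtain p q where "c = gcomm (hdp m) p q" by blast
      then obtain n x y z n' x' y' z' where c: "c = gcomm (hdp m) (n, x, y, z) (n', x', y', z')"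
        by (metis prod_cases4)
      obtain u w s where uws: "gcomm (hdp m) (n, x, y, z) (n', x', y', z') = (0, u, w, s)"
        and w: "w = y + sg n * y' - (y' + sg n' * y)"
        using gcomm_hdp[OF refl refl refl] by metis
      have "w = (1 - sg n') * y - (1 - sg n) * y'" unfolding w by (simp add: algebra_simps)
      then have "2 dvd w" by (auto intro!: dvd_diff dvd_mult2 sg_diff_even)
      then show "c \<in> V 0"
        unfolding c uws V_def by auto
    qed
  next
    case (Suc j)
    show ?case
      unfolding P.lower_central_Suc[of "Suc j"]
    proof (rule P.generate_subgroup_incl[OF _ sub], rule subsetI)
      fix c assume "c \<in> {gcomm (hdp m) p q |p q. p \<in> lower_central (hdp m) (Suc j) \<and> q \<in> carrier (hdp m)}"
      then obtain p q where "c = gcomm (hdp m) p q" and lc: "p \<in> lower_central (hdp m) (Suc j)" by blast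
      then obtain n' x' y' z' where c: "c = gcomm (hdp m) p (n', x', y', z')"
        by (metis prod_cases4)
      have "p \<in> V j" using Suc lc by (rule subsetD)
      then obtain x y z where p: "p = (0, x, y, z)" and dvd: "2 ^ j dvd x" "2 ^ Suc j dvd y" "2 ^ j dvd z"
        unfolding V_def by blast
      obtain u w s where uws: "gcomm (hdp m) p (n', x', y', z') = (0, u, w, s)"
        and u: "u = x + sg 0 * (x' - of_int 0 * m * y') - (x' + sg n' * (x - of_int n' * m * y))"
        and w: "w = y + sg 0 * y' - (y' + sg n' * y)"
        and s: "s = x * (sg 0 * y') - y * (sg 0 * (x' - of_int 0 * m * y'))
            - (x' * (sg n' * y) - y' * (sg n' * (x - of_int n' * m * y)))
            - (u * (y' + sg n' * y) - w * (x' + sg n' * (x - of_int n' * m * y)))"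
        unfolding p using gcomm_hdp[OF refl refl refl] by metis
      have two: "2 ^ Suc j dvd 2 * x" using dvd(1) by (simp add: mult_dvd_mono)
      have "u = (if even n' then 0 else 2 * x) + sg n' * of_int n' * m * y"
        unfolding u sg_def by (simp add: algebra_simps)
      then have du: "2 ^ Suc j dvd u" using two dvd(2) by (auto intro!: dvd_add dvd_mult simp del: power_Suc)
      have "w = (1 - sg n') * y" unfolding w by (simp add: algebra_simps)
      then have dw: "2 ^ Suc (Suc j) dvd w"
        using mult_dvd_mono[OF sg_diff_even[of n'] dvd(2)] by simp
      \<comment> \<open>Rearranged so that every summand contains \<open>2 * x\<close> or
        \<open>y\<close>, both of which have the required divisibility.\<close>
      have "s = sg n' * y' * (2 * x) + - sg n' * (2 * of_int n' * m * y' + 2 * x' + of_int n' * m * y) * y"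
        unfolding s u w by (simp add: algebra_simps)
      then have ds: "2 ^ Suc j dvd s" using two dvd(2) by (auto intro!: dvd_add dvd_mult simp del: power_Suc)
      show "c \<in> V (Suc j)"
        unfolding c uws V_def using du dw ds by blast
    qed
  qed
  then have "p \<in> V j" using assms by (rule subsetD)
  then show ?thesis unfolding V_def by blast
qed

lemma lower_central_sdp:
  assumes "p \<in> lower_central (sdp m) (Suc j)"
  shows "\<exists>x y. p = (0, x, y) \<and> 2 ^ j dvd x \<and> 2 ^ Suc j dvd y"
proof -
  have "(\<lambda>(n, x, y, z). (n, x, y)) ` carrier (hdp m) = carrier (sdp m)"
    by (force simp: image_def)
  then obtain q where "q \<in> lower_central (hdp m) (Suc j)" "(\<lambda>(n, x, y, z). (n, x, y)) q = p"
    using hom_lower_central_surj[OF group_hdp group_sdp hdp_proj_hom] assms by blast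
  then show ?thesis using lower_central_hdp by fastforce
qed

section \<open>Extending homomorphisms to completions\<close>

text \<open>A complete and separated filtration that contains the lower central series up to a shift
  by one. These properties extend a homomorphism into \<open>P\<close> to the pronilpotent
  completion of its source.\<close>

locale complete_group = plain_group P for P :: "'p monoid" +
  fixes cong :: "nat \<Rightarrow> 'p \<Rightarrow> 'p \<Rightarrow> bool"
  assumes carrier_UNIV [simp]: "carrier P = UNIV"
    and cong_sym: "cong j p q \<Longrightarrow> cong j q p"
    and cong_trans: "cong j p q \<Longrightarrow> cong j q r \<Longrightarrow> cong j p r"
    and cong_mult: "cong j p q \<Longrightarrow> cong j p' q' \<Longrightarrow> cong j (p \<otimes>\<^bsub>P\<^esub> p') (q \<otimes>\<^bsub>P\<^esub> q')"
    and cong_refl: "cong j p p"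
    and cong_separated: "(\<And>j. cong j p q) \<Longrightarrow> p = q"
    and cong_complete: "(\<And>j. cong j (s (Suc j)) (s j)) \<Longrightarrow> \<exists>p. \<forall>j. cong j p (s j)"
    and cong_lower_central: "c \<in> lower_central P (Suc j) \<Longrightarrow> cong j c \<one>\<^bsub>P\<^esub>"
begin

context
  fixes F :: "'f monoid" and h :: "'f \<Rightarrow> 'p"
  assumes F: "group F" and h: "h \<in> hom F P"
begin

interpretation F: plain_group F by (rule plain_group.intro[OF F])

lemma cong_of_lcong:
  assumes "F.lcong (Suc j) f g" shows "cong j (h f) (h g)"
proof -
  have "h f \<otimes>\<^bsub>P\<^esub> inv\<^bsub>P\<^esub> h g \<in> lower_central P (Suc j)"
    using hom_lcong[OF F is_group h assms] by (simp add: lcong_def)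
  then have "cong j (h f \<otimes>\<^bsub>P\<^esub> inv\<^bsub>P\<^esub> h g \<otimes>\<^bsub>P\<^esub> h g) (\<one>\<^bsub>P\<^esub> \<otimes>\<^bsub>P\<^esub> h g)"
    by (intro cong_mult cong_lower_central cong_refl)
  then show ?thesis by (simp add: m_assoc)
qed

lemma ext_ex1:
  assumes x: "x \<in> carrier F.compl"
  shows "\<exists>!p. \<forall>j. \<forall>f\<in>x (Suc j). cong j (h f) p"
proof -
  obtain s where s: "\<And>n. s n \<in> x n" using F.compl_nonempty[OF x] by metis
  have "cong j (h (s (Suc (Suc j)))) (h (s (Suc j)))" for j
    using s F.compl_mem_iff[OF x s] F.compl_mem_antimono[OF x s, of "Suc j" "Suc (Suc j)"]
    by (intro cong_of_lcong) simp
  then obtain p where p: "\<And>j. cong j p (h (s (Suc j)))"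
    using cong_complete[of "\<lambda>j. h (s (Suc j))"] by blast
  have ex: "cong j (h f) p" if "f \<in> x (Suc j)" for f j
    using cong_of_lcong[of j f "s (Suc j)"] F.compl_mem_iff[OF x s] that cong_trans cong_sym p by blast
  show ?thesis
  proof (rule ex1I[of _ p])
    fix q assume "\<forall>j. \<forall>f\<in>x (Suc j). cong j (h f) q"
    then show "q = p" using s ex cong_trans cong_sym by (intro cong_separated) blast
  qed (use ex in blast)
qed

text \<open>Index \<open>j\<close> is read off at level \<open>Suc j\<close> because
  \<open>cong_lower_central\<close> loses one index.\<close>

definition ext :: "(nat \<Rightarrow> 'f set) \<Rightarrow> 'p" where
  "ext x = (THE p. \<forall>j. \<forall>f\<in>x (Suc j). cong j (h f) p)"

lemma ext_cong: "x \<in> carrier F.compl \<Longrightarrow> f \<in> x (Suc j) \<Longrightarrow> cong j (h f) (ext x)"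
  using theI'[OF ext_ex1] unfolding ext_def by blast

lemma ext_eqI:
  assumes x: "x \<in> carrier F.compl" and p: "\<And>j. \<exists>f\<in>x (Suc j). cong j (h f) p"
  shows "ext x = p"
proof (rule cong_separated)
  fix j
  obtain f where f: "f \<in> x (Suc j)" "cong j (h f) p" using p by blast
  then show "cong j (ext x) p" using ext_cong[OF x f(1)] cong_trans cong_sym by blast
qed

lemma ext_hom: "ext \<in> hom F.compl P"
proof (rule homI)
  fix x y assume x: "x \<in> carrier F.compl" and y: "y \<in> carrier F.compl"
  show "ext (x \<otimes>\<^bsub>F.compl\<^esub> y) = ext x \<otimes>\<^bsub>P\<^esub> ext y"
  proof (rule ext_eqI[OF F.compl_mult_closed[OF x y]])
    fix j
    obtain f g where fg: "f \<in> x (Suc j)" "g \<in> y (Suc j)"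
      using F.compl_nonempty[OF x] F.compl_nonempty[OF y] by blast
    have "h (f \<otimes>\<^bsub>F\<^esub> g) = h f \<otimes>\<^bsub>P\<^esub> h g"
      using hom_mult[OF h] F.compl_mem_carrier[OF x fg(1)] F.compl_mem_carrier[OF y fg(2)] by blast
    then have "cong j (h (f \<otimes>\<^bsub>F\<^esub> g)) (ext x \<otimes>\<^bsub>P\<^esub> ext y)"
      using cong_mult ext_cong[OF x fg(1)] ext_cong[OF y fg(2)] by simp
    then show "\<exists>f\<in>(x \<otimes>\<^bsub>F.compl\<^esub> y) (Suc j). cong j (h f) (ext x \<otimes>\<^bsub>P\<^esub> ext y)"
      using fg by (intro bexI[of _ "f \<otimes>\<^bsub>F\<^esub> g"] F.compl_mult_mem)
  qed
qed simp

end

end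

section \<open>Congruence modulo powers of 2\<close>

definition eqm :: "nat \<Rightarrow> 'r::comm_ring_1 \<Rightarrow> 'r \<Rightarrow> bool" where
  "eqm j a b \<longleftrightarrow> 2 ^ j dvd a - b"

lemma eqm_refl [simp, intro]: "eqm j a a"
  by (simp add: eqm_def)

lemma eqm_sym: "eqm j a b \<Longrightarrow> eqm j b a"
  unfolding eqm_def by (metis dvd_minus_iff minus_diff_eq)

lemma eqm_trans: "eqm j a b \<Longrightarrow> eqm j b c \<Longrightarrow> eqm j a c"
  unfolding eqm_def by (metis diff_add_cancel add_diff_eq dvd_add)

lemma eqm_add: "eqm j a b \<Longrightarrow> eqm j c d \<Longrightarrow> eqm j (a + c) (b + d)"
  unfolding eqm_def by (metis add_diff_add dvd_add)

lemma eqm_diff: "eqm j a b \<Longrightarrow> eqm j c d \<Longrightarrow> eqm j (a - c) (b - d)"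
  unfolding eqm_def by (metis diff_diff_eq2 diff_add_eq dvd_diff add_diff_eq diff_diff_eq add.commute)

lemma eqm_mult: "eqm j a b \<Longrightarrow> eqm j c d \<Longrightarrow> eqm j (a * c) (b * d)"
proof -
  assume "eqm j a b" "eqm j c d"
  then have "2 ^ j dvd a * (c - d) + (a - b) * d" unfolding eqm_def by (intro dvd_add dvd_mult dvd_mult2)
  moreover have "a * (c - d) + (a - b) * d = a * c - b * d" by (simp add: algebra_simps)
  ultimately show ?thesis unfolding eqm_def by simp
qed

lemma eqm_separated: "(\<And>j. eqm j x y) \<Longrightarrow> x = y" for x y :: z2
  using z2_separated[of "x - y"] by (simp add: eqm_def)

lemma eqm_complete: "(\<And>j. eqm j (s (Suc j)) (s j)) \<Longrightarrow> \<exists>x. \<forall>j. eqm j x (s j)" for s :: "nat \<Rightarrow> z2"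
  unfolding eqm_def by (rule z2_limit)

text \<open>The integer coordinate is compared exactly: it vanishes on all terms of the lower
  central series after the first, so this factor stays discrete in the completion.\<close>

definition cong_sdp :: "nat \<Rightarrow> int \<times> z2 \<times> z2 \<Rightarrow> int \<times> z2 \<times> z2 \<Rightarrow> bool" where
  "cong_sdp j p q \<longleftrightarrow> fst p = fst q \<and> eqm j (fst (snd p)) (fst (snd q)) \<and> eqm j (snd (snd p)) (snd (snd q))"

definition cong_hdp :: "nat \<Rightarrow> int \<times> z2 \<times> z2 \<times> z2 \<Rightarrow> int \<times> z2 \<times> z2 \<times> z2 \<Rightarrow> bool" where
  "cong_hdp j p q \<longleftrightarrow> fst p = fst q \<and> eqm j (fst (snd p)) (fst (snd q))
    \<and> eqm j (fst (snd (snd p))) (fst (snd (snd q))) \<and> eqm j (snd (snd (snd p))) (snd (snd (snd q)))"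

lemma const_seq: "(\<And>j. s (Suc j) = s j) \<Longrightarrow> s j = s 0" for s :: "nat \<Rightarrow> 'b"
  by (induction j) simp_all

lemma complete_group_sdp: "complete_group (sdp m) cong_sdp"
proof (intro complete_group.intro plain_group.intro group_sdp complete_group_axioms.intro)
  fix s assume s: "\<And>j. cong_sdp j (s (Suc j)) (s j)"
  have n: "fst (s j) = fst (s 0)" for j
    by (rule const_seq[of "\<lambda>j. fst (s j)"]) (use s in \<open>simp add: cong_sdp_def\<close>)
  obtain x where x: "\<And>j. eqm j x (fst (snd (s j)))"
    using eqm_complete[of "\<lambda>j. fst (snd (s j))"] s by (auto simp: cong_sdp_def)
  obtain y where y: "\<And>j. eqm j y (snd (snd (s j)))"
    using eqm_complete[of "\<lambda>j. snd (snd (s j))"] s by (auto simp: cong_sdp_def)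
  have "cong_sdp j (fst (s 0), x, y) (s j)" for j
    by (simp add: cong_sdp_def n[of j] x y)
  then show "\<exists>p. \<forall>j. cong_sdp j p (s j)" by blast
next
  fix j p q p' q' assume "cong_sdp j p q" "cong_sdp j p' q'"
  then show "cong_sdp j (p \<otimes>\<^bsub>sdp m\<^esub> p') (q \<otimes>\<^bsub>sdp m\<^esub> q')"
    by (cases p; cases q; cases p'; cases q') (auto simp: cong_sdp_def mult_sdp intro!: eqm_add eqm_diff eqm_mult)
next
  fix c j assume "c \<in> lower_central (sdp m) (Suc j)"
  from lower_central_sdp[OF this] obtain x y where "c = (0, x, y)" "2 ^ j dvd x" "2 ^ Suc j dvd y"
    by auto
  then show "cong_sdp j c \<one>\<^bsub>sdp m\<^esub>"
    using dvd_mult_right[of 2 "2 ^ j" y] by (simp add: cong_sdp_def eqm_def)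
qed (auto simp: cong_sdp_def prod_eq_iff intro: eqm_sym eqm_trans eqm_separated)

lemma complete_group_hdp: "complete_group (hdp m) cong_hdp"
proof (intro complete_group.intro plain_group.intro group_hdp complete_group_axioms.intro)
  fix s assume s: "\<And>j. cong_hdp j (s (Suc j)) (s j)"
  have n: "fst (s j) = fst (s 0)" for j
    by (rule const_seq[of "\<lambda>j. fst (s j)"]) (use s in \<open>simp add: cong_hdp_def\<close>)
  obtain x where x: "\<And>j. eqm j x (fst (snd (s j)))"
    using eqm_complete[of "\<lambda>j. fst (snd (s j))"] s by (auto simp: cong_hdp_def)
  obtain y where y: "\<And>j. eqm j y (fst (snd (snd (s j))))"
    using eqm_complete[of "\<lambda>j. fst (snd (snd (s j)))"] s by (auto simp: cong_hdp_def)
  obtain z where z: "\<And>j. eqm j z (snd (snd (snd (s j))))"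
    using eqm_complete[of "\<lambda>j. snd (snd (snd (s j)))"] s by (auto simp: cong_hdp_def)
  have "cong_hdp j (fst (s 0), x, y, z) (s j)" for j
    by (simp add: cong_hdp_def n[of j] x y z)
  then show "\<exists>p. \<forall>j. cong_hdp j p (s j)" by blast
next
  fix j p q p' q' assume "cong_hdp j p q" "cong_hdp j p' q'"
  then show "cong_hdp j (p \<otimes>\<^bsub>hdp m\<^esub> p') (q \<otimes>\<^bsub>hdp m\<^esub> q')"
    by (cases p; cases q; cases p'; cases q') (auto simp: cong_hdp_def mult_hdp intro!: eqm_add eqm_diff eqm_mult)
next
  fix c j assume "c \<in> lower_central (hdp m) (Suc j)"
  from lower_central_hdp[OF this] obtain x y z where "c = (0, x, y, z)" "2 ^ j dvd x" "2 ^ Suc j dvd y" "2 ^ j dvd z"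
    by auto
  then show "cong_hdp j c \<one>\<^bsub>hdp m\<^esub>"
    using dvd_mult_right[of 2 "2 ^ j" y] by (simp add: cong_hdp_def eqm_def)
qed (auto simp: cong_hdp_def prod_eq_iff intro: eqm_sym eqm_trans eqm_separated)

section \<open>The pronilpotent completion of \<open>\<int> \<ltimes> \<int>\<^sup>2\<close>\<close>

lemma iso_inv_hom:
  assumes "group G" "h \<in> iso G H"
  shows "inv_into (carrier G) h \<in> hom H G"
  using group.iso_set_sym[OF assms] by (simp add: iso_def)

text \<open>The commutator with the generator of the integers is the endomorphism
  \<open>1 - a\<close> of the lattice.\<close>

lemma gcomm_sdp_t: "gcomm (sdp m) (0, u, w) (1, 0, 0) = (0, 2 * u - m * w, 2 * w)"
  by (rule gcomm_eqI[OF group_sdp]) (simp_all add: mult_sdp)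

lemma pow4_in_lower_central_sdp:
  fixes m :: int
  assumes "4 ^ n dvd a" "4 ^ n dvd b"
  shows "(0, a, b) \<in> lower_central (sdp m) n"
  using assms
proof (induction n arbitrary: a b)
  case (Suc n)
  interpret P: plain_group "sdp m" by (rule plain_group.intro[OF group_sdp])
  obtain a' b' where ab: "a = 4 * (4 ^ n * a')" "b = 4 * (4 ^ n * b')"
    using Suc.prems by (metis dvdE mult.assoc power_Suc)
  \<comment> \<open>The adjugate of \<open>1 - a\<close> applied to the vector. The determinant of
    \<open>1 - a\<close> is 4, so applying \<open>1 - a\<close> afterwards multiplies by 4.\<close>
  have "(0, 2 * (4 ^ n * a') + m * (4 ^ n * b'), 2 * (4 ^ n * b')) \<in> lower_central (sdp m) n"
    by (intro Suc.IH dvd_add) simp_all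
  then have "gcomm (sdp m) (0, 2 * (4 ^ n * a') + m * (4 ^ n * b'), 2 * (4 ^ n * b')) (1, 0, 0)
      \<in> lower_central (sdp m) (Suc n)"
    by (rule P.comm_in_lower_central) simp
  then show ?case by (simp add: gcomm_sdp_t ab algebra_simps)
qed simp

definition z2_emb :: "int \<times> int \<times> int \<Rightarrow> int \<times> z2 \<times> z2" where
  "z2_emb = (\<lambda>(n, x, y). (n, of_int x, of_int y))"

lemma z2_emb_simp [simp]: "z2_emb (n, x, y) = (n, of_int x, of_int y)"
  by (simp add: z2_emb_def)

lemma z2_emb_hom: "z2_emb \<in> hom (sdp m) (sdp (of_int m))"
  by (rule homI) (auto simp: mult_sdp of_int_sg)

text \<open>The group is given only up to an isomorphism with \<open>sdp m\<close>, the form in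
  which fundamental groups are obtained.\<close>

locale torus_group = bar_group +
  fixes m :: int and pr :: "'a \<Rightarrow> int \<times> int \<times> int"
  assumes pr_iso: "pr \<in> iso G (sdp m)"
begin

interpretation S: plain_group "sdp m" by (rule plain_group.intro[OF group_sdp])
interpretation B: complete_group "sdp (of_int m)" cong_sdp by (rule complete_group_sdp)

definition rp :: "int \<times> int \<times> int \<Rightarrow> 'a" where
  "rp = inv_into (carrier G) pr"

lemma pr_hom: "pr \<in> hom G (sdp m)" and pr_bij: "bij_betw pr (carrier G) UNIV"
  using pr_iso by (simp_all add: iso_def)

lemma rp_hom: "rp \<in> hom (sdp m) G"
  unfolding rp_def by (rule iso_inv_hom[OF is_group pr_iso])

lemma rp_closed [simp]: "rp p \<in> carrier G"
  using rp_hom by (auto simp: hom_def)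

lemma pr_rp [simp]: "pr (rp p) = p"
  unfolding rp_def using pr_bij by (intro f_inv_into_f) (auto simp: bij_betw_def)

lemma rp_pr [simp]: "g \<in> carrier G \<Longrightarrow> rp (pr g) = g"
  unfolding rp_def using pr_bij by (intro inv_into_f_f) (auto simp: bij_betw_def)

lemma lower_central_pr:
  assumes "g \<in> carrier G" shows "g \<in> lower_central G n \<longleftrightarrow> pr g \<in> lower_central (sdp m) n"
proof
  show "pr g \<in> lower_central (sdp m) n" if "g \<in> lower_central G n"
    using hom_lower_central[OF is_group group_sdp pr_hom that] .
  show "g \<in> lower_central G n" if "pr g \<in> lower_central (sdp m) n"
    using hom_lower_central[OF group_sdp is_group rp_hom that] assms by simp
qed

definition theta :: "'a \<Rightarrow> int \<times> z2 \<times> z2" where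
  "theta g = z2_emb (pr g)"

lemma theta_hom: "theta \<in> hom G (sdp (of_int m))"
  unfolding theta_def using Group.hom_compose[OF pr_hom z2_emb_hom] by (simp add: comp_def)

definition psi :: "(nat \<Rightarrow> 'a set) \<Rightarrow> int \<times> z2 \<times> z2" where
  "psi = B.ext theta"

lemma psi_hom: "psi \<in> hom compl (sdp (of_int m))"
  unfolding psi_def by (rule B.ext_hom[OF is_group theta_hom])

lemma psi_cong: "x \<in> carrier compl \<Longrightarrow> f \<in> x (Suc j) \<Longrightarrow> cong_sdp j (theta f) (psi x)"
  unfolding psi_def by (rule B.ext_cong[OF is_group theta_hom])

lemma psi_eqI:
  "x \<in> carrier compl \<Longrightarrow> (\<And>j. \<exists>f\<in>x (Suc j). cong_sdp j (theta f) p) \<Longrightarrow> psi x = p"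
  unfolding psi_def by (rule B.ext_eqI[OF is_group theta_hom])

lemma pow4: "(4::int) ^ n = 2 ^ (2 * n)"
  by (simp add: power_mult)

text \<open>Injectivity: level \<open>Suc (2 * n)\<close> controls the coordinates modulo
  \<open>2 ^ (2 * n) = 4 ^ n\<close>, which suffices for membership in the term
  \<open>n\<close>.\<close>

lemma psi_one:
  assumes x: "x \<in> carrier compl" "psi x = (0, 0, 0)"
  shows "x = \<one>\<^bsub>compl\<^esub>"
proof (rule compl_eqI[OF x(1) compl_one_closed])
  fix n
  obtain f where f: "f \<in> x (Suc (2 * n))" using compl_nonempty[OF x(1)] by blast
  have fc: "f \<in> carrier G" using compl_mem_carrier[OF x(1) f] .
  obtain k a b where p: "pr f = (k, a, b)" by (metis prod_cases3)
  have "cong_sdp (2 * n) (theta f) (0, 0, 0)" using psi_cong[OF x(1) f] x(2) by simp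
  then have "k = 0" "2 ^ (2 * n) dvd (of_int a :: z2)" "2 ^ (2 * n) dvd (of_int b :: z2)"
    by (simp_all add: theta_def p cong_sdp_def eqm_def)
  then have "f \<in> lower_central G n"
    using lower_central_pr[OF fc] pow4_in_lower_central_sdp[of n a b m] p
    by (simp add: pow2_dvd_of_int_iff pow4)
  moreover have "f \<in> x n" using compl_mem_antimono[OF x(1) f, of n] by simp
  ultimately show "\<exists>g. g \<in> x n \<and> g \<in> \<one>\<^bsub>compl\<^esub> n" using compl_one_mem_iff by blast
qed

lemma psi_surj: "\<exists>x\<in>carrier compl. psi x = p"
proof -
  obtain n x y where p: "p = (n, x, y)" by (metis prod_cases3)
  have "\<forall>j. \<exists>a. 2 ^ (2 * j) dvd x - of_int a" "\<forall>j. \<exists>b. 2 ^ (2 * j) dvd y - of_int b"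
    using z2_approx by blast+
  then obtain a b where a: "\<And>j. 2 ^ (2 * j) dvd x - of_int (a j)" and b: "\<And>j. 2 ^ (2 * j) dvd y - of_int (b j)"
    by metis
  define s where "s j = rp (n, a j, b j)" for j
  \<comment> \<open>Approximating modulo \<open>4 ^ j\<close> rather than \<open>2 ^ j\<close> makes
    consecutive approximations differ by an element of the term \<open>j\<close>.\<close>
  have diff: "(4::int) ^ j dvd c (Suc j) - c j" if c: "\<And>j. 2 ^ (2 * j) dvd z - of_int (c j)" for z :: z2 and c j
  proof -
    have "(2::z2) ^ (2 * j) dvd 2 ^ (2 * Suc j)" by (rule le_imp_power_dvd) simp
    then have "2 ^ (2 * j) dvd z - of_int (c (Suc j))" by (rule dvd_trans[OF _ c])
    then have "2 ^ (2 * j) dvd (z - of_int (c j)) - (z - of_int (c (Suc j)))"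
      by (rule dvd_diff[OF c])
    then have "(2::z2) ^ (2 * j) dvd of_int (c (Suc j) - c j)" by simp
    then show ?thesis unfolding pow2_dvd_of_int_iff pow4 .
  qed
  have sc: "s j \<in> carrier G" for j by (simp add: s_def)
  have "lcong j (s (Suc j)) (s j)" for j
  proof -
    have "(0, a (Suc j) - a j, b (Suc j) - b j) \<in> lower_central (sdp m) j"
      using diff[OF a] diff[OF b] by (rule pow4_in_lower_central_sdp)
    then have "rp (0, a (Suc j) - a j, b (Suc j) - b j) \<in> lower_central G j"
      by (simp add: lower_central_pr)
    then have "lcong j (rp (0, a (Suc j) - a j, b (Suc j) - b j) \<otimes> s j) (s j)"
      by (rule lcong_mult_left[OF _ sc])
    moreover have "rp (0, a (Suc j) - a j, b (Suc j) - b j) \<otimes> s j = s (Suc j)"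
      unfolding s_def using hom_mult[OF rp_hom, of "(0, a (Suc j) - a j, b (Suc j) - b j)" "(n, a j, b j)"]
      by (simp add: mult_sdp)
    ultimately show ?thesis by simp
  qed
  note lim = compl_lim_closed[of s, OF sc this] compl_lim_mem[of s, OF sc this]
  have "psi (compl_lim s) = p"
  proof (rule psi_eqI[OF lim(1)])
    fix j
    have "(2::z2) ^ j dvd 2 ^ (2 * Suc j)" by (rule le_imp_power_dvd) simp
    then have "2 ^ j dvd x - of_int (a (Suc j))" "2 ^ j dvd y - of_int (b (Suc j))"
      by (rule dvd_trans[OF _ a], rule dvd_trans[OF _ b])
    then have "cong_sdp j (theta (s (Suc j))) p"
      by (auto simp: cong_sdp_def theta_def s_def p eqm_def[symmetric] intro: eqm_sym)
    then show "\<exists>f\<in>compl_lim s (Suc j). cong_sdp j (theta f) p" using lim(2) by blast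
  qed
  then show ?thesis using lim(1) by blast
qed

theorem compl_iso: "compl \<cong> sdp (of_int m :: z2)"
proof -
  interpret psi: group_hom compl "sdp (of_int m)" psi
    by (intro group_hom.intro group_hom_axioms.intro compl_group group_sdp psi_hom)
  have "psi \<in> iso compl (sdp (of_int m))"
    unfolding psi.iso_iff
  proof (intro conjI ballI impI)
    show "carrier (sdp (of_int m)) \<subseteq> psi ` carrier compl"
      using psi_surj by (metis image_eqI subsetI)
    fix x assume "x \<in> carrier compl" "psi x = \<one>\<^bsub>sdp (of_int m)\<^esub>"
    then show "x = \<one>\<^bsub>compl\<^esub>" using psi_one by simp
  qed
  then show ?thesis by (auto simp: is_iso_def)
qed

end

lemma sdp_z2_iso:
  assumes "odd k" "odd l"
  shows "sdp (of_int k :: z2) \<cong> sdp (of_int l :: z2)"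
proof -
  obtain u v :: z2 where u: "of_int k * u = 1" and v: "of_int l * v = 1"
    using odd_z2_unit assms by metis
  define f where "f = (\<lambda>(n::int, x :: z2, y :: z2). (n, of_int l * u * x, y))"
  define g where "g = (\<lambda>(n::int, x :: z2, y :: z2). (n, of_int k * v * x, y))"
  have uv: "of_int l * u * (of_int k * v * x) = x" "of_int k * v * (of_int l * u * x) = x" for x
  proof -
    have "of_int l * u * (of_int k * v * x) = (of_int k * u) * (of_int l * v) * x"
      by (simp add: mult_ac)
    then show "of_int l * u * (of_int k * v * x) = x" using u v by simp
    then show "of_int k * v * (of_int l * u * x) = x" by (simp add: mult_ac)
  qed
  have "f (g p) = p" "g (f p) = p" for p
    by (auto simp: f_def g_def uv split: prod.splits)
  then have "bij_betw f UNIV UNIV"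
    by (intro bij_betwI[of _ _ _ g]) auto
  moreover have "f (p \<otimes>\<^bsub>sdp (of_int k)\<^esub> q) = f p \<otimes>\<^bsub>sdp (of_int l)\<^esub> f q" for p q
  proof -
    obtain n x y n' x' y' where pq: "p = (n, x, y)" "q = (n', x', y')" by (metis prod_cases3)
    have "of_int l * u * (x + sg n * (x' - of_int n * of_int k * y'))
        = of_int l * u * x + sg n * (of_int l * u * x' - of_int n * of_int l * (of_int k * u) * y')"
      by (simp add: algebra_simps)
    then show ?thesis using u by (simp add: pq f_def mult_sdp)
  qed
  ultimately have "f \<in> iso (sdp (of_int k)) (sdp (of_int l))"
    by (auto simp: iso_def hom_def)
  then show ?thesis by (auto simp: is_iso_def)
qed

section \<open>The right exact completion of \<open>\<int> \<ltimes> \<int>\<^sup>2\<close>\<close>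

definition int_add :: "int monoid" where
  "int_add = \<lparr>carrier = UNIV, mult = (+), one = 0\<rparr>"

lemma int_add_simps [simp]:
  "carrier int_add = UNIV" "x \<otimes>\<^bsub>int_add\<^esub> y = x + y" "\<one>\<^bsub>int_add\<^esub> = 0"
  by (simp_all add: int_add_def)

lemma group_int_add: "group int_add"
  by (rule groupI) (auto intro: exI[of _ "- x" for x])

lemma lower_central_int_add: "lower_central int_add (Suc 0) = {0}"
proof -
  interpret Z: plain_group int_add by (rule plain_group.intro[OF group_int_add])
  have "gcomm int_add x y = 0" for x y
    by (rule gcomm_eqI[OF group_int_add]) simp_all
  then have "{gcomm int_add x y |x y. x \<in> lower_central int_add 0 \<and> y \<in> carrier int_add} = {\<one>\<^bsub>int_add\<^esub>}"
    by auto
  then show ?thesis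
    unfolding Z.lower_central_Suc using Z.generate_one by simp
qed

lemma subgroup_sdp_UNIV:
  fixes m :: int
  assumes H: "subgroup H (sdp m)" "(1, 0, 0) \<in> H" "(0, 1, 0) \<in> H" "(0, 0, 1) \<in> H"
  shows "H = UNIV"
proof -
  interpret P: plain_group "sdp m" by (rule plain_group.intro[OF group_sdp])
  have inv: "inv\<^bsub>sdp m\<^esub> (n, x, y) = (- n, - sg n * (x + of_int n * m * y), - sg n * y)" for n x y
    by (rule P.inv_equality) (simp_all add: mult_sdp algebra_simps)
  have mult: "p \<otimes>\<^bsub>sdp m\<^esub> q \<in> H" if "p \<in> H" "q \<in> H" for p q
    using subgroup.m_closed[OF H(1) that] .
  have invH: "inv\<^bsub>sdp m\<^esub> p \<in> H" if "p \<in> H" for p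
    using subgroup.m_inv_closed[OF H(1) that] .
  have ind: "\<forall>k. f k \<in> H" if "f 1 \<in> H" "\<And>k l. f (k + l) = f k \<otimes>\<^bsub>sdp m\<^esub> f l"
      "\<And>k. f (- k) = inv\<^bsub>sdp m\<^esub> f k" for f :: "int \<Rightarrow> int \<times> int \<times> int"
  proof
    fix k
    have "f (1 + - 1) \<in> H"
      unfolding that(2) that(3) by (intro mult invH that(1))
    then have 0: "f 0 \<in> H" by simp
    show "f k \<in> H"
    proof (induction k rule: int_induct[of _ 0])
      case (step1 i)
      then show ?case using that mult by simp
    next
      case (step2 i)
      have "f (i + - 1) \<in> H"
        unfolding that(2) that(3) by (intro mult invH that(1) step2.IH)
      then show ?case by simp
    qed (rule 0)
  qed
  have x: "\<forall>k. (0, k, 0) \<in> H"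
    by (rule ind) (use H in \<open>simp_all add: mult_sdp inv\<close>)
  have y: "\<forall>k. (0, 0, k) \<in> H"
    by (rule ind) (use H in \<open>simp_all add: mult_sdp inv\<close>)
  have n: "\<forall>k. (k, 0, 0) \<in> H"
    by (rule ind) (use H in \<open>simp_all add: mult_sdp inv\<close>)
  have "(k, a, b) \<in> H" for k a b
    using mult[OF mult[of "(0, a, 0)" "(0, 0, b)"], of "(k, 0, 0)"] x y n by (simp add: mult_sdp)
  then show ?thesis by auto
qed

context torus_group
begin

interpretation S: plain_group "sdp m" by (rule plain_group.intro[OF group_sdp])
interpretation Q: complete_group "hdp (of_int m)" cong_hdp by (rule complete_group_hdp)

lemma generate_G: "generate G {rp (1, 0, 0), rp (0, 1, 0), rp (0, 0, 1)} = carrier G"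
proof -
  interpret r: group_hom "sdp m" G rp
    by (intro group_hom.intro group_hom_axioms.intro group_sdp is_group rp_hom)
  let ?T = "{(1, 0, 0), (0, 1, 0), (0, 0, 1)} :: (int \<times> int \<times> int) set"
  have "generate (sdp m) ?T = UNIV"
    by (rule subgroup_sdp_UNIV[OF S.generate_is_subgroup]) (auto intro: generate.incl)
  then have "generate G (rp ` ?T) = rp ` UNIV" using r.generate_img[of ?T] by simp
  also have "rp ` UNIV = carrier G"
    using rp_pr by (metis UNIV_I image_eqI image_subsetI rp_closed subset_antisym subsetI)
  finally show ?thesis by simp
qed

text \<open>A section of the central extension over the integral points. It is not multiplicative,
  and \<open>cocycle\<close> measures the failure.\<close>

definition hlift :: "int \<times> int \<times> int \<Rightarrow> int \<times> z2 \<times> z2 \<times> z2" where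
  "hlift = (\<lambda>(n, x, y). (n, of_int x, of_int y, 0))"

definition hmap :: "(bool \<times> 'a list) list \<Rightarrow> int \<times> z2 \<times> z2 \<times> z2" where
  "hmap = free_extension (hdp (of_int m)) (\<lambda>s. hlift (pr (hd s)))"

lemma pr_one: "pr \<one> = (0, 0, 0)"
  using hom_one[OF pr_hom is_group group_sdp] by simp

lemma hmap_hom: "hmap \<in> hom F0 (hdp (of_int m))"
  unfolding hmap_def F0_def by (rule free_extension_hom[OF group_hdp]) simp

lemma hmap_tau: "hmap (tau g) = hlift (pr g)"
proof (cases "g = \<one>")
  case True
  then show ?thesis
    using hom_one[OF hmap_hom group_F0 group_hdp] by (simp add: tau_def pr_one hlift_def)
next
  case False
  then show ?thesis
    using free_extension_free_gen[OF group_hdp, of "\<lambda>s. hlift (pr (hd s))" "[g]" "of_int m"]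
    by (simp add: tau_def hmap_def)
qed

abbreviation hproj :: "int \<times> z2 \<times> z2 \<times> z2 \<Rightarrow> int \<times> z2 \<times> z2" where
  "hproj \<equiv> \<lambda>(n, x, y, z). (n, x, y)"

lemma hproj_hmap:
  assumes w: "w \<in> carrier F0"
  shows "hproj (hmap w) = theta (phi w)"
proof -
  have h: "hproj \<circ> hmap \<in> hom F0 (sdp (of_int m))" "theta \<circ> phi \<in> hom F0 (sdp (of_int m))"
    using Group.hom_compose[OF hmap_hom hdp_proj_hom] Group.hom_compose[OF phi_hom theta_hom] .
  have "(hproj \<circ> hmap) w = (theta \<circ> phi) w"
  proof (rule F0_hom_eq[OF group_sdp h _ w])
    fix g assume g: "g \<in> carrier G"
    then show "(hproj \<circ> hmap) (tau g) = (theta \<circ> phi) (tau g)"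
      by (simp add: hmap_tau phi_tau theta_def hlift_def split: prod.splits)
  qed
  then show ?thesis by simp
qed

text \<open>Minus the cocycle of \<open>hdp\<close>: the lift of a product is the product of the
  lifts times this central integer.\<close>

definition cocycle :: "'a list \<Rightarrow> int" where
  "cocycle s = (case (pr (s ! 0), pr (s ! 1)) of ((n, x, y), (n', x', y')) \<Rightarrow>
    - (x * (sg n * y') - y * (sg n * (x' - n * m * y'))))"

definition eps :: "(bool \<times> 'a list) list \<Rightarrow> int" where
  "eps = free_extension int_add cocycle"

lemma eps_hom: "eps \<in> hom F1 int_add"
  unfolding eps_def F1_def by (rule free_extension_hom[OF group_int_add]) simp

abbreviation zz :: "int \<Rightarrow> int \<times> z2 \<times> z2 \<times> z2" where
  "zz i \<equiv> (0, 0, 0, of_int i)"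

lemma zz_central: "zz i \<otimes>\<^bsub>hdp c\<^esub> p = p \<otimes>\<^bsub>hdp c\<^esub> zz i"
  by (cases p) (simp add: mult_hdp)

lemma zz_add: "zz (i + j) = zz i \<otimes>\<^bsub>hdp c\<^esub> zz j"
  by (simp add: mult_hdp)

text \<open>The lifts of the two ends of a homotopy differ by a central integer. Since it is
  central, the right-hand side is multiplicative in \<open>w\<close>, so checking it on generators
  is enough.\<close>

lemma hmap_d0:
  assumes w: "w \<in> carrier F1"
  shows "hmap (d0 w) = hmap (d1 w) \<otimes>\<^bsub>hdp (of_int m)\<^esub> zz (eps w)"
proof -
  let ?H = "hdp (of_int m :: z2)"
  have h0: "hmap \<circ> d0 \<in> hom F1 ?H" and h1: "hmap \<circ> d1 \<in> hom F1 ?H"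
    using Group.hom_compose[OF d0_hom hmap_hom] Group.hom_compose[OF d1_hom hmap_hom] .
  have h2: "(\<lambda>w. (hmap \<circ> d1) w \<otimes>\<^bsub>?H\<^esub> zz (eps w)) \<in> hom F1 ?H"
  proof (rule homI)
    fix u v assume uv: "u \<in> carrier F1" "v \<in> carrier F1"
    have "eps (u \<otimes>\<^bsub>F1\<^esub> v) = eps u + eps v" using hom_mult[OF eps_hom uv] by simp
    then have "zz (eps (u \<otimes>\<^bsub>F1\<^esub> v)) = zz (eps u) \<otimes>\<^bsub>?H\<^esub> zz (eps v)"
      by (simp only: zz_add)
    then have "(hmap \<circ> d1) (u \<otimes>\<^bsub>F1\<^esub> v) \<otimes>\<^bsub>?H\<^esub> zz (eps (u \<otimes>\<^bsub>F1\<^esub> v))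
      = ((hmap \<circ> d1) u \<otimes>\<^bsub>?H\<^esub> (hmap \<circ> d1) v) \<otimes>\<^bsub>?H\<^esub> (zz (eps u) \<otimes>\<^bsub>?H\<^esub> zz (eps v))"
      using hom_mult[OF h1 uv] by simp
    also have "\<dots> = (hmap \<circ> d1) u \<otimes>\<^bsub>?H\<^esub> ((hmap \<circ> d1) v \<otimes>\<^bsub>?H\<^esub> zz (eps u)) \<otimes>\<^bsub>?H\<^esub> zz (eps v)"
      by (simp add: Q.m_assoc)
    also have "\<dots> = (hmap \<circ> d1) u \<otimes>\<^bsub>?H\<^esub> (zz (eps u) \<otimes>\<^bsub>?H\<^esub> (hmap \<circ> d1) v) \<otimes>\<^bsub>?H\<^esub> zz (eps v)"
      by (simp only: zz_central)
    also have "\<dots> = ((hmap \<circ> d1) u \<otimes>\<^bsub>?H\<^esub> zz (eps u)) \<otimes>\<^bsub>?H\<^esub> ((hmap \<circ> d1) v \<otimes>\<^bsub>?H\<^esub> zz (eps v))"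
      by (simp add: Q.m_assoc)
    finally show "(hmap \<circ> d1) (u \<otimes>\<^bsub>F1\<^esub> v) \<otimes>\<^bsub>?H\<^esub> zz (eps (u \<otimes>\<^bsub>F1\<^esub> v))
      = ((hmap \<circ> d1) u \<otimes>\<^bsub>?H\<^esub> zz (eps u)) \<otimes>\<^bsub>?H\<^esub> ((hmap \<circ> d1) v \<otimes>\<^bsub>?H\<^esub> zz (eps v))" .
  qed simp
  have "(hmap \<circ> d0) w = (hmap \<circ> d1) w \<otimes>\<^bsub>?H\<^esub> zz (eps w)"
  proof (rule F1_hom_eq[OF group_hdp h0 h2 _ w])
    fix g h assume gh: "[g, h] \<in> gens1"
    then have c: "g \<in> carrier G" "h \<in> carrier G" by (auto simp: gens1_def)
    obtain n x y n' x' y' where p: "pr g = (n, x, y)" "pr h = (n', x', y')" by (metis prod_cases3)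
    then have pgh: "pr (g \<otimes> h) = (n + n', x + sg n * (x' - n * m * y'), y + sg n * y')"
      using hom_mult[OF pr_hom c] by (simp add: mult_sdp)
    have e: "eps (free_gen [g, h]) = - (x * (sg n * y') - y * (sg n * (x' - n * m * y')))"
      by (simp add: eps_def free_extension_free_gen group_int_add cocycle_def p)
    have "hmap (tau (g \<otimes> h)) = (hmap (tau g) \<otimes>\<^bsub>?H\<^esub> zz (eps (free_gen [g, h]))) \<otimes>\<^bsub>?H\<^esub> hmap (tau h)"
      unfolding e hmap_tau p pgh hlift_def by (simp add: mult_hdp of_int_sg algebra_simps)
    moreover have "hmap (d0 (free_gen [g, h])) = hmap (tau (g \<otimes> h)) \<otimes>\<^bsub>?H\<^esub> inv\<^bsub>?H\<^esub> hmap (tau h)"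
    proof -
      interpret hm: group_hom F0 ?H hmap
        by (intro group_hom.intro group_hom_axioms.intro group_F0 group_hdp hmap_hom)
      show ?thesis using c tau_closed by (simp add: d0_gen[OF gh])
    qed
    ultimately have "hmap (d0 (free_gen [g, h])) = hmap (tau g) \<otimes>\<^bsub>?H\<^esub> zz (eps (free_gen [g, h]))"
      by (simp add: Q.m_assoc)
    then show "(hmap \<circ> d0) (free_gen [g, h]) = (hmap \<circ> d1) (free_gen [g, h]) \<otimes>\<^bsub>?H\<^esub> zz (eps (free_gen [g, h]))"
      by (simp add: d1_gen[OF gh])
  qed
  then show ?thesis by simp
qed

definition hext :: "(nat \<Rightarrow> (bool \<times> 'a list) list set) \<Rightarrow> int \<times> z2 \<times> z2 \<times> z2" where
  "hext = Q.ext hmap"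

lemma hext_hom: "hext \<in> hom F0.compl (hdp (of_int m))"
  unfolding hext_def by (rule Q.ext_hom[OF group_F0 hmap_hom])

lemma hext_cong: "x \<in> carrier F0.compl \<Longrightarrow> f \<in> x (Suc j) \<Longrightarrow> cong_hdp j (hmap f) (hext x)"
  unfolding hext_def by (rule Q.ext_cong[OF group_F0 hmap_hom])

lemma hext_eqI:
  "x \<in> carrier F0.compl \<Longrightarrow> (\<And>j. \<exists>f\<in>x (Suc j). cong_hdp j (hmap f) p) \<Longrightarrow> hext x = p"
  unfolding hext_def by (rule Q.ext_eqI[OF group_F0 hmap_hom])

text \<open>Since \<open>\<int>\<close> is abelian, the integral cocycle survives the completion of \<open>F1\<close> unchanged.\<close>

lemma hext_rel:
  assumes "K.rel x x'"
  shows "\<exists>i. hext x = hext x' \<otimes>\<^bsub>hdp (of_int m)\<^esub> zz i"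
proof -
  obtain y where y: "y \<in> carrier F1.compl" "completion_map F0 d0 y = x" "completion_map F0 d1 y = x'"
    using assms by (auto simp: K.rel_def)
  obtain f1 where f1: "f1 \<in> y (Suc 0)" using F1.compl_nonempty[OF y(1)] by blast
  \<comment> \<open>The integers have trivial term \<open>Suc 0\<close>, so \<open>eps\<close> is
    already determined by level \<open>Suc 0\<close> and takes one integer value on all of
    \<open>y\<close>.\<close>
  have eps: "eps f = eps f1" if f: "f \<in> y (Suc j)" for f j
  proof -
    have "f \<in> y (Suc 0)" using F1.compl_mem_antimono[OF y(1) f, of "Suc 0"] by simp
    then have "F1.lcong (Suc 0) f f1" using F1.compl_mem_iff[OF y(1) f1] by simp
    then have "plain_group.lcong int_add (Suc 0) (eps f) (eps f1)"
      by (rule hom_lcong[OF group_F1 group_int_add eps_hom])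
    then have "eps f \<otimes>\<^bsub>int_add\<^esub> inv\<^bsub>int_add\<^esub> eps f1 = 0"
      using lower_central_int_add by (simp add: plain_group.lcong_def[OF plain_group.intro[OF group_int_add]])
    moreover have "inv\<^bsub>int_add\<^esub> eps f1 = - eps f1"
      by (rule group.inv_equality[OF group_int_add]) simp_all
    ultimately show ?thesis by simp
  qed
  have "hext x = hext x' \<otimes>\<^bsub>hdp (of_int m)\<^esub> zz (eps f1)"
  proof (rule hext_eqI)
    show "x \<in> carrier F0.compl" using K.rel_carrier[OF assms] by simp
    fix j
    obtain f where f: "f \<in> y (Suc j)" using F1.compl_nonempty[OF y(1)] by blast
    have "d0 f \<in> x (Suc j)" "d1 f \<in> x' (Suc j)"
      using completion_map_mem[OF group_F1 group_F0 d0_hom y(1) f]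
        completion_map_mem[OF group_F1 group_F0 d1_hom y(1) f] y by simp_all
    moreover have "cong_hdp j (hmap (d0 f)) (hext x' \<otimes>\<^bsub>hdp (of_int m)\<^esub> zz (eps f1))"
      unfolding hmap_d0[OF F1.compl_mem_carrier[OF y(1) f]] eps[OF f]
      using K.rel_carrier(2)[OF assms] \<open>d1 f \<in> x' (Suc j)\<close>
      by (intro Q.cong_mult hext_cong Q.cong_refl)
    ultimately show "\<exists>f\<in>x (Suc j). cong_hdp j (hmap f) (hext x' \<otimes>\<^bsub>hdp (of_int m)\<^esub> zz (eps f1))"
      by blast
  qed
  then show ?thesis by blast
qed

lemma hproj_hext:
  assumes x: "x \<in> carrier F0.compl"
  shows "hproj (hext x) = psi (phihat x)"
proof -
  have px: "phihat x \<in> carrier compl" using phihat_hom x by (auto simp: hom_def)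
  have "psi (phihat x) = hproj (hext x)"
  proof (rule psi_eqI[OF px])
    fix j
    obtain f where f: "f \<in> x (Suc j)" using F0.compl_nonempty[OF x] by blast
    obtain n a b c n' a' b' c' where h: "hext x = (n, a, b, c)" "hmap f = (n', a', b', c')"
      by (metis prod_cases4)
    have "cong_sdp j (theta (phi f)) (hproj (hext x))"
      using hext_cong[OF x f] hproj_hmap[OF F0.compl_mem_carrier[OF x f], symmetric]
      by (simp add: cong_hdp_def cong_sdp_def h)
    then show "\<exists>g\<in>phihat x (Suc j). cong_sdp j (theta g) (hproj (hext x))"
      using phihat_mem[OF x f] by blast
  qed
  then show ?thesis by simp
qed

lemma phihat_rel:
  assumes "K.rel x x'" shows "phihat x = phihat x'"
proof -
  obtain y where y: "y \<in> carrier F1.compl" "completion_map F0 d0 y = x" "completion_map F0 d1 y = x'"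
    using assms by (auto simp: K.rel_def)
  have h: "(\<lambda>w. phi (d1 w)) \<in> hom F1 G"
    using Group.hom_compose[OF d1_hom phi_hom] by (simp add: comp_def)
  show ?thesis
    using completion_map_comp[OF group_F1 group_F0 is_group d0_hom phi_hom h phi_d0_d1 y(1)]
      completion_map_comp[OF group_F1 group_F0 is_group d1_hom phi_hom h _ y(1)] y
    by (simp add: phihat_def)
qed

text \<open>The natural map from the right exact completion to the pronilpotent one, in coordinates.
  It does not depend on the chosen representative because \<open>phi\<close> identifies both ends of
  a homotopy.\<close>

definition pv :: "(nat \<Rightarrow> (bool \<times> 'a list) list set) list set \<Rightarrow> int \<times> z2 \<times> z2" where
  "pv e = psi (phihat (SOME x. x \<in> carrier F0.compl \<and> K.cls x = e))"

lemma pv_cls: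
  assumes "x \<in> carrier F0.compl" shows "pv (K.cls x) = psi (phihat x)"
proof -
  let ?y = "SOME y. y \<in> carrier F0.compl \<and> K.cls y = K.cls x"
  have "?y \<in> carrier F0.compl \<and> K.cls ?y = K.cls x"
    by (rule someI[of _ x]) (simp add: assms)
  then have "phihat ?y = phihat x"
    using assms K.cls_eq_iff by (intro phihat_rel) blast
  then show ?thesis by (simp add: pv_def)
qed

lemma ZG_cases:
  assumes "e \<in> carrier ZG" obtains x where "x \<in> carrier F0.compl" "e = K.cls x"
  using assms by (auto simp: ZG_eq K.carrier_pi1)

lemma cls_closed: "x \<in> carrier F0.compl \<Longrightarrow> K.cls x \<in> carrier ZG"
  by (simp add: ZG_eq K.carrier_pi1)

lemma pv_hom: "pv \<in> hom ZG (sdp (of_int m))"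
proof (rule homI)
  fix e e' assume "e \<in> carrier ZG" "e' \<in> carrier ZG"
  then obtain x x' where x: "x \<in> carrier F0.compl" "e = K.cls x" "x' \<in> carrier F0.compl" "e' = K.cls x'"
    using ZG_cases by metis
  then have ee': "e \<otimes>\<^bsub>ZG\<^esub> e' = K.cls (x \<otimes>\<^bsub>F0.compl\<^esub> x')"
    by (simp add: ZG_eq K.mult_pi1)
  have "psi (phihat (x \<otimes>\<^bsub>F0.compl\<^esub> x')) = psi (phihat x) \<otimes>\<^bsub>sdp (of_int m)\<^esub> psi (phihat x')"
    using hom_mult[OF Group.hom_compose[OF phihat_hom psi_hom] x(1,3)] by simp
  then show "pv (e \<otimes>\<^bsub>ZG\<^esub> e') = pv e \<otimes>\<^bsub>sdp (of_int m)\<^esub> pv e'"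
    unfolding ee' using x by (simp add: pv_cls F0.compl_mult_closed)
qed simp

lemma pv_surj: "\<exists>e\<in>carrier ZG. pv e = p"
proof -
  obtain y where y: "y \<in> carrier compl" "psi y = p" using psi_surj by blast
  obtain x where "x \<in> carrier F0.compl" "phihat x = y" using phihat_surj[OF y(1)] by blast
  then show ?thesis using y pv_cls cls_closed by blast
qed

lemma pv_kernel:
  assumes e: "e \<in> carrier ZG" "pv e = (0, 0, 0)"
  shows "e \<in> lower_central ZG n"
proof -
  obtain x where x: "x \<in> carrier F0.compl" "e = K.cls x" using ZG_cases e(1) by blast
  have "phihat x \<in> carrier compl" using phihat_hom x by (auto simp: hom_def)
  then have "phihat x = \<one>\<^bsub>compl\<^esub>" using e(2) x pv_cls psi_one by simp
  then show ?thesis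
    using kernel_in_lower_central[OF _ _ generate_G x(1)] x(2) by simp
qed

text \<open>In the central extension the products in the two orders have central coordinates that
  differ by twice the determinant, while homotopic elements differ by an integer there.\<close>

lemma pv_commute:
  assumes e: "e \<in> carrier ZG" "pv e = (0, x, y)" and e': "e' \<in> carrier ZG" "pv e' = (0, x', y')"
    and comm: "e \<otimes>\<^bsub>ZG\<^esub> e' = e' \<otimes>\<^bsub>ZG\<^esub> e"
  shows "\<exists>i. x * y' - y * x' = of_int i"
proof -
  obtain a a' where a: "a \<in> carrier F0.compl" "e = K.cls a" and a': "a' \<in> carrier F0.compl" "e' = K.cls a'"
    using ZG_cases e(1) e'(1) by metis
  obtain z z' where z: "hext a = (0, x, y, z)" "hext a' = (0, x', y', z')"
    using hproj_hext[OF a(1)] hproj_hext[OF a'(1)] e(2) e'(2) pv_cls a a' by (auto split: prod.splits)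
  have "K.rel (a \<otimes>\<^bsub>F0.compl\<^esub> a') (a' \<otimes>\<^bsub>F0.compl\<^esub> a)"
    using comm a a' F0.compl_mult_closed by (simp add: ZG_eq K.mult_pi1 K.cls_eq_iff)
  then obtain i where "hext (a \<otimes>\<^bsub>F0.compl\<^esub> a') = hext (a' \<otimes>\<^bsub>F0.compl\<^esub> a) \<otimes>\<^bsub>hdp (of_int m)\<^esub> zz i"
    using hext_rel by blast
  then have i: "2 * (x * y' - y * x') = of_int i"
    using hom_mult[OF hext_hom] a a' by (simp add: z mult_hdp algebra_simps)
  \<comment> \<open>Divisibility of an integer by 2 is the same in the integers and in the 2-adic
    integers, so the relation can be halved.\<close>
  then have "2 ^ 1 dvd (of_int i :: z2)" by (metis dvd_triv_left power_one_right)
  then have "2 dvd i" unfolding pow2_dvd_of_int_iff by simp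
  then obtain j where "i = 2 * j" by (elim dvdE)
  then have "2 * (x * y' - y * x' - of_int j) = 0" using i by (simp add: algebra_simps)
  then show ?thesis using z2_double_eq_0[of "x * y' - y * x' - of_int j"] by auto
qed

text \<open>The canonical images of the two lattice generators of \<open>G\<close> commute because
  the generators do.\<close>

lemma pv_commuting_lifts:
  "\<exists>e\<in>carrier ZG. \<exists>e'\<in>carrier ZG. pv e = (0, 1, 0) \<and> pv e' = (0, 0, 1) \<and> e \<otimes>\<^bsub>ZG\<^esub> e' = e' \<otimes>\<^bsub>ZG\<^esub> e"
proof -
  define u where "u p = K.cls (const0 (tau (rp p)))" for p
  have c: "const0 (tau (rp p)) \<in> carrier F0.compl" for p
    using const0_hom tau_closed by (auto simp: hom_def)
  have "u p \<in> carrier ZG" for p by (simp add: u_def cls_closed c)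
  moreover have "pv (u p) = z2_emb p" for p
  proof -
    have "phihat (const0 (tau (rp p))) = compl_lim (\<lambda>_. rp p)"
      unfolding phihat_def const0_def
      using completion_map_const[OF group_F0 is_group phi_hom tau_closed] by (simp add: phi_tau)
    moreover have "psi (compl_lim (\<lambda>_. rp p)) = theta (rp p)"
      by (rule psi_eqI[OF compl_of_closed]) (auto intro!: bexI compl_of_mem simp: cong_sdp_def)
    ultimately show ?thesis using pv_cls[OF c] by (simp add: u_def theta_def)
  qed
  moreover have "u p \<otimes>\<^bsub>ZG\<^esub> u q = u (p \<otimes>\<^bsub>sdp m\<^esub> q)" for p q
    using hom_mult[OF unit_hom, of "rp p" "rp q"] hom_mult[OF rp_hom, of p q] by (simp add: u_def)
  ultimately show ?thesis
    by (intro bexI[of _ "u (0, 1, 0)"] bexI[of _ "u (0, 0, 1)"]) (auto simp: mult_sdp)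
qed

end

section \<open>Isomorphisms between the right exact completions\<close>

text \<open>An additive map sends multiples of \<open>2 ^ n\<close> to multiples of
  \<open>2 ^ n\<close>, hence is continuous, and it is linear over the dense subring of integers. No
  topology has to be assumed on an abstract isomorphism.\<close>

lemma z2_additive:
  fixes f :: "z2 \<Rightarrow> z2"
  assumes add: "\<And>x y. f (x + y) = f x + f y"
  shows "f x = x * f 1"
proof -
  have 0: "f 0 = 0" using add[of 0 0] by simp
  have neg: "f (- x) = - f x" for x using add[of x "- x"] 0 by (simp add: eq_neg_iff_add_eq_0 add.commute)
  have nat: "f (of_nat n * x) = of_nat n * f x" for n x
    by (induction n) (simp_all add: 0 add algebra_simps)
  have int: "f (of_int a * x) = of_int a * f x" for a x
  proof (cases a)
    case (nonneg n)
    then show ?thesis using nat[of n x] by simp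
  next
    case (neg n)
    then show ?thesis using nat[of "Suc n" x] \<open>\<And>x. f (- x) = - f x\<close>[of "of_nat (Suc n) * x"]
      by (simp only: of_int_minus of_int_of_nat_eq mult_minus_left)
  qed
  have "2 ^ n dvd f x - x * f 1" for n
  proof -
    obtain a where "2 ^ n dvd x - of_int a" using z2_approx by blast
    then obtain c where "x - of_int a = 2 ^ n * c" by (elim dvdE)
    then have x: "x = of_int a * 1 + of_int (2 ^ n) * c" by (simp add: algebra_simps)
    have fx: "f x = of_int a * f 1 + of_int (2 ^ n) * f c"
      unfolding x add int by simp
    have "f x - x * f 1 = 2 ^ n * (f c - c * f 1)"
      unfolding fx by (subst x) (simp add: algebra_simps)
    then show ?thesis by simp
  qed
  then show ?thesis using z2_separated[of "f x - x * f 1"] by simp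
qed

lemma int_additive:
  fixes f :: "int \<Rightarrow> int"
  assumes add: "\<And>x y. f (x + y) = f x + f y"
  shows "f x = x * f 1"
proof (induction x rule: int_induct[of _ 0])
  case base
  show ?case using add[of 0 0] by simp
next
  case (step1 i)
  then show ?case by (simp add: add algebra_simps)
next
  case (step2 i)
  then show ?case using add[of "i - 1" 1] by (simp add: algebra_simps)
qed

lemma odd_z2_cancel: "odd l \<Longrightarrow> of_int l * x = 0 \<Longrightarrow> x = (0 :: z2)"
  using odd_z2_unit by (metis mult.commute mult.left_commute mult_1 mult_zero_right)

text \<open>The lattice is preserved because its fourth powers are commutators. The action on it
  must then intertwine \<open>a_k\<close> with \<open>a_l\<close> to the power \<open>e\<close>, and
  comparing entries yields triangularity and the relation between the diagonal entries.\<close>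

lemma sdp_hom_matrix:
  fixes k l :: int
  assumes hom: "b \<in> hom (sdp (of_int k :: z2)) (sdp (of_int l :: z2))" and surj: "\<And>p. \<exists>q. b q = p"
    and l: "odd l"
  shows "\<exists>p q s e. (e = 1 \<or> e = - 1) \<and> (\<forall>x y. b (0, x, y) = (0, p * x + q * y, s * y))
    \<and> of_int k * p = of_int (e * l) * s"
proof -
  let ?K = "sdp (of_int k :: z2)" and ?L = "sdp (of_int l :: z2)"
  interpret K: plain_group ?K by (rule plain_group.intro[OF group_sdp])
  interpret L: plain_group ?L by (rule plain_group.intro[OF group_sdp])
  have mult: "b (p \<otimes>\<^bsub>?K\<^esub> q) = b p \<otimes>\<^bsub>?L\<^esub> b q" for p q
    using hom_mult[OF hom, of p q] by simp
  have fst_mult: "fst (p \<otimes>\<^bsub>?L\<^esub> q) = fst p + fst q" for p q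
    by (cases p; cases q) (simp add: mult_sdp)
  have fst0: "fst (b (0, x, y)) = 0" for x y
  proof -
    \<comment> \<open>Again the adjugate of \<open>1 - a\<close>, so that the commutator of
      \<open>?v\<close> with the integer generator is four times the vector.\<close>
    let ?v = "(0, 2 * x + of_int k * y, 2 * y) :: int \<times> z2 \<times> z2"
    have "(0, x, y) \<otimes>\<^bsub>?K\<^esub> (0, x, y) \<otimes>\<^bsub>?K\<^esub> (0, x, y) \<otimes>\<^bsub>?K\<^esub> (0, x, y) = gcomm ?K ?v (1, 0, 0)"
      by (simp add: gcomm_sdp_t mult_sdp algebra_simps)
    also have "\<dots> \<in> lower_central ?K (Suc 0)"
      by (rule K.comm_in_lower_central) simp_all
    finally have "b ((0, x, y) \<otimes>\<^bsub>?K\<^esub> (0, x, y) \<otimes>\<^bsub>?K\<^esub> (0, x, y) \<otimes>\<^bsub>?K\<^esub> (0, x, y)) \<in> lower_central ?L (Suc 0)"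
      by (rule hom_lower_central[OF group_sdp group_sdp hom])
    then have "fst (b ((0, x, y) \<otimes>\<^bsub>?K\<^esub> (0, x, y) \<otimes>\<^bsub>?K\<^esub> (0, x, y) \<otimes>\<^bsub>?K\<^esub> (0, x, y))) = 0"
      using lower_central_sdp by fastforce
    then show ?thesis unfolding mult fst_mult by simp
  qed
  define f g where "f x y = fst (snd (b (0, x, y)))" and "g x y = snd (snd (b (0, x, y)))" for x y
  have b0: "b (0, x, y) = (0, f x y, g x y)" for x y
    using fst0[of x y] by (simp add: f_def g_def prod_eq_iff)
  have add: "f (x + x') (y + y') = f x y + f x' y'" "g (x + x') (y + y') = g x y + g x' y'" for x y x' y'
    using mult[of "(0, x, y)" "(0, x', y')"] by (simp_all add: mult_sdp b0)
  define p q r s where "p = f 1 0" and "q = f 0 1" and "r = g 1 0" and "s = g 0 1"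
  have f: "f x y = p * x + q * y" for x y
  proof -
    have "f x 0 = x * f 1 0"
      using add(1)[of _ _ 0 0] by (intro z2_additive[of "\<lambda>x. f x 0"]) simp
    moreover have "f 0 y = y * f 0 1"
      using add(1)[of 0 0] by (intro z2_additive[of "f 0"]) simp
    ultimately show ?thesis
      using add(1)[of x 0 0 y] by (simp add: p_def q_def mult.commute)
  qed
  have g: "g x y = r * x + s * y" for x y
  proof -
    have "g x 0 = x * g 1 0"
      using add(2)[of _ _ 0 0] by (intro z2_additive[of "\<lambda>x. g x 0"]) simp
    moreover have "g 0 y = y * g 0 1"
      using add(2)[of 0 0] by (intro z2_additive[of "g 0"]) simp
    ultimately show ?thesis
      using add(2)[of x 0 0 y] by (simp add: r_def s_def mult.commute)
  qed
  obtain e u w where bt: "b (1, 0, 0) = (e, u, w)" by (metis prod_cases3)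
  have "fst (b (n, 0, 0)) = n * e" for n
  proof -
    have "fst (b (x + y, 0, 0)) = fst (b (x, 0, 0)) + fst (b (y, 0, 0))" for x y
      using mult[of "(x, 0, 0)" "(y, 0, 0)"] fst_mult[of "b (x, 0, 0)" "b (y, 0, 0)"] by (simp add: mult_sdp)
    then show ?thesis using int_additive[of "\<lambda>n. fst (b (n, 0, 0))" n] bt by simp
  qed
  \<comment> \<open>Some element maps to first coordinate 1, and its lattice part contributes 0
    there. Hence \<open>e\<close> is invertible in the integers.\<close>
  moreover obtain n x y where "b (n, x, y) = (1, 0, 0)" using surj by (metis prod_cases3)
  then have "fst (b ((0, x, y) \<otimes>\<^bsub>?K\<^esub> (n, 0, 0))) = 1" by (simp add: mult_sdp)
  then have "fst (b (n, 0, 0)) = 1" unfolding mult fst_mult fst0 by simp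
  ultimately have "n * e = 1" by simp
  then have e: "e = 1 \<or> e = - 1" by (metis zmult_eq_1_iff)
  then have sge: "sg e = (- 1 :: z2)" by (auto simp: sg_def)
  \<comment> \<open>The image of the relation \<open>t v = (a v) t\<close>, with \<open>t\<close>
    the integer generator; the translation part of \<open>b t\<close> cancels.\<close>
  have conj: "f (- x + of_int k * y) (- y) = - (f x y - of_int e * of_int l * g x y) \<and> g (- x + of_int k * y) (- y) = - g x y" for x y
  proof -
    have "(1, 0, 0) \<otimes>\<^bsub>?K\<^esub> (0, x, y) = (0, - x + of_int k * y, - y) \<otimes>\<^bsub>?K\<^esub> (1, 0, 0)"
      by (simp add: mult_sdp)
    then have "b (1, 0, 0) \<otimes>\<^bsub>?L\<^esub> b (0, x, y) = b (0, - x + of_int k * y, - y) \<otimes>\<^bsub>?L\<^esub> b (1, 0, 0)"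
      by (metis mult)
    then show ?thesis by (simp add: b0 bt mult_sdp sge algebra_simps eq_neg_iff_add_eq_0)
  qed
  \<comment> \<open>The first basis vector is an eigenvector for both matrices, so its image has no
    second component. The second basis vector gives the relation between \<open>p\<close> and
    \<open>s\<close>.\<close>
  have "of_int e * of_int l * r = 0" using conj[of 1 0] by (simp add: f g algebra_simps)
  then have "of_int l * r = 0" using e by auto
  then have r: "r = 0" using odd_z2_cancel[OF l] by simp
  have "of_int k * p = of_int (e * l) * s" using conj[of 0 1] by (simp add: f g algebra_simps)
  moreover have "b (0, x, y) = (0, p * x + q * y, s * y)" for x y
    by (simp add: b0 f g r)
  ultimately show ?thesis using e by blast
qed

text \<open>The properties of the right exact completion that the comparison uses, isolated so that
  they apply to an isomorphism and to its inverse alike.\<close>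

locale completion_structure = plain_group E for E :: "'e monoid" +
  fixes k :: int and pv :: "'e \<Rightarrow> int \<times> z2 \<times> z2"
  assumes pv_hom: "pv \<in> hom E (sdp (of_int k))"
    and pv_surj: "\<exists>e\<in>carrier E. pv e = p"
    and pv_kernel: "e \<in> carrier E \<Longrightarrow> pv e = (0, 0, 0) \<Longrightarrow> e \<in> lower_central E n"
    and pv_commute: "e \<in> carrier E \<Longrightarrow> pv e = (0, x, y) \<Longrightarrow> e' \<in> carrier E \<Longrightarrow> pv e' = (0, x', y')
      \<Longrightarrow> e \<otimes>\<^bsub>E\<^esub> e' = e' \<otimes>\<^bsub>E\<^esub> e \<Longrightarrow> \<exists>i. x * y' - y * x' = of_int i"
    and pv_lifts: "\<exists>e\<in>carrier E. \<exists>e'\<in>carrier E. pv e = (0, 1, 0) \<and> pv e' = (0, 0, 1) \<and> e \<otimes>\<^bsub>E\<^esub> e' = e' \<otimes>\<^bsub>E\<^esub> e"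

lemma sdp_residually_nilpotent:
  fixes p :: "int \<times> z2 \<times> z2"
  assumes "\<And>n. p \<in> lower_central (sdp m) n" shows "p = (0, 0, 0)"
proof -
  obtain n x y where p: "p = (n, x, y)" by (metis prod_cases3)
  have *: "n = 0 \<and> 2 ^ j dvd x \<and> 2 ^ j dvd y" for j
    using lower_central_sdp[OF assms, of j] dvd_mult_right[of 2 "2 ^ j" y] p by auto
  then show ?thesis using z2_separated[of x] z2_separated[of y] p by simp
qed

text \<open>The kernel of \<open>pv\<close> is the intersection of the lower central series, hence preserved.\<close>

lemma induced_hom:
  assumes "completion_structure E k pv" "completion_structure E' l pv'" and h: "h \<in> hom E E'" "h ` carrier E = carrier E'"
  shows "\<exists>b\<in>hom (sdp (of_int k)) (sdp (of_int l)). (\<forall>e\<in>carrier E. b (pv e) = pv' (h e)) \<and> (\<forall>p. \<exists>q. b q = p)"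
proof -
  interpret E: completion_structure E k pv by fact
  interpret E': completion_structure E' l pv' by fact
  interpret h: group_hom E E' h using h(1) by unfold_locales
  interpret pv: group_hom E "sdp (of_int k)" pv
    by (intro group_hom.intro group_hom_axioms.intro E.is_group group_sdp E.pv_hom)
  interpret pv': group_hom E' "sdp (of_int l)" pv'
    by (intro group_hom.intro group_hom_axioms.intro E'.is_group group_sdp E'.pv_hom)
  have wd: "pv' (h e) = pv' (h e')" if e: "e \<in> carrier E" "e' \<in> carrier E" "pv e = pv e'" for e e'
  proof -
    have "pv (e \<otimes>\<^bsub>E\<^esub> inv\<^bsub>E\<^esub> e') = \<one>\<^bsub>sdp (of_int k)\<^esub>"
      using e pv.H.r_inv[of "pv e'"] by (simp del: one_sdp)
    then have "pv (e \<otimes>\<^bsub>E\<^esub> inv\<^bsub>E\<^esub> e') = (0, 0, 0)" by simp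
    then have "e \<otimes>\<^bsub>E\<^esub> inv\<^bsub>E\<^esub> e' \<in> lower_central E n" for n
      using e by (intro E.pv_kernel) auto
    then have "h (e \<otimes>\<^bsub>E\<^esub> inv\<^bsub>E\<^esub> e') \<in> lower_central E' n" for n
      by (rule hom_lower_central[OF E.is_group E'.is_group h(1)])
    then have "pv' (h (e \<otimes>\<^bsub>E\<^esub> inv\<^bsub>E\<^esub> e')) \<in> lower_central (sdp (of_int l)) n" for n
      by (rule hom_lower_central[OF E'.is_group group_sdp E'.pv_hom])
    then have "pv' (h (e \<otimes>\<^bsub>E\<^esub> inv\<^bsub>E\<^esub> e')) = \<one>\<^bsub>sdp (of_int l)\<^esub>"
      unfolding one_sdp by (rule sdp_residually_nilpotent)
    then have "pv' (h e) \<otimes>\<^bsub>sdp (of_int l)\<^esub> inv\<^bsub>sdp (of_int l)\<^esub> pv' (h e') = \<one>\<^bsub>sdp (of_int l)\<^esub>"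
      using e by (simp del: one_sdp)
    then show ?thesis
      using pv'.H.inv_equality[of "pv' (h e)" "inv\<^bsub>sdp (of_int l)\<^esub> pv' (h e')"] by (simp del: one_sdp)
  qed
  obtain sec where sec: "\<And>p. sec p \<in> carrier E" "\<And>p. pv (sec p) = p"
    using E.pv_surj by metis
  define b where "b p = pv' (h (sec p))" for p
  have b: "b (pv e) = pv' (h e)" if "e \<in> carrier E" for e
    unfolding b_def using that sec by (intro wd) auto
  have "b \<in> hom (sdp (of_int k)) (sdp (of_int l))"
  proof (rule homI)
    fix p q
    have "b (p \<otimes>\<^bsub>sdp (of_int k)\<^esub> q) = b (pv (sec p \<otimes>\<^bsub>E\<^esub> sec q))"
      using sec by simp
    also have "\<dots> = pv' (h (sec p \<otimes>\<^bsub>E\<^esub> sec q))"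
      by (rule b) (simp add: sec)
    also have "\<dots> = pv' (h (sec p)) \<otimes>\<^bsub>sdp (of_int l)\<^esub> pv' (h (sec q))"
      by (simp add: sec)
    finally show "b (p \<otimes>\<^bsub>sdp (of_int k)\<^esub> q) = b p \<otimes>\<^bsub>sdp (of_int l)\<^esub> b q"
      by (simp add: b_def)
  qed simp
  moreover have "\<exists>q. b q = p" for p
  proof -
    obtain e' where "e' \<in> carrier E'" "pv' e' = p" using E'.pv_surj by blast
    then obtain e where "e \<in> carrier E" "pv' (h e) = p" using h(2) by (metis imageE)
    then show ?thesis using b by metis
  qed
  ultimately show ?thesis using b by blast
qed

text \<open>The isomorphism carries commuting lifts of the standard basis to commuting lifts of the
  columns \<open>(p, 0)\<close> and \<open>(q, s)\<close>, whose determinant is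
  \<open>p * s\<close>.\<close>

lemma det_integral:
  assumes "completion_structure E k pv" "completion_structure E' l pv'" "h \<in> hom E E'"
    and b: "\<And>e. e \<in> carrier E \<Longrightarrow> b (pv e) = pv' (h e)"
    and mat: "\<And>x y. b (0, x, y) = (0, p * x + q * y, s * y)"
  shows "\<exists>i. p * s = of_int i"
proof -
  interpret E: completion_structure E k pv by fact
  interpret E': completion_structure E' l pv' by fact
  obtain e e' where e: "e \<in> carrier E" "e' \<in> carrier E" "pv e = (0, 1, 0)" "pv e' = (0, 0, 1)"
    and comm: "e \<otimes>\<^bsub>E\<^esub> e' = e' \<otimes>\<^bsub>E\<^esub> e"
    using E.pv_lifts by blast
  have "h e \<in> carrier E'" "h e' \<in> carrier E'" using e assms(3) by (auto simp: hom_def)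
  moreover have "pv' (h e) = (0, p, 0)" "pv' (h e') = (0, q, s)"
    using b[of e] b[of e'] e mat[of 1 0] mat[of 0 1] by simp_all
  moreover have "h e \<otimes>\<^bsub>E'\<^esub> h e' = h e' \<otimes>\<^bsub>E'\<^esub> h e"
    using hom_mult[OF assms(3)] e comm by metis
  ultimately have "\<exists>i. p * s - 0 * q = of_int i" by (intro E'.pv_commute)
  then show ?thesis by simp
qed

lemma iso_imp_cong_8:
  fixes k l :: int
  assumes E: "completion_structure E k pv" and E': "completion_structure E' l pv'" and iso: "E \<cong> E'"
    and odd: "odd k" "odd l"
  shows "[k * l = 1] (mod 8) \<or> [k * l = 7] (mod 8)"
proof -
  interpret E: completion_structure E k pv by fact
  interpret E': completion_structure E' l pv' by fact
  obtain h where h: "h \<in> iso E E'" using iso by (auto simp: is_iso_def)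
  define g where "g = inv_into (carrier E) h"
  have g: "g \<in> iso E' E" unfolding g_def by (rule E.iso_set_sym[OF h])
  have hom: "h \<in> hom E E'" "g \<in> hom E' E" "h ` carrier E = carrier E'" "g ` carrier E' = carrier E"
    using h g by (auto simp: iso_def bij_betw_def)
  have gh: "g (h e) = e" if "e \<in> carrier E" for e
    unfolding g_def using h that by (intro inv_into_f_f) (auto simp: iso_def bij_betw_def)
  obtain b where b: "b \<in> hom (sdp (of_int k)) (sdp (of_int l))" "\<And>e. e \<in> carrier E \<Longrightarrow> b (pv e) = pv' (h e)"
    "\<And>p. \<exists>q. b q = p"
    using induced_hom[OF E E' hom(1,3)] by blast
  obtain c where c: "c \<in> hom (sdp (of_int l)) (sdp (of_int k))" "\<And>e. e \<in> carrier E' \<Longrightarrow> c (pv' e) = pv (g e)"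
    "\<And>p. \<exists>q. c q = p"
    using induced_hom[OF E' E hom(2,4)] by blast
  \<comment> \<open>The induced maps are mutually inverse on this side, which makes the diagonal
    entries \<open>p\<close> and \<open>s\<close> units.\<close>
  have cb: "c (b r) = r" for r
  proof -
    obtain e where e: "e \<in> carrier E" "pv e = r" using E.pv_surj by blast
    then have "h e \<in> carrier E'" using hom(1) by (auto simp: hom_def)
    then show ?thesis using b(2)[OF e(1)] c(2) gh[OF e(1)] e by simp
  qed
  obtain p q s e where e: "e = 1 \<or> e = - 1" and pqs: "\<And>x y. b (0, x, y) = (0, p * x + q * y, s * y)"
    and kp: "of_int k * p = of_int (e * l) * s"
    using sdp_hom_matrix[OF b(1,3) odd(2)] by blast
  obtain p' q' s' where pqs': "\<And>x y. c (0, x, y) = (0, p' * x + q' * y, s' * y)"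
    using sdp_hom_matrix[OF c(1,3) odd(1)] by blast
  have pp': "p' * p = 1" using cb[of "(0, 1, 0)"] by (simp add: pqs pqs')
  have ss': "s' * s = 1" using cb[of "(0, 0, 1)"] by (simp add: pqs pqs')
  obtain d where d: "p * s = of_int d" using det_integral[OF E E' hom(1) b(2) pqs] by blast
  obtain d' where d': "p' * s' = of_int d'" using det_integral[OF E' E hom(2) c(2) pqs'] by blast
  \<comment> \<open>The determinants of the two induced matrices are integers with product 1 in the
    2-adic integers, hence in the integers.\<close>
  have "(of_int (d * d') :: z2) = (p * s) * (p' * s')" by (simp add: d d')
  also have "\<dots> = (p' * p) * (s' * s)" by (simp add: mult_ac)
  finally have "(of_int (d * d') :: z2) = of_int 1" by (simp add: pp' ss')
  then have "d * d' = 1" by (simp only: of_int_z2_eq_iff)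
  then have d1: "d = 1 \<or> d = - 1" by (metis zmult_eq_1_iff)
  \<comment> \<open>Multiplying \<open>k p = e l s\<close> by \<open>s\<close> replaces
    \<open>p s\<close> by the sign \<open>d\<close> and leaves the square of a unit on the
    right.\<close>
  have "(of_int (k * d) :: z2) = (of_int k * p) * s" by (simp add: d[symmetric] mult.assoc)
  also have "\<dots> = of_int (e * l) * (s * s)" by (simp add: kp mult.assoc)
  finally have "(of_int (k * d - e * l) :: z2) = of_int (e * l) * (s * s - 1)"
    by (simp add: algebra_simps)
  moreover have "8 dvd s * s - 1" using ss' by (intro z2_unit_square[of s s']) (simp add: mult.commute)
  ultimately have "(2 ^ 3 :: z2) dvd of_int (k * d - e * l)" by simp
  then have dvd: "8 dvd k * d - e * l" unfolding pow2_dvd_of_int_iff by simp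
  have ll: "8 dvd l * l - 1" using odd_square_mod_8[OF odd(2)] .
  \<comment> \<open>The signs \<open>d\<close> and \<open>e\<close> decide between the cases.
    Multiplying by \<open>l\<close>, whose square is 1 modulo 8, turns them into the residues 1 and
    7, that is, 1 and -1.\<close>
  consider "8 dvd k - l" | "8 dvd k + l"
    using d1 e dvd by (elim disjE) (auto dest: dvd_minus_iff[THEN iffD2] simp: algebra_simps)
  then show ?thesis
  proof cases
    case 1
    have eq: "k * l - 1 = (k - l) * l + (l * l - 1)" by (simp add: algebra_simps)
    have "8 dvd k * l - 1" unfolding eq by (intro dvd_add dvd_mult2 1 ll)
    then show ?thesis by (simp add: cong_iff_dvd_diff)
  next
    case 2
    have eq: "k * l - 7 = (k + l) * l - (l * l - 1) - 8" by (simp add: algebra_simps)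
    have "8 dvd k * l - 7" unfolding eq by (intro dvd_diff dvd_mult2 2 ll dvd_refl)
    then show ?thesis by (simp add: cong_iff_dvd_diff)
  qed
qed

lemma (in torus_group) completion_structure_ZG: "completion_structure ZG m pv"
  by (intro completion_structure.intro plain_group.intro completion_structure_axioms.intro group_ZG
      pv_hom pv_surj pv_kernel pv_commute pv_commuting_lifts)

theorem completions_of_torus_groups:
  fixes k l :: int
  assumes "group G" "pr \<in> iso G (sdp k)" "group G'" "pr' \<in> iso G' (sdp l)" "odd k" "odd l"
  shows "pronilpotent_completion G \<cong> pronilpotent_completion G'"
    and "right_exact_Z_completion G \<cong> right_exact_Z_completion G'
      \<Longrightarrow> [k * l = 1] (mod 8) \<or> [k * l = 7] (mod 8)"
proof -
  interpret G: torus_group G k pr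
    using assms by (intro torus_group.intro bar_group.intro plain_group.intro torus_group_axioms.intro)
  interpret G': torus_group G' l pr'
    using assms by (intro torus_group.intro bar_group.intro plain_group.intro torus_group_axioms.intro)
  have "sdp (of_int l :: z2) \<cong> pronilpotent_completion G'"
    using group.iso_sym[OF G'.compl_group G'.compl_iso] .
  then show "pronilpotent_completion G \<cong> pronilpotent_completion G'"
    using iso_trans[OF iso_trans[OF G.compl_iso sdp_z2_iso[OF assms(5,6)]]] by blast
  show "[k * l = 1] (mod 8) \<or> [k * l = 7] (mod 8)"
    if "right_exact_Z_completion G \<cong> right_exact_Z_completion G'"
    using iso_imp_cong_8[OF G.completion_structure_ZG G'.completion_structure_ZG that assms(5,6)] .
qed

section \<open>The fundamental group of the quotient by a free action\<close>

text \<open>A quotient space \<open>X\<close> carries no type class topology, so the covering space theory is applied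
  to the image of \<open>X\<close> under an injective continuous map \<open>h\<close> into a normed space.\<close>

locale free_quotient = plain_group \<Gamma> for \<Gamma> :: "'g monoid" +
  fixes act :: "'g \<Rightarrow> 'y::real_normed_vector \<Rightarrow> 'y" and X :: "'x topology"
    and p :: "'y \<Rightarrow> 'x" and h :: "'x \<Rightarrow> 'v::real_normed_vector" and K :: "'y set"
  assumes act_mult: "a \<in> carrier \<Gamma> \<Longrightarrow> b \<in> carrier \<Gamma> \<Longrightarrow> act (a \<otimes>\<^bsub>\<Gamma>\<^esub> b) y = act a (act b y)"
    and act_one: "act \<one>\<^bsub>\<Gamma>\<^esub> y = y"
    and act_continuous: "a \<in> carrier \<Gamma> \<Longrightarrow> continuous_on UNIV (act a)"
    and p_act: "a \<in> carrier \<Gamma> \<Longrightarrow> p (act a y) = p y"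
    and h_p_eq: "h (p y) = h (p y') \<Longrightarrow> \<exists>a\<in>carrier \<Gamma>. y' = act a y"
    and p_continuous: "continuous_map euclidean X p"
    and h_continuous: "continuous_map X euclidean h"
    and p_surj: "topspace X = range p"
    and K_compact: "compact K"
    and K_fundamental: "\<exists>a\<in>carrier \<Gamma>. act a y \<in> K"
    and wandering: "\<exists>U. open U \<and> y \<in> U \<and> (\<forall>a\<in>carrier \<Gamma>. \<forall>u\<in>U. act a u \<in> U \<longrightarrow> a = \<one>\<^bsub>\<Gamma>\<^esub>)"
begin

text \<open>The covering map, viewed with values in a normed space so that it has a type class
  topology on both sides.\<close>

definition q :: "'y \<Rightarrow> 'v" where "q y = h (p y)"

lemma q_act [simp]: "a \<in> carrier \<Gamma> \<Longrightarrow> q (act a y) = q y"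
  by (simp add: q_def p_act)

lemma q_eqD: "q y = q y' \<Longrightarrow> \<exists>a\<in>carrier \<Gamma>. y' = act a y"
  unfolding q_def by (rule h_p_eq)

lemma p_eq_of_q_eq: "q y = q y' \<Longrightarrow> p y = p y'"
  using q_eqD p_act by metis

lemma h_inj: "u \<in> topspace X \<Longrightarrow> v \<in> topspace X \<Longrightarrow> h u = h v \<Longrightarrow> u = v"
proof -
  assume "u \<in> topspace X" "v \<in> topspace X" and eq: "h u = h v"
  then obtain y y' where "u = p y" "v = p y'" using p_surj by blast
  then show ?thesis using p_eq_of_q_eq[of y y'] eq by (simp add: q_def)
qed

lemma h_range: "u \<in> topspace X \<Longrightarrow> h u \<in> range q"
  unfolding p_surj by (auto simp: q_def)

lemma q_continuous: "continuous_on UNIV q"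
  using continuous_map_compose[OF p_continuous h_continuous] by (simp add: q_def[abs_def] comp_def)

lemma act_inv [simp]:
  assumes "a \<in> carrier \<Gamma>"
  shows "act (inv\<^bsub>\<Gamma>\<^esub> a) (act a y) = y" "act a (act (inv\<^bsub>\<Gamma>\<^esub> a) y) = y"
  using assms by (simp_all flip: act_mult add: act_one)

lemma inv_mult_eq_one:
  assumes "a \<in> carrier \<Gamma>" "b \<in> carrier \<Gamma>" "inv\<^bsub>\<Gamma>\<^esub> b \<otimes>\<^bsub>\<Gamma>\<^esub> a = \<one>\<^bsub>\<Gamma>\<^esub>"
  shows "a = b"
proof -
  have "b \<otimes>\<^bsub>\<Gamma>\<^esub> (inv\<^bsub>\<Gamma>\<^esub> b \<otimes>\<^bsub>\<Gamma>\<^esub> a) = b" using assms by simp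
  then show ?thesis using assms(1,2) by (simp add: cancel_left)
qed

lemma act_free:
  assumes "a \<in> carrier \<Gamma>" "b \<in> carrier \<Gamma>" "act a y = act b y"
  shows "a = b"
proof -
  have "act (inv\<^bsub>\<Gamma>\<^esub> b \<otimes>\<^bsub>\<Gamma>\<^esub> a) y = y" using assms by (simp add: act_mult)
  then have "inv\<^bsub>\<Gamma>\<^esub> b \<otimes>\<^bsub>\<Gamma>\<^esub> a = \<one>\<^bsub>\<Gamma>\<^esub>"
    using wandering[of y] assms by (metis inv_closed m_closed)
  then show ?thesis using inv_mult_eq_one assms by blast
qed

lemma open_act:
  assumes "a \<in> carrier \<Gamma>" "open U" shows "open (act a ` U)"
proof -
  have "act a ` U = act (inv\<^bsub>\<Gamma>\<^esub> a) -` U"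
    using assms(1) by (force simp: image_iff)
  then show ?thesis
    using open_vimage[OF assms(2) act_continuous[of "inv\<^bsub>\<Gamma>\<^esub> a"]] assms(1) by simp
qed

lemma vimage_q_image: "q -` (q ` U) = (\<Union>a\<in>carrier \<Gamma>. act a ` U)"
proof (rule Set.set_eqI)
  fix y
  show "y \<in> q -` (q ` U) \<longleftrightarrow> y \<in> (\<Union>a\<in>carrier \<Gamma>. act a ` U)"
  proof
    assume "y \<in> q -` (q ` U)"
    then obtain u where u: "u \<in> U" "q u = q y" by auto
    then show "y \<in> (\<Union>a\<in>carrier \<Gamma>. act a ` U)" using q_eqD[OF u(2)] by blast
  qed auto
qed

text \<open>The complement of \<open>q ` U\<close> is the image of a compact part of the fundamental domain.\<close>

lemma q_open:
  assumes "open U" shows "openin (top_of_set (range q)) (q ` U)"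
proof -
  let ?W = "q -` (q ` U)"
  have W: "open ?W" unfolding vimage_q_image using open_act[OF _ assms] by blast
  have "compact (q ` (K - ?W))"
    using W K_compact q_continuous by (intro compact_continuous_image continuous_on_subset[OF q_continuous] compact_diff) auto
  then have "open (- q ` (K - ?W))" by (simp add: compact_imp_closed open_Compl)
  moreover have "q ` U = range q \<inter> - q ` (K - ?W)"
  proof -
    have "\<exists>y\<in>K. z = q y" if "z \<in> range q" for z
      using that K_fundamental q_act by (metis rangeE)
    then have "z \<in> q ` (K - ?W)" if "z \<in> range q" "z \<notin> q ` U" for z
      using that by (metis DiffI image_eqI vimageE)
    moreover have "z \<notin> q ` (K - ?W)" if z: "z \<in> q ` U" for z
    proof
      assume "z \<in> q ` (K - ?W)"
      then obtain y where "z = q y" "y \<notin> ?W" by blast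
      then show False using z by (metis vimageI)
    qed
    ultimately show ?thesis by auto
  qed
  ultimately show ?thesis by (auto simp: openin_open)
qed

text \<open>Over the image of a wandering open set \<open>U\<close> the sheets are the translates of
  \<open>U\<close>. Wandering makes them disjoint and the map injective on each.\<close>

lemma covering: "covering_space UNIV q (range q)"
proof (rule covering_spaceI[OF q_continuous refl])
  fix z assume "z \<in> range q"
  then obtain y where y: "z = q y" by blast
  obtain U where U: "open U" "y \<in> U" and one: "\<And>a u. a \<in> carrier \<Gamma> \<Longrightarrow> u \<in> U \<Longrightarrow> act a u \<in> U \<Longrightarrow> a = \<one>\<^bsub>\<Gamma>\<^esub>"
    using wandering[of y] by blast
  let ?v = "(\<lambda>a. act a ` U) ` carrier \<Gamma>"
  have same: "a = b" if "a \<in> carrier \<Gamma>" "b \<in> carrier \<Gamma>" "u \<in> U" "u' \<in> U" "act a u = act b u'" for a b u u'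
  proof -
    have "act (inv\<^bsub>\<Gamma>\<^esub> b \<otimes>\<^bsub>\<Gamma>\<^esub> a) u = u'" using that by (simp add: act_mult)
    then have "inv\<^bsub>\<Gamma>\<^esub> b \<otimes>\<^bsub>\<Gamma>\<^esub> a = \<one>\<^bsub>\<Gamma>\<^esub>" using one that by (metis inv_closed m_closed)
    then show ?thesis using inv_mult_eq_one that by blast
  qed
  have "pairwise disjnt ?v"
    unfolding pairwise_def disjnt_def using same by (smt (verit) disjoint_iff imageE)
  moreover have "\<exists>g. homeomorphism V (q ` U) q g" if "V \<in> ?v" for V
  proof -
    obtain a where a: "a \<in> carrier \<Gamma>" "V = act a ` U" using \<open>V \<in> ?v\<close> by blast
    have "inj_on q V"
    proof (rule inj_onI)
      fix w w' assume w: "w \<in> V" "w' \<in> V" "q w = q w'"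
      then obtain u u' where u: "u \<in> U" "u' \<in> U" "w = act a u" "w' = act a u'" using a by blast
      obtain b where b: "b \<in> carrier \<Gamma>" "w' = act b w" using q_eqD w(3) by blast
      have "act a u' = act (b \<otimes>\<^bsub>\<Gamma>\<^esub> a) u" using u b a by (simp add: act_mult)
      then have "a = b \<otimes>\<^bsub>\<Gamma>\<^esub> a" by (rule same[OF a(1) m_closed[OF b(1) a(1)] u(2,1)])
      then have "b = \<one>\<^bsub>\<Gamma>\<^esub>" using r_cancel_one'[OF a(1) b(1)] by blast
      then show "w = w'" using b by (simp add: act_one)
    qed
    moreover have "openin (top_of_set (q ` U)) (q ` S)" if S: "openin (top_of_set V) S" for S
    proof -
      have "open V" using open_act a U by blast
      then have "open S" "S \<subseteq> V" using S openin_open_trans openin_imp_subset by blast+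
      moreover have "q ` V = q ` U" using a by (auto simp: image_iff)
      ultimately show ?thesis
        using q_open[of S] by (metis image_mono openin_subset_trans image_subset_iff rangeI)
    qed
    moreover have "q ` V = q ` U" using a by (auto simp: image_iff)
    ultimately show ?thesis
      using homeomorphism_injective_open_map[OF continuous_on_subset[OF q_continuous]] by (metis subset_UNIV)
  qed
  moreover have "\<Union>?v = UNIV \<inter> q -` (q ` U)" using vimage_q_image by auto
  moreover have "\<forall>u\<in>?v. openin (top_of_set UNIV) u" using open_act U by simp
  ultimately show "\<exists>T. z \<in> T \<and> openin (top_of_set (range q)) T \<and>
      (\<exists>v. \<Union>v = UNIV \<inter> q -` T \<and> (\<forall>u\<in>v. openin (top_of_set UNIV) u) \<and> pairwise disjnt v \<and>
        (\<forall>u\<in>v. \<exists>g. homeomorphism u T q g))"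
    using U y q_open[OF U(1)] by (intro exI[of _ "q ` U"] conjI exI[of _ ?v]) auto
qed

context
  fixes x :: 'x and y0 :: 'y
  assumes y0: "p y0 = x"
begin

text \<open>The lift of \<open>g\<close> that starts at \<open>y0\<close> ends at the translate of
  \<open>y0\<close> by \<open>a\<close>; this relation becomes the isomorphism. The equation is
  required on the unit interval only, as loops are arbitrary functions outside it.\<close>

definition ends :: "(real \<Rightarrow> 'x) \<Rightarrow> 'g \<Rightarrow> bool" where
  "ends g a \<longleftrightarrow> a \<in> carrier \<Gamma> \<and>
    (\<exists>k. path k \<and> k 0 = y0 \<and> k 1 = act a y0 \<and> (\<forall>t\<in>{0..1}. g t = p (k t)))"

lemma lift_pathin:
  assumes "path k" "\<And>t. t \<in> {0..1} \<Longrightarrow> g t = p (k t)"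
  shows "pathin X g"
proof -
  have "continuous_map (top_of_set {0..1}) X (p \<circ> k)"
    using assms(1) p_continuous by (intro continuous_map_compose[of _ euclidean]) (auto simp: path_def)
  then show ?thesis
    unfolding pathin_def using assms(2) by (auto elim: continuous_map_eq)
qed

lemma ends_loop: "ends g a \<Longrightarrow> g \<in> loops X x"
  unfolding ends_def loops_def using lift_pathin y0 p_act by fastforce

text \<open>The path is lifted after composing with \<open>h\<close>; injectivity of
  \<open>h\<close> on \<open>X\<close> turns the lift of \<open>h \<circ> g\<close> into a lift of
  \<open>g\<close>.\<close>

lemma loop_ends:
  assumes g: "g \<in> loops X x" shows "\<exists>a. ends g a"
proof -
  have gc: "continuous_map (top_of_set {0..1}) X g" and g01: "g 0 = x" "g 1 = x"
    using g by (auto simp: loops_def pathin_def)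
  then have gX: "g t \<in> topspace X" if "t \<in> {0..1}" for t
    using that by (auto simp: continuous_map_def Pi_iff)
  have "path (h \<circ> g)"
    using continuous_map_compose[OF gc h_continuous] by (simp add: path_def)
  moreover have "path_image (h \<circ> g) \<subseteq> range q"
    using h_range[OF gX] by (auto simp: path_image_def)
  moreover have "pathstart (h \<circ> g) = q y0"
    using g01 y0 by (simp add: pathstart_def q_def)
  ultimately obtain k where k: "path k" "pathstart k = y0" "\<And>t. t \<in> {0..1} \<Longrightarrow> q (k t) = (h \<circ> g) t"
    using covering_space_lift_path_strong[OF covering, of y0 "h \<circ> g"] by auto
  have pk: "g t = p (k t)" if "t \<in> {0..1}" for t
    using k(3)[OF that] gX[OF that] p_surj by (intro h_inj) (auto simp: q_def)
  then have "p (k 1) = p y0" using g01 y0 by (metis atLeastAtMost_iff order_refl zero_le_one)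
  then obtain a where "a \<in> carrier \<Gamma>" "k 1 = act a y0" using h_p_eq by metis
  then show ?thesis unfolding ends_def using k pk by (auto simp: pathstart_def)
qed

text \<open>By monodromy, homotopic loops have lifts with the same end point; freeness of the action
  then determines the group element.\<close>

lemma ends_homotopic:
  assumes "ends g a" "ends g' a'" "(g, g') \<in> loop_homotopy X x"
  shows "a = a'"
proof -
  obtain k where k: "path k" "k 0 = y0" "k 1 = act a y0" "\<And>t. t \<in> {0..1} \<Longrightarrow> g t = p (k t)"
    using assms(1) by (auto simp: ends_def)
  obtain k' where k': "path k'" "k' 0 = y0" "k' 1 = act a' y0" "\<And>t. t \<in> {0..1} \<Longrightarrow> g' t = p (k' t)"
    using assms(2) by (auto simp: ends_def)
  have a: "a \<in> carrier \<Gamma>" "a' \<in> carrier \<Gamma>" using assms by (auto simp: ends_def)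
  have g: "g \<in> loops X x" "g' \<in> loops X x" using assms ends_loop by auto
  then have g01: "g 0 = x" "g 1 = x" by (auto simp: loops_def)
  have hc: "continuous_map X (top_of_set (range q)) h"
    using h_continuous h_range by (auto simp: continuous_map_in_subtopology)
  have hom: "homotopic_paths (range q) (h \<circ> g) (h \<circ> g')"
    unfolding homotopic_paths_def
  proof (rule homotopic_with_compose_continuous_map_left[OF _ hc])
    show "homotopic_with (\<lambda>r. r 0 = x \<and> r 1 = x) (top_of_set {0..1}) X g g'"
      using assms(3) by (simp add: loop_homotopy_def)
  qed (simp add: pathstart_def pathfinish_def g01)
  have "pathfinish k = pathfinish k'"
  proof (rule covering_space_monodromy[OF covering _ _ _ _ hom])
    show "path (h \<circ> g)" "path (h \<circ> g')"
      using continuous_map_compose[OF _ h_continuous, of "top_of_set {0..1}" g]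
        continuous_map_compose[OF _ h_continuous, of "top_of_set {0..1}" g'] g
      by (simp_all add: path_def loops_def pathin_def)
    show "path_image (h \<circ> g) \<subseteq> range q" "path_image (h \<circ> g') \<subseteq> range q"
      using k(4) k'(4) by (auto simp: path_image_def q_def)
  qed (use k k' in \<open>auto simp: q_def pathstart_def\<close>)
  then have "act a y0 = act a' y0" using k k' by (simp add: pathfinish_def)
  then show ?thesis using act_free a by blast
qed

text \<open>The lifts have common end points in a normed space, where the straight-line homotopy
  joins them; \<open>p\<close> projects it to \<open>X\<close>.\<close>

lemma homotopic_of_ends:
  assumes "ends g a" "ends g' a"
  shows "(g, g') \<in> loop_homotopy X x"
proof -
  obtain k where k: "path k" "k 0 = y0" "k 1 = act a y0" "\<And>t. t \<in> {0..1} \<Longrightarrow> g t = p (k t)"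
    using assms(1) by (auto simp: ends_def)
  obtain k' where k': "path k'" "k' 0 = y0" "k' 1 = act a y0" "\<And>t. t \<in> {0..1} \<Longrightarrow> g' t = p (k' t)"
    using assms(2) by (auto simp: ends_def)
  have a: "a \<in> carrier \<Gamma>" using assms by (auto simp: ends_def)
  have "homotopic_paths UNIV k k'"
    using k k' by (intro homotopic_paths_linear) (auto simp: pathstart_def pathfinish_def)
  then have "homotopic_with (\<lambda>r. pathstart r = y0 \<and> pathfinish r = act a y0) (top_of_set {0..1}) euclidean k k'"
    using k by (simp add: homotopic_paths_def pathstart_def pathfinish_def)
  then have "homotopic_with (\<lambda>r. r 0 = x \<and> r 1 = x) (top_of_set {0..1}) X (p \<circ> k) (p \<circ> k')"
    by (rule homotopic_with_compose_continuous_map_left[OF _ p_continuous])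
      (use y0 a p_act in \<open>auto simp: pathstart_def pathfinish_def\<close>)
  then have "homotopic_with (\<lambda>r. r 0 = x \<and> r 1 = x) (top_of_set {0..1}) X g g'"
    by (rule homotopic_with_eq) (use k k' in auto)
  then show ?thesis by (simp add: loop_homotopy_def)
qed

lemma loop_homotopy_loops: "(g, g') \<in> loop_homotopy X x \<Longrightarrow> g \<in> loops X x \<and> g' \<in> loops X x"
proof -
  assume "(g, g') \<in> loop_homotopy X x"
  then have "homotopic_with (\<lambda>r. r 0 = x \<and> r 1 = x) (top_of_set {0..1}) X g g'"
    by (simp add: loop_homotopy_def)
  from homotopic_with_imp_continuous_maps[OF this] homotopic_with_imp_property[OF this]
  show ?thesis by (simp add: loops_def pathin_def)
qed

text \<open>The second lift is translated by \<open>a\<close> to start where the first one stops. It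
  then ends at the translate of \<open>y0\<close> by the product in this order, so no opposite group
  appears.\<close>

lemma ends_join:
  assumes "ends g a" "ends g' a'"
  shows "ends (join_loops g g') (a \<otimes>\<^bsub>\<Gamma>\<^esub> a')"
proof -
  obtain k where k: "path k" "k 0 = y0" "k 1 = act a y0" "\<And>t. t \<in> {0..1} \<Longrightarrow> g t = p (k t)"
    using assms(1) by (auto simp: ends_def)
  obtain k' where k': "path k'" "k' 0 = y0" "k' 1 = act a' y0" "\<And>t. t \<in> {0..1} \<Longrightarrow> g' t = p (k' t)"
    using assms(2) by (auto simp: ends_def)
  have a: "a \<in> carrier \<Gamma>" "a' \<in> carrier \<Gamma>" using assms by (auto simp: ends_def)
  let ?k = "k +++ (act a \<circ> k')"
  have "path (act a \<circ> k')"
    using k'(1) a(1) act_continuous unfolding path_def by (intro continuous_on_compose) (auto intro: continuous_on_subset)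
  then have "path ?k" using k k' by (simp add: pathstart_def pathfinish_def)
  moreover have "?k 0 = y0" "?k 1 = act (a \<otimes>\<^bsub>\<Gamma>\<^esub> a') y0"
    using k k' a by (simp_all add: joinpaths_def act_mult)
  moreover have "join_loops g g' t = p (?k t)" if "t \<in> {0..1}" for t
    using that k(4)[of "2 * t"] k'(4)[of "2 * t - 1"] p_act[OF a(1)]
    by (auto simp: join_loops_def joinpaths_def)
  ultimately show ?thesis using a unfolding ends_def by blast
qed

lemma ends_ex:
  assumes "a \<in> carrier \<Gamma>" shows "\<exists>g. ends g a"
  unfolding ends_def using assms
  by (intro exI[of _ "\<lambda>t. p (linepath y0 (act a y0) t)"] conjI exI[of _ "linepath y0 (act a y0)"])
    (simp_all add: linepath_0' linepath_1')

lemma ends_const: "ends (\<lambda>_. x) \<one>\<^bsub>\<Gamma>\<^esub>"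
  unfolding ends_def using y0 act_one by (intro conjI exI[of _ "\<lambda>_. y0"]) (auto simp: path_def)

definition loop_class :: "'g \<Rightarrow> (real \<Rightarrow> 'x) set" where
  "loop_class a = {g. ends g a}"

lemma homotopy_class: "ends g a \<Longrightarrow> loop_homotopy X x `` {g} = loop_class a"
proof (rule Set.set_eqI)
  fix g' assume g: "ends g a"
  show "g' \<in> loop_homotopy X x `` {g} \<longleftrightarrow> g' \<in> loop_class a"
    using g ends_homotopic homotopic_of_ends loop_ends loop_homotopy_loops unfolding loop_class_def
    by (metis Image_singleton_iff mem_Collect_eq)
qed

lemma loop_class_bij: "bij_betw loop_class (carrier \<Gamma>) (carrier (fundamental_group X x))"
proof -
  have "inj_on loop_class (carrier \<Gamma>)"
  proof (rule inj_onI)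
    fix a b assume ab: "a \<in> carrier \<Gamma>" "b \<in> carrier \<Gamma>" "loop_class a = loop_class b"
    obtain g where g: "ends g a" using ends_ex ab(1) by blast
    then have "ends g b" using ab(3) by (auto simp: loop_class_def)
    then show "a = b" using ends_homotopic[OF g _ homotopic_of_ends[OF g g]] by blast
  qed
  moreover have "loop_class ` carrier \<Gamma> = loops X x // loop_homotopy X x"
  proof
    show "loop_class ` carrier \<Gamma> \<subseteq> loops X x // loop_homotopy X x"
    proof (rule image_subsetI)
      fix a assume "a \<in> carrier \<Gamma>"
      then obtain g where g: "ends g a" using ends_ex by blast
      show "loop_class a \<in> loops X x // loop_homotopy X x"
        unfolding homotopy_class[OF g, symmetric] by (rule quotientI[OF ends_loop[OF g]])
    qed
    show "loops X x // loop_homotopy X x \<subseteq> loop_class ` carrier \<Gamma>"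
    proof
      fix A assume "A \<in> loops X x // loop_homotopy X x"
      then obtain g where g: "g \<in> loops X x" "A = loop_homotopy X x `` {g}" by (auto simp: quotient_def)
      obtain a where a: "ends g a" using loop_ends g(1) by blast
      then have "a \<in> carrier \<Gamma>" by (simp add: ends_def)
      then show "A \<in> loop_class ` carrier \<Gamma>" using homotopy_class[OF a] g(2) by simp
    qed
  qed
  ultimately show ?thesis by (simp add: bij_betw_def fundamental_group_def)
qed

lemma loop_class_mult:
  assumes "a \<in> carrier \<Gamma>" "b \<in> carrier \<Gamma>"
  shows "loop_class a \<otimes>\<^bsub>fundamental_group X x\<^esub> loop_class b = loop_class (a \<otimes>\<^bsub>\<Gamma>\<^esub> b)"
proof -
  have "loop_homotopy X x `` {join_loops g g'} = loop_class (a \<otimes>\<^bsub>\<Gamma>\<^esub> b)"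
    if "g \<in> loop_class a" "g' \<in> loop_class b" for g g'
    using that ends_join homotopy_class by (simp add: loop_class_def)
  moreover have "loop_class a \<noteq> {}" "loop_class b \<noteq> {}"
    using assms ends_ex by (auto simp: loop_class_def)
  ultimately have "(\<Union>g\<in>loop_class a. \<Union>g'\<in>loop_class b. loop_homotopy X x `` {join_loops g g'})
      = loop_class (a \<otimes>\<^bsub>\<Gamma>\<^esub> b)" by auto
  then show ?thesis by (simp add: fundamental_group_def)
qed

lemma fundamental_group_iso:
  "group (fundamental_group X x) \<and> (\<exists>f. f \<in> iso (fundamental_group X x) \<Gamma>)"
proof -
  let ?P = "fundamental_group X x"
  have carr: "carrier ?P = loop_class ` carrier \<Gamma>" using loop_class_bij by (simp add: bij_betw_def)
  have one: "\<one>\<^bsub>?P\<^esub> = loop_class \<one>\<^bsub>\<Gamma>\<^esub>"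
    using homotopy_class[OF ends_const] by (simp add: fundamental_group_def)
  have group: "group ?P"
  proof (rule groupI)
    fix u assume "u \<in> carrier ?P"
    then obtain a where a: "a \<in> carrier \<Gamma>" "u = loop_class a" by (auto simp: carr)
    then show "\<one>\<^bsub>?P\<^esub> \<otimes>\<^bsub>?P\<^esub> u = u" by (simp add: one loop_class_mult)
    have "loop_class (inv\<^bsub>\<Gamma>\<^esub> a) \<otimes>\<^bsub>?P\<^esub> u = \<one>\<^bsub>?P\<^esub>" using a by (simp add: one loop_class_mult)
    then show "\<exists>v\<in>carrier ?P. v \<otimes>\<^bsub>?P\<^esub> u = \<one>\<^bsub>?P\<^esub>" using a by (auto simp: carr)
  qed (auto simp: carr one loop_class_mult m_assoc)
  have "loop_class \<in> iso \<Gamma> ?P"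
    using loop_class_bij by (auto simp: iso_def hom_def loop_class_mult carr)
  then show ?thesis using group iso_set_sym by blast
qed

end

end

section \<open>The mapping torus as a quotient of \<open>\<real> \<times> \<real>\<^sup>2\<close>\<close>

lemma topspace_quotient_topology:
  assumes "r \<subseteq> topspace X \<times> topspace X"
  shows "topspace (quotient_topology X r) = topspace X // (r \<union> r\<inverse>)\<^sup>*"
proof
  show "topspace (quotient_topology X r) \<subseteq> topspace X // (r \<union> r\<inverse>)\<^sup>*"
    using openin_topspace[of "quotient_topology X r"] openin_quotient_topology[OF assms] by blast
  have closed: "b \<in> topspace X" if "(a, b) \<in> (r \<union> r\<inverse>)\<^sup>*" "a \<in> topspace X" for a b
    using that by (induction rule: rtrancl_induct) (use assms in auto)
  then have "\<Union>(topspace X // (r \<union> r\<inverse>)\<^sup>*) = topspace X"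
    by (auto simp: quotient_def)
  then have "openin (quotient_topology X r) (topspace X // (r \<union> r\<inverse>)\<^sup>*)"
    by (simp add: openin_quotient_topology[OF assms])
  then show "topspace X // (r \<union> r\<inverse>)\<^sup>* \<subseteq> topspace (quotient_topology X r)"
    by (rule openin_subset)
qed

lemma equiv_rtrancl_Un_converse: "equiv UNIV ((r \<union> r\<inverse>)\<^sup>*)"
  by (intro equivI refl_rtrancl trans_rtrancl sym_rtrancl sym_Un_converse) simp

lemma continuous_map_quotient_class:
  assumes "r \<subseteq> topspace X \<times> topspace X"
  shows "continuous_map X (quotient_topology X r) (\<lambda>x. (r \<union> r\<inverse>)\<^sup>* `` {x})"
  unfolding continuous_map_def
proof (intro conjI allI impI)
  let ?E = "(r \<union> r\<inverse>)\<^sup>*"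
  show "(\<lambda>x. ?E `` {x}) \<in> topspace X \<rightarrow> topspace (quotient_topology X r)"
    by (auto simp: topspace_quotient_topology[OF assms] intro: quotientI)
  fix U assume "openin (quotient_topology X r) U"
  then have U: "U \<subseteq> topspace X // ?E" "openin X (\<Union>U)"
    by (simp_all add: openin_quotient_topology[OF assms])
  have "{x \<in> topspace X. ?E `` {x} \<in> U} = \<Union>U"
  proof (intro equalityI subsetI)
    fix x assume "x \<in> {x \<in> topspace X. ?E `` {x} \<in> U}"
    then show "x \<in> \<Union>U" by blast
  next
    fix x assume x: "x \<in> \<Union>U"
    then obtain C where C: "C \<in> U" "x \<in> C" by blast
    then obtain a where a: "C = ?E `` {a}" using U(1) by (auto simp: quotient_def)
    then have "?E `` {a} = ?E `` {x}"
      using equiv_class_eq[OF equiv_rtrancl_Un_converse[of r], of a x] C by blast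
    then show "x \<in> {x \<in> topspace X. ?E `` {x} \<in> U}"
      using C a openin_subset[OF U(2)] x by auto
  qed
  then show "openin X {x \<in> topspace X. ?E `` {x} \<in> U}" using U by simp
qed

text \<open>The universal property. That \<open>g\<close> is constant on classes follows from
  \<open>f\<close> being a function of the class.\<close>

lemma continuous_map_from_quotient:
  assumes "r \<subseteq> topspace X \<times> topspace X" and g: "continuous_map X Y g"
    and f: "\<And>x. x \<in> topspace X \<Longrightarrow> f ((r \<union> r\<inverse>)\<^sup>* `` {x}) = g x"
  shows "continuous_map (quotient_topology X r) Y f"
  unfolding continuous_map_def
proof (intro conjI allI impI)
  let ?E = "(r \<union> r\<inverse>)\<^sup>*"
  show "f \<in> topspace (quotient_topology X r) \<rightarrow> topspace Y"
    using g f by (auto simp: topspace_quotient_topology[OF assms(1)] quotient_def continuous_map_def Pi_iff)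
  fix V assume V: "openin Y V"
  have closed: "b \<in> topspace X" if "(a, b) \<in> ?E" "a \<in> topspace X" for a b
    using that by (induction rule: rtrancl_induct) (use assms(1) in auto)
  have same: "g b = g a" if "(a, b) \<in> ?E" "a \<in> topspace X" for a b
    using f[OF that(2)] f[OF closed[OF that]] equiv_class_eq[OF equiv_rtrancl_Un_converse[of r] that(1)] by simp
  have "\<Union>{C \<in> topspace X // ?E. f C \<in> V} = {x \<in> topspace X. g x \<in> V}"
  proof (intro equalityI subsetI)
    fix x assume "x \<in> \<Union>{C \<in> topspace X // ?E. f C \<in> V}"
    then obtain a where a: "a \<in> topspace X" "(a, x) \<in> ?E" "f (?E `` {a}) \<in> V"
      by (auto simp: quotient_def)
    then show "x \<in> {x \<in> topspace X. g x \<in> V}" using same closed f by simp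
  next
    fix x assume "x \<in> {x \<in> topspace X. g x \<in> V}"
    then have "?E `` {x} \<in> {C \<in> topspace X // ?E. f C \<in> V}"
      using f by (auto intro: quotientI)
    then show "x \<in> \<Union>{C \<in> topspace X // ?E. f C \<in> V}" by blast
  qed
  then show "openin (quotient_topology X r) {C \<in> topspace (quotient_topology X r). f C \<in> V}"
    using g V by (simp add: openin_quotient_topology[OF assms(1)] topspace_quotient_topology[OF assms(1)] continuous_map_def)
qed

section \<open>The torus and the integral powers of the matrix\<close>

definition lat :: "real^2 \<Rightarrow> bool" where
  "lat v \<longleftrightarrow> (\<forall>i. v $ i \<in> \<int>)"

lemma lat_2: "lat v \<longleftrightarrow> v $ 1 \<in> \<int> \<and> v $ 2 \<in> \<int>"
  by (simp add: lat_def forall_2)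

lemma vec2_eq_iff: "v = w \<longleftrightarrow> v $ 1 = w $ 1 \<and> v $ 2 = w $ 2" for v w :: "real^2"
  by (simp add: vec_eq_iff forall_2)

text \<open>The closed form of the \<open>n\<close>-th power of \<open>matrix_a m\<close> for all
  integers \<open>n\<close>, with the same formula as the action in \<open>sdp\<close>.\<close>

definition apow :: "int \<Rightarrow> int \<Rightarrow> real^2 \<Rightarrow> real^2" where
  "apow m n v = (\<chi> i. if i = 1 then sg n * (v $ 1 - of_int n * of_int m * v $ 2) else sg n * v $ 2)"

lemma apow_nth [simp]:
  "apow m n v $ 1 = sg n * (v $ 1 - of_int n * of_int m * v $ 2)" "apow m n v $ 2 = sg n * v $ 2"
  by (simp_all add: apow_def)

lemma apow_add: "apow m (n + n') v = apow m n (apow m n' v)"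
  by (simp add: vec2_eq_iff sg_add algebra_simps)

lemma apow_0 [simp]: "apow m 0 v = v"
  by (simp add: vec2_eq_iff)

lemma apow_plus: "apow m n (v + w) = apow m n v + apow m n w"
  by (simp add: vec2_eq_iff algebra_simps)

lemma apow_diff: "apow m n (v - w) = apow m n v - apow m n w"
  by (simp add: vec2_eq_iff algebra_simps)

lemma sg_Ints [simp]: "(sg n :: real) \<in> \<int>"
  by (simp add: sg_def)

lemma lat_apow: "lat v \<Longrightarrow> lat (apow m n v)"
  by (simp add: lat_2)

lemma continuous_on_apow: "continuous_on S (apow m n)"
proof -
  have "continuous_on S (\<lambda>v :: real^2. if i = 1 then sg n * (v $ 1 - of_int n * of_int m * v $ 2) else sg n * v $ 2)"
    for i :: 2
    by (cases "i = 1") (auto intro!: continuous_intros)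
  then show ?thesis unfolding apow_def[abs_def] by (rule continuous_on_vec_lambda)
qed

lemma matrix_a_mult: "matrix_a m *v v = apow m 1 v"
  by (simp add: vec2_eq_iff matrix_a_def matrix_vector_mult_def sum_2)

definition coset :: "real^2 \<Rightarrow> (real^2) set" where
  "coset v = {w. lat (w - v)}"

lemma coset_eq_iff: "coset v = coset w \<longleftrightarrow> lat (w - v)"
proof
  assume "coset v = coset w"
  then have "w \<in> coset v" by (simp add: coset_def lat_2)
  then show "lat (w - v)" by (simp add: coset_def)
next
  assume *: "lat (w - v)"
  have "lat (u - v) \<longleftrightarrow> lat (u - w)" for u
  proof -
    have eq: "u - v = (u - w) + (w - v)" "u - w = (u - v) - (w - v)" by simp_all
    show ?thesis
      using * unfolding lat_2 by (metis eq Ints_add Ints_diff vector_add_component vector_minus_component)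
  qed
  then show "coset v = coset w" by (simp add: coset_def)
qed

definition lat_rel :: "((real^2) \<times> (real^2)) set" where
  "lat_rel = {(v, w). \<forall>i. (w - v) $ i \<in> \<int>}"

lemma lat_rel_closure: "(lat_rel \<union> lat_rel\<inverse>)\<^sup>* = lat_rel"
proof -
  have rel: "(v, w) \<in> lat_rel \<longleftrightarrow> coset v = coset w" for v w
    by (simp add: coset_eq_iff lat_rel_def lat_def)
  show ?thesis
  proof (intro equalityI subrelI)
    fix v w assume "(v, w) \<in> (lat_rel \<union> lat_rel\<inverse>)\<^sup>*"
    then show "(v, w) \<in> lat_rel"
      by (induction rule: rtrancl_induct) (auto simp: rel)
  qed auto
qed

lemma lat_rel_class: "lat_rel `` {v} = coset v"
  by (auto simp: lat_rel_def coset_def lat_def)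

lemma torus_eq: "torus = quotient_topology euclidean lat_rel"
  by (simp add: torus_def lat_rel_def)

lemma lat_rel_subset: "lat_rel \<subseteq> topspace euclidean \<times> topspace euclidean"
  by simp

lemma topspace_torus: "topspace torus = range coset"
  by (auto simp: torus_eq topspace_quotient_topology[OF lat_rel_subset] lat_rel_closure quotient_def lat_rel_class)

lemma continuous_map_coset: "continuous_map euclidean torus coset"
  using continuous_map_quotient_class[OF lat_rel_subset]
  by (simp add: torus_eq lat_rel_closure lat_rel_class)

lemma continuous_map_from_torus:
  "continuous_map euclidean Y g \<Longrightarrow> (\<And>v. f (coset v) = g v) \<Longrightarrow> continuous_map torus Y f"
  unfolding torus_eq by (rule continuous_map_from_quotient[OF lat_rel_subset]) (simp_all add: lat_rel_closure lat_rel_class)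

lemma torus_map_coset: "torus_map (matrix_a m) (coset v) = coset (apow m 1 v)"
proof -
  have "u \<in> (\<lambda>v. apow m 1 v) ` coset v \<longleftrightarrow> u \<in> coset (apow m 1 v)" for u
  proof
    assume "u \<in> coset (apow m 1 v)"
    then have "lat (apow m (- 1) (u - apow m 1 v))" by (simp add: coset_def lat_apow)
    moreover have "apow m (- 1) (u - apow m 1 v) = apow m (- 1) u - v"
      by (simp only: apow_diff flip: apow_add) simp
    ultimately have "apow m (- 1) u \<in> coset v" by (simp add: coset_def)
    moreover have "u = apow m 1 (apow m (- 1) u)" by (simp flip: apow_add)
    ultimately show "u \<in> (\<lambda>v. apow m 1 v) ` coset v" by blast
  qed (auto simp: coset_def lat_apow simp flip: apow_diff)
  then show ?thesis by (auto simp: torus_map_def matrix_a_mult)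
qed

lemma continuous_map_torus_map: "continuous_map torus torus (torus_map (matrix_a m))"
proof (rule continuous_map_from_torus)
  show "continuous_map euclidean torus (coset \<circ> apow m 1)"
    using continuous_on_apow by (intro continuous_map_compose[OF _ continuous_map_coset]) simp
qed (simp add: torus_map_coset)

text \<open>The standard embedding of the torus as a product of two unit circles; periodicity of
  \<open>cis\<close> makes the choice of \<open>v\<close> immaterial.\<close>

definition tor_emb :: "(real^2) set \<Rightarrow> complex \<times> complex" where
  "tor_emb C = (let v = (SOME v. v \<in> C) in (cis (2 * pi * v $ 1), cis (2 * pi * v $ 2)))"

lemma cis_eq_iff: "cis (2 * pi * a) = cis (2 * pi * b) \<longleftrightarrow> a - b \<in> \<int>"
proof -
  have "cis (2 * pi * a) = cis (2 * pi * b) \<longleftrightarrow> (\<exists>n::int. 2 * pi * a = 2 * pi * b + 2 * pi * of_int n)"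
    using sin_cos_eq_iff[of "2 * pi * a" "2 * pi * b"] by (auto simp: complex_eq_iff)
  also have "\<dots> \<longleftrightarrow> (\<exists>n::int. a - b = of_int n)"
  proof -
    have "2 * pi * a = 2 * pi * b + 2 * pi * of_int n \<longleftrightarrow> 2 * pi * (a - b) = 2 * pi * of_int n" for n :: int
      by (simp add: algebra_simps)
    then show ?thesis by simp
  qed
  finally show ?thesis by (auto simp: Ints_def)
qed

lemma tor_emb_coset: "tor_emb (coset v) = (cis (2 * pi * v $ 1), cis (2 * pi * v $ 2))"
proof -
  have "(SOME w. w \<in> coset v) \<in> coset v"
    by (rule someI[of _ v]) (simp add: coset_def lat_2)
  then show ?thesis by (simp add: tor_emb_def Let_def cis_eq_iff coset_def lat_2)
qed

lemma tor_emb_inj: "tor_emb (coset v) = tor_emb (coset w) \<longleftrightarrow> coset v = coset w"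
  using Ints_minus[of "v $ 1 - w $ 1"] Ints_minus[of "v $ 2 - w $ 2"]
    Ints_minus[of "w $ 1 - v $ 1"] Ints_minus[of "w $ 2 - v $ 2"]
  by (auto simp: tor_emb_coset cis_eq_iff coset_eq_iff lat_2)

lemma continuous_map_tor_emb: "continuous_map torus euclidean tor_emb"
proof (rule continuous_map_from_torus)
  show "continuous_map euclidean euclidean (\<lambda>v :: real^2. (cis (2 * pi * v $ 1), cis (2 * pi * v $ 2)))"
    by (auto intro!: continuous_intros)
qed (rule tor_emb_coset)

section \<open>The cylinder, the gluing and the covering map\<close>

definition cyl :: "(real \<times> (real^2) set) topology" where
  "cyl = prod_topology (top_of_set {0..1}) torus"

definition glue :: "int \<Rightarrow> ((real \<times> (real^2) set) \<times> (real \<times> (real^2) set)) set" where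
  "glue m = {((1, C), (0, torus_map (matrix_a m) C)) |C. C \<in> topspace torus}"

definition glue_class :: "int \<Rightarrow> real \<times> (real^2) set \<Rightarrow> (real \<times> (real^2) set) set" where
  "glue_class m a = (glue m \<union> (glue m)\<inverse>)\<^sup>* `` {a}"

lemma manifold_X_eq: "manifold_X m = quotient_topology cyl (glue m)"
  by (simp add: manifold_X_def mapping_torus_def cyl_def glue_def)

lemma topspace_cyl: "topspace cyl = {0..1} \<times> range coset"
  by (simp add: cyl_def topspace_torus)

lemma glue_subset: "glue m \<subseteq> topspace cyl \<times> topspace cyl"
  by (auto simp: glue_def topspace_cyl topspace_torus torus_map_coset)

lemma topspace_manifold_X: "topspace (manifold_X m) = glue_class m ` topspace cyl"
  by (auto simp: manifold_X_eq topspace_quotient_topology[OF glue_subset] quotient_def glue_class_def)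

lemma continuous_map_glue_class: "continuous_map cyl (manifold_X m) (glue_class m)"
  using continuous_map_quotient_class[OF glue_subset] by (simp add: manifold_X_eq glue_class_def[abs_def])

lemma glue_class_eq: "glue_class m (1, coset v) = glue_class m (0, coset (apow m 1 v))"
proof -
  have "((1, coset v), (0, coset (apow m 1 v))) \<in> glue m"
    by (auto simp: glue_def topspace_torus simp flip: torus_map_coset)
  then show ?thesis
    unfolding glue_class_def by (intro equiv_class_eq[OF equiv_rtrancl_Un_converse]) blast
qed

definition cover :: "int \<Rightarrow> real \<times> (real^2) \<Rightarrow> (real \<times> (real^2) set) set" where
  "cover m y = glue_class m (frac (fst y), coset (apow m \<lfloor>fst y\<rfloor> (snd y)))"

text \<open>On a closed strip one formula holds up to and including the upper boundary, where the
  floor jumps: there the gluing identifies the two descriptions. Continuity can then be pasted from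
  closed strips.\<close>

lemma cover_strip:
  assumes "of_int n \<le> s" "s \<le> of_int n + 1"
  shows "cover m (s, w) = glue_class m (s - of_int n, coset (apow m n w))"
proof (cases "s = of_int n + 1")
  case True
  then have fl: "\<lfloor>s\<rfloor> = 1 + n" and fr: "frac s = 0" by (simp_all add: frac_def)
  have "cover m (s, w) = glue_class m (0, coset (apow m (1 + n) w))"
    by (simp only: cover_def fst_conv snd_conv fl fr)
  also have "\<dots> = glue_class m (1, coset (apow m n w))"
    by (simp only: glue_class_eq apow_add)
  finally show ?thesis using True by simp
next
  case False
  then have "\<lfloor>s\<rfloor> = n" using assms by (simp add: floor_unique)
  then show ?thesis by (simp add: cover_def frac_def)
qed

lemma continuous_map_cover: "continuous_map euclidean (manifold_X m) (cover m)"
proof (rule pasting_lemma_locally_finite[where I = UNIV and T = "\<lambda>n::int. {of_int n..of_int n + 1} \<times> UNIV" and f = "\<lambda>_. cover m"])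
  fix y :: "real \<times> (real^2)"
  \<comment> \<open>An open slab of height 2 meets finitely many unit strips, which gives local
    finiteness.\<close>
  have sub: "{n::int. (({of_int n..of_int n + 1} \<times> UNIV) \<inter> ({fst y - 1<..<fst y + 1} \<times> UNIV) :: (real \<times> (real^2)) set) \<noteq> {}}
      \<subseteq> {\<lfloor>fst y\<rfloor> - 2..\<lfloor>fst y\<rfloor> + 2}"
  proof
    fix n assume "n \<in> {n::int. (({of_int n..of_int n + 1} \<times> UNIV) \<inter> ({fst y - 1<..<fst y + 1} \<times> UNIV) :: (real \<times> (real^2)) set) \<noteq> {}}"
    then obtain t where "of_int n \<le> t" "t \<le> of_int n + 1" "fst y - 1 < t" "t < fst y + 1" by auto
    then show "n \<in> {\<lfloor>fst y\<rfloor> - 2..\<lfloor>fst y\<rfloor> + 2}" by (auto; linarith)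
  qed
  show "\<exists>V. openin euclidean V \<and> y \<in> V \<and>
      finite {i::int \<in> UNIV. ({of_int i..of_int i + 1} \<times> UNIV) \<inter> V \<noteq> {}}"
    by (rule exI[of _ "{fst y - 1<..<fst y + 1} \<times> UNIV"])
      (use finite_subset[OF sub] in \<open>auto simp: mem_Times_iff intro!: open_Times\<close>)
  show "\<exists>j::int. j \<in> UNIV \<and> y \<in> {of_int j..of_int j + 1} \<times> UNIV \<and> cover m y = cover m y"
    by (rule exI[of _ "\<lfloor>fst y\<rfloor>"]) (simp add: mem_Times_iff real_of_int_floor_add_one_ge)
next
  fix n :: int
  show "closedin euclidean ({of_int n..of_int n + 1} \<times> UNIV :: (real \<times> (real^2)) set)"
    by (auto intro!: closed_Times)
  let ?S = "{of_int n..of_int n + 1} \<times> UNIV :: (real \<times> (real^2)) set"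
  have "continuous_map (top_of_set ?S) cyl (\<lambda>y. (fst y - of_int n, (coset \<circ> (\<lambda>y. apow m n (snd y))) y))"
    unfolding cyl_def continuous_map_paired
  proof
    show "continuous_map (top_of_set ?S) (top_of_set {0..1}) (\<lambda>y. fst y - of_int n)"
      by (auto simp: continuous_map_in_subtopology intro!: continuous_intros)
    have "continuous_on ?S (\<lambda>y. apow m n (snd y))"
      by (rule continuous_on_compose2[OF continuous_on_apow[of UNIV]]) (auto intro!: continuous_intros)
    then show "continuous_map (top_of_set ?S) torus (coset \<circ> (\<lambda>y. apow m n (snd y)))"
      by (intro continuous_map_compose[OF _ continuous_map_coset]) simp
  qed
  then have "continuous_map (top_of_set ?S) (manifold_X m)
      (glue_class m \<circ> (\<lambda>y. (fst y - of_int n, (coset \<circ> (\<lambda>y. apow m n (snd y))) y)))"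
    by (rule continuous_map_compose[OF _ continuous_map_glue_class])
  then show "continuous_map (top_of_set ?S) (manifold_X m) (cover m)"
    by (rule continuous_map_eq) (auto simp: cover_strip)
qed simp

lemma range_cover: "topspace (manifold_X m) = range (cover m)"
proof
  show "range (cover m) \<subseteq> topspace (manifold_X m)"
    using continuous_map_image_subset_topspace[OF continuous_map_cover, of m] by auto
  show "topspace (manifold_X m) \<subseteq> range (cover m)"
  proof
    fix c assume "c \<in> topspace (manifold_X m)"
    then obtain s v where "0 \<le> s" "s \<le> 1" "c = glue_class m (s, coset v)"
      by (auto simp: topspace_manifold_X topspace_cyl)
    then have "c = cover m (s, v)" using cover_strip[of 0 s m v] by simp
    then show "c \<in> range (cover m)" by blast
  qed
qed

text \<open>The second component determines the point of the torus away from the glued fibre, the third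
  one on that fibre; both respect the gluing.\<close>

definition cyl_emb :: "int \<Rightarrow> real \<times> (real^2) set \<Rightarrow> complex \<times> (complex \<times> complex) \<times> (complex \<times> complex)" where
  "cyl_emb m a = (cis (2 * pi * fst a), sin (pi * fst a) *\<^sub>R tor_emb (snd a),
     max 0 (cos (pi * fst a)) *\<^sub>R tor_emb (snd a)
     + max 0 (- cos (pi * fst a)) *\<^sub>R tor_emb (torus_map (matrix_a m) (snd a)))"

text \<open>Descends \<open>cyl_emb\<close> to the quotient; the value does not depend on the chosen
  point since \<open>cyl_emb\<close> agrees on glued points.\<close>

definition emb :: "int \<Rightarrow> (real \<times> (real^2) set) set \<Rightarrow> complex \<times> (complex \<times> complex) \<times> (complex \<times> complex)" where
  "emb m c = cyl_emb m (SOME a. a \<in> c)"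

lemma cyl_emb_glue: "(a, b) \<in> glue m \<Longrightarrow> cyl_emb m a = cyl_emb m b"
  by (auto simp: glue_def cyl_emb_def cis_eq_iff[of 1 0, simplified])

lemma emb_glue_class: "emb m (glue_class m a) = cyl_emb m a"
proof -
  have "cyl_emb m b = cyl_emb m a" if "(a, b) \<in> (glue m \<union> (glue m)\<inverse>)\<^sup>*" for b
    using that by (induction rule: rtrancl_induct) (auto dest: cyl_emb_glue)
  moreover have "(SOME b. b \<in> glue_class m a) \<in> glue_class m a"
    by (rule someI[of _ a]) (simp add: glue_class_def)
  then have "(a, SOME b. b \<in> glue_class m a) \<in> (glue m \<union> (glue m)\<inverse>)\<^sup>*"
    by (simp only: glue_class_def Image_singleton_iff)
  ultimately show ?thesis unfolding emb_def by blast
qed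

lemma euclidean_prod: "prod_topology euclidean euclidean = euclidean"
  unfolding topology_eq openin_prod_topology_alt open_openin[symmetric] open_prod_def
  by (simp add: Ball_def split_paired_All)

lemma continuous_map_emb: "continuous_map (manifold_X m) euclidean (emb m)"
  unfolding manifold_X_eq
proof (rule continuous_map_from_quotient[OF glue_subset])
  have fst: "continuous_map cyl euclideanreal fst"
    unfolding cyl_def using continuous_map_fst[of "top_of_set {0..1::real}" torus]
    by (simp add: continuous_map_in_subtopology)
  have snd: "continuous_map cyl torus snd"
    unfolding cyl_def by (rule continuous_map_snd)
  have "continuous_map cyl (prod_topology euclidean (prod_topology euclidean euclidean))
      (\<lambda>a. (fst a, (tor_emb \<circ> snd) a, (tor_emb \<circ> (torus_map (matrix_a m) \<circ> snd)) a))"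
    unfolding continuous_map_paired
    by (intro conjI fst continuous_map_compose[OF snd] continuous_map_compose[OF _ continuous_map_tor_emb]
        continuous_map_torus_map continuous_map_tor_emb)
  then have 1: "continuous_map cyl euclidean
      (\<lambda>a. (fst a, (tor_emb \<circ> snd) a, (tor_emb \<circ> (torus_map (matrix_a m) \<circ> snd)) a))"
    by (simp add: euclidean_prod)
  have 2: "continuous_map euclidean euclidean (\<lambda>(s::real, u :: complex \<times> complex, v :: complex \<times> complex).
      (cis (2 * pi * s), sin (pi * s) *\<^sub>R u, max 0 (cos (pi * s)) *\<^sub>R u + max 0 (- cos (pi * s)) *\<^sub>R v))"
    by (auto simp: case_prod_beta intro!: continuous_intros)
  show "continuous_map cyl euclidean (cyl_emb m)"
    using continuous_map_compose[OF 1 2] by (simp add: comp_def cyl_emb_def[abs_def])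
qed (simp add: emb_glue_class flip: glue_class_def)

section \<open>Deck transformations and the fundamental group of the mapping torus\<close>

definition deck :: "int \<Rightarrow> int \<times> int \<times> int \<Rightarrow> real \<times> (real^2) \<Rightarrow> real \<times> (real^2)" where
  "deck m g y = (fst y - of_int (fst g),
     apow m (fst g) (snd y) + vector [of_int (fst (snd g)), of_int (snd (snd g))])"

lemma deck_mult: "deck m (a \<otimes>\<^bsub>sdp m\<^esub> b) y = deck m a (deck m b y)"
proof -
  obtain n x y' n' x' y'' where "a = (n, x, y')" "b = (n', x', y'')" by (metis prod_cases3)
  then show ?thesis
    by (simp add: deck_def mult_sdp vec2_eq_iff apow_add of_int_sg algebra_simps)
qed

lemma deck_one: "deck m (0, 0, 0) y = y"
  by (simp add: deck_def vec2_eq_iff prod_eq_iff)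

lemma continuous_on_deck: "continuous_on UNIV (deck m a)"
  unfolding deck_def[abs_def]
  by (auto intro!: continuous_intros continuous_on_compose2[OF continuous_on_apow[of UNIV]])

lemma cover_deck: "cover m (deck m a y) = cover m y"
proof -
  obtain n x z where a: "a = (n, x, z)" by (metis prod_cases3)
  obtain s w where y: "y = (s, w)" by (metis surj_pair)
  let ?u = "vector [of_int x, of_int z] :: real^2"
  have fl: "\<lfloor>s - of_int n\<rfloor> = \<lfloor>s\<rfloor> - n" "frac (s - of_int n) = frac s" by (simp_all add: frac_def)
  \<comment> \<open>Lowering the height by \<open>n\<close> lowers the exponent in
    \<open>cover\<close> by \<open>n\<close>, which cancels the power of the matrix applied by
    \<open>deck\<close>; only a lattice vector remains.\<close>
  have "apow m (\<lfloor>s\<rfloor> - n) (apow m n w + ?u) = apow m \<lfloor>s\<rfloor> w + apow m (\<lfloor>s\<rfloor> - n) ?u"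
    by (simp add: apow_plus flip: apow_add)
  moreover have "lat (apow m (\<lfloor>s\<rfloor> - n) ?u)" by (rule lat_apow) (simp add: lat_2)
  ultimately have "coset (apow m \<lfloor>s\<rfloor> w) = coset (apow m (\<lfloor>s\<rfloor> - n) (apow m n w + ?u))"
    unfolding coset_eq_iff by simp
  then show ?thesis by (simp add: a y deck_def cover_def fl)
qed

lemma emb_cover_eq:
  assumes "emb m (cover m y) = emb m (cover m y')"
  shows "\<exists>a. y' = deck m a y"
proof -
  obtain s w s' w' where y: "y = (s, w)" "y' = (s', w')" by (metis surj_pair)
  define v v' where "v = apow m \<lfloor>s\<rfloor> w" and "v' = apow m \<lfloor>s'\<rfloor> w'"
  have eq: "cyl_emb m (frac s, coset v) = cyl_emb m (frac s', coset v')"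
    using assms by (simp add: y cover_def emb_glue_class v_def v'_def)
  then have "frac s - frac s' \<in> \<int>" by (simp add: cyl_emb_def cis_eq_iff)
  then obtain z where z: "frac s - frac s' = of_int z" by (elim Ints_cases)
  then have "of_int z < (1 :: real)" "of_int z > (- 1 :: real)"
    using frac_lt_1[of s] frac_lt_1[of s'] frac_ge_0[of s] frac_ge_0[of s'] by linarith+
  then have "z = 0" by linarith
  then have fr: "frac s = frac s'" using z by simp
  \<comment> \<open>Away from the glued fibre \<open>sin (pi * frac s)\<close> is positive and can
    be cancelled. On that fibre the third component is \<open>tor_emb\<close> itself, since its
    weights are 1 and 0 at height 0.\<close>
  have "tor_emb (coset v) = tor_emb (coset v')"
  proof (cases "frac s = 0")
    case True
    then have "cyl_emb m (0, coset v) = cyl_emb m (0, coset v')" using eq fr by metis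
    then show ?thesis by (simp add: cyl_emb_def)
  next
    case False
    then have "0 < pi * frac s" "pi * frac s < pi"
      using frac_lt_1[of s] frac_ge_0[of s] by auto
    then have "sin (pi * frac s) \<noteq> 0" using sin_gt_zero by fastforce
    then show ?thesis using eq fr by (simp add: cyl_emb_def)
  qed
  then have "lat (v' - v)" by (simp add: tor_emb_inj coset_eq_iff)
  then have "lat (apow m (- \<lfloor>s'\<rfloor>) (v' - v))" by (rule lat_apow)
  moreover have "apow m (- \<lfloor>s'\<rfloor>) (v' - v) = w' - apow m (\<lfloor>s\<rfloor> - \<lfloor>s'\<rfloor>) w"
    by (simp add: apow_diff v_def v'_def flip: apow_add)
  ultimately obtain i j where ij: "(w' - apow m (\<lfloor>s\<rfloor> - \<lfloor>s'\<rfloor>) w) $ 1 = of_int i"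
    "(w' - apow m (\<lfloor>s\<rfloor> - \<lfloor>s'\<rfloor>) w) $ 2 = of_int j"
    by (auto simp only: lat_2 elim!: Ints_cases)
  have "w' = apow m (\<lfloor>s\<rfloor> - \<lfloor>s'\<rfloor>) w + vector [of_int i, of_int j]"
    using ij by (simp add: vec2_eq_iff)
  moreover have "s' = s - of_int (\<lfloor>s\<rfloor> - \<lfloor>s'\<rfloor>)" using fr by (simp add: frac_def)
  ultimately have "y' = deck m (\<lfloor>s\<rfloor> - \<lfloor>s'\<rfloor>, i, j) y" by (simp add: deck_def y)
  then show ?thesis by blast
qed

lemma deck_fundamental: "\<exists>a. deck m a y \<in> {0..1} \<times> cbox 0 1"
proof -
  obtain s w where y: "y = (s, w)" by (metis surj_pair)
  define u where "u = apow m \<lfloor>s\<rfloor> w"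
  have "deck m (\<lfloor>s\<rfloor>, - \<lfloor>u $ 1\<rfloor>, - \<lfloor>u $ 2\<rfloor>) y \<in> {0..1} \<times> cbox 0 1"
    by (simp add: deck_def y mem_box_cart forall_2 u_def[symmetric] less_imp_le)
      linarith
  then show ?thesis by (rule exI)
qed

text \<open>Points of an open box with all sides 1 differ by less than 1 in every coordinate. The
  height forces \<open>n = 0\<close>, after which the element acts as an integral
  translation.\<close>

lemma deck_wandering:
  "\<exists>U. open U \<and> y \<in> U \<and> (\<forall>a. \<forall>u\<in>U. deck m a u \<in> U \<longrightarrow> a = (0, 0, 0))"
proof -
  obtain s w where y: "y = (s, w)" by (metis surj_pair)
  let ?c = "(1/2) *\<^sub>R (1 :: real^2)"
  let ?U = "{s - 1/2<..<s + 1/2} \<times> box (w - ?c) (w + ?c)"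
  have wand: "a = (0, 0, 0)" if "u \<in> ?U" "deck m a u \<in> ?U" for a u
  proof -
    obtain n i j where a: "a = (n, i, j)" by (metis prod_cases3)
    obtain t v where u: "u = (t, v)" by (metis surj_pair)
    have "\<bar>of_int n :: real\<bar> < 1" using that by (simp add: a u deck_def)
    then have n: "n = 0" by linarith
    have "\<bar>of_int i :: real\<bar> < 1" "\<bar>of_int j :: real\<bar> < 1"
      using that by (simp_all add: a u deck_def n mem_box_cart forall_2)
    then show ?thesis using n a by auto
  qed
  have "open ?U" "y \<in> ?U"
    by (auto simp: y mem_box_cart forall_2 intro!: open_Times)
  then show ?thesis
    by (intro exI[of _ ?U] conjI allI ballI impI) (assumption, assumption, rule wand)
qed

lemma fundamental_group_manifold_X:
  assumes "x \<in> topspace (manifold_X m)"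
  shows "group (fundamental_group (manifold_X m) x) \<and> (\<exists>f. f \<in> iso (fundamental_group (manifold_X m) x) (sdp m))"
proof -
  interpret Q: free_quotient "sdp m" "deck m" "manifold_X m" "cover m" "emb m" "{0..1} \<times> cbox 0 1"
  proof (intro free_quotient.intro plain_group.intro free_quotient_axioms.intro group_sdp)
    show "compact ({0..1::real} \<times> cbox 0 (1 :: real^2))"
      by (intro compact_Times compact_Icc compact_cbox)
    show "\<exists>a\<in>carrier (sdp m). deck m a y \<in> {0..1} \<times> cbox 0 1" for y
      using deck_fundamental by simp
    show "\<exists>U. open U \<and> y \<in> U \<and> (\<forall>a\<in>carrier (sdp m). \<forall>u\<in>U. deck m a u \<in> U \<longrightarrow> a = \<one>\<^bsub>sdp m\<^esub>)" for y
      using deck_wandering by simp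
    show "\<exists>a\<in>carrier (sdp m). y' = deck m a y" if "emb m (cover m y) = emb m (cover m y')" for y y'
      using emb_cover_eq[OF that] by simp
  qed (simp_all add: deck_mult deck_one continuous_on_deck cover_deck continuous_map_cover
      continuous_map_emb range_cover)
  obtain y where "cover m y = x" using assms range_cover by auto
  then show ?thesis by (rule Q.fundamental_group_iso)
qed

theorem theorem4p1:
  fixes k l :: int
  assumes "odd k" and "odd l"
    and "x \<in> topspace (manifold_X k)" and "y \<in> topspace (manifold_X l)"
  shows "pronilpotent_completion (fundamental_group (manifold_X k) x)
           \<cong> pronilpotent_completion (fundamental_group (manifold_X l) y)
       \<and> (\<not> [k * l = 1] (mod 8) \<and> \<not> [k * l = 7] (mod 8) \<longrightarrow>
           \<not> right_exact_Z_completion (fundamental_group (manifold_X k) x)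
             \<cong> right_exact_Z_completion (fundamental_group (manifold_X l) y))"
proof -
  obtain f g where G: "group (fundamental_group (manifold_X k) x)" "f \<in> iso (fundamental_group (manifold_X k) x) (sdp k)"
    and G': "group (fundamental_group (manifold_X l) y)" "g \<in> iso (fundamental_group (manifold_X l) y) (sdp l)"
    using fundamental_group_manifold_X[OF assms(3)] fundamental_group_manifold_X[OF assms(4)] by blast
  show ?thesis
    using completions_of_torus_groups[OF G G' assms(1,2)] by blast
qed

end
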